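(* For any degree $2d$ the sets $\mathcal{S}\Sigma_{2d}^*$ and $\mathcal{B}\Sigma_{2d}^*$ are spectrahedral cones.
   Context: Let $\Lambda_{2d}$ be the set of partitions of $2d$ and $\Lambda_{2d}^{\varepsilon}$ the set of partitions of $2d$ all of whose parts are even. For a partition $\lambda$, $p_\lambda=\prod_i p_{\lambda_i}$ with $p_r=X_1^r+\cdots+X_n^r$. $\mathcal{S}\Sigma_{2d}$ is the set of $c\in\mathbb{R}^{\Lambda_{2d}}$ such that for every $n\ge2d$ the form $\sum_\lambda c_\lambda p_\lambda(X_1,\dots,X_n)$ is a sum of squares of real polynomials; $\mathcal{B}\Sigma_{2d}\subset\mathbb{R}^{\Lambda_{2d}^\varepsilon}$ is defined in the same way with $\Lambda_{2d}^\varepsilon$ in place of $\Lambda_{2d}$. For a cone $K\subset\mathbb{R}^N$, $K^*=\{\varphi\in\mathbb{R}^N:\sum_i c_i\varphi_i\ge0\ \text{for all } c\in K\}$. A spectrahedral cone in $\mathbb{R}^N$ is a set of the form $\{x\in\mathbb{R}^N: L(x)\text{ is positive semidefinite}\}$, where $L(x)$ is a real symmetric matrix whose entries are (homogeneous) linear forms in $x$. *)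

theory Defs
  imports
    Complex_Main
    "HOL-Library.FuncSet"
    "HOL-Library.Multiset"
    "HOL-Library.Poly_Mapping"
    "Jordan_Normal_Form.Matrix"
begin

definition partitions_of :: "nat \<Rightarrow> nat multiset set" where
  "partitions_of k = {\<mu>. 0 \<notin># \<mu> \<and> sum_mset \<mu> = k}"

definition even_partitions_of :: "nat \<Rightarrow> nat multiset set" where
  "even_partitions_of k = {\<mu> \<in> partitions_of k. \<forall>r \<in># \<mu>. even r}"

(* Ensures that the sums over these index sets below are genuine finite sums. *)
lemma finite_partitions_of: "finite (partitions_of k)"
proof (rule finite_subset)
  show "partitions_of k \<subseteq> (\<Union>s\<le>k. multisets_of_size {..k} s)"
  proof
    fix \<mu> assume l: "\<mu> \<in> partitions_of k"
    have "size \<mu> \<le> sum_mset \<mu>" if "0 \<notin># \<mu>"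
      using that by (induction \<mu>) auto
    moreover have "r \<le> sum_mset \<mu>" if "r \<in># \<mu>" for r
      using that by (metis le_add1 multi_member_split sum_mset.add_mset)
    ultimately show "\<mu> \<in> (\<Union>s\<le>k. multisets_of_size {..k} s)"
      using l by (auto simp: partitions_of_def multisets_of_size_def)
  qed
  show "finite (\<Union>s\<le>k. multisets_of_size {..k} s)"
    by (auto intro: finite_multisets_of_size)
qed

lemma finite_even_partitions_of: "finite (even_partitions_of k)"
  unfolding even_partitions_of_def by (simp add: finite_partitions_of)


(* Real polynomials in variables X_1, X_2, ...: finitely supported maps from
   monomials (finitely supported exponent vectors) to coefficients; the ring
   structure is the convolution one of Poly_Mapping. *)
type_synonym real_mpoly = "(nat \<Rightarrow>\<^sub>0 nat) \<Rightarrow>\<^sub>0 real"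

definition Var :: "nat \<Rightarrow> real_mpoly" where
  "Var i = Poly_Mapping.single (Poly_Mapping.single i 1) 1"

definition Const :: "real \<Rightarrow> real_mpoly" where
  "Const a = Poly_Mapping.single 0 a"

(* The subring of polynomials in X_1, ..., X_n. *)
definition polys_in :: "nat \<Rightarrow> real_mpoly set" where
  "polys_in n = {f. \<forall>m \<in> Poly_Mapping.keys f. Poly_Mapping.keys m \<subseteq> {1..n}}"

definition sum_of_squares_in :: "nat \<Rightarrow> real_mpoly \<Rightarrow> bool" where
  "sum_of_squares_in n f \<longleftrightarrow>
     (\<exists>qs. set qs \<subseteq> polys_in n \<and> f = (\<Sum>q\<leftarrow>qs. q ^ 2))"

definition power_sum :: "nat \<Rightarrow> nat \<Rightarrow> real_mpoly" where
  "power_sum n r = (\<Sum>i = 1..n. Var i ^ r)"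

definition power_sum_partition :: "nat \<Rightarrow> nat multiset \<Rightarrow> real_mpoly" where
  "power_sum_partition n \<mu> = (\<Prod>r\<in>#\<mu>. power_sum n r)"


(* Real space with coordinates indexed by a finite set I; coordinates outside I are
   fixed to be undefined, so that points are determined by their I-coordinates. *)
definition coord_space :: "'i set \<Rightarrow> ('i \<Rightarrow> real) set" where
  "coord_space I = (I \<rightarrow>\<^sub>E UNIV)"

definition dual_cone :: "'i set \<Rightarrow> ('i \<Rightarrow> real) set \<Rightarrow> ('i \<Rightarrow> real) set" where
  "dual_cone I K = {\<phi> \<in> coord_space I. \<forall>c \<in> K. (\<Sum>i\<in>I. c i * \<phi> i) \<ge> 0}"

definition symmetric_mat :: "nat \<Rightarrow> real mat \<Rightarrow> bool" where
  "symmetric_mat m A \<longleftrightarrow> A \<in> carrier_mat m m \<and> transpose_mat A = A"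

definition psd_mat :: "nat \<Rightarrow> real mat \<Rightarrow> bool" where
  "psd_mat m A \<longleftrightarrow> symmetric_mat m A \<and> (\<forall>v \<in> carrier_vec m. v \<bullet> (A *\<^sub>v v) \<ge> 0)"

definition linear_form_on :: "'i set \<Rightarrow> (('i \<Rightarrow> real) \<Rightarrow> real) \<Rightarrow> bool" where
  "linear_form_on I l \<longleftrightarrow> (\<exists>a. \<forall>x \<in> coord_space I. l x = (\<Sum>i\<in>I. a i * x i))"

definition spectrahedral_cone :: "'i set \<Rightarrow> ('i \<Rightarrow> real) set \<Rightarrow> bool" where
  "spectrahedral_cone I K \<longleftrightarrow>
     (\<exists>(m::nat) (L :: ('i \<Rightarrow> real) \<Rightarrow> real mat).
        (\<forall>x \<in> coord_space I. symmetric_mat m (L x)) \<and>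
        (\<forall>i<m. \<forall>j<m. linear_form_on I (\<lambda>x. L x $$ (i, j))) \<and>
        K = {x \<in> coord_space I. psd_mat m (L x)})"


definition stable_sos :: "nat multiset set \<Rightarrow> nat \<Rightarrow> (nat multiset \<Rightarrow> real) set" where
  "stable_sos \<Lambda> N = {c \<in> coord_space \<Lambda>. \<forall>n\<ge>N.
     sum_of_squares_in n (\<Sum>\<mu>\<in>\<Lambda>. Const (c \<mu>) * power_sum_partition n \<mu>)}"

definition S_Sigma :: "nat \<Rightarrow> (nat multiset \<Rightarrow> real) set" where
  "S_Sigma k = stable_sos (partitions_of k) k"

definition B_Sigma :: "nat \<Rightarrow> (nat multiset \<Rightarrow> real) set" where
  "B_Sigma k = stable_sos (even_partitions_of k) k"

end

theory Submission
  imports Defs "HOL-Combinatorics.Multiset_Permutations"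
begin

text \<open>
  A symmetric form that is a sum of squares in \<open>n\<close> variables has a positive semidefinite Gram matrix
  \<open>Q\<close> that is invariant under \<open>S\<^sub>n\<close>, so \<open>Q(\<alpha>, \<beta>)\<close> only depends on the multiset of pairs
  \<open>(\<alpha>\<^sub>i, \<beta>\<^sub>i)\<close>, and its entries are bounded independently of \<open>n\<close>. Inclusion-exclusion over the
  set of common variables writes \<open>Q(\<alpha>, \<beta>)\<close> as a sum, over sets \<open>S\<close> of common variables, of
  cumulants in which the remaining variables of \<open>\<alpha>\<close> and \<open>\<beta>\<close> have been moved apart. As
  \<open>n\<close> grows, these cumulants are approximated by Gram matrices of alternating sums of coefficient
  vectors in which variables have been moved to fresh positions. The cumulants are indexed by the exponents
  on \<open>S\<close> and the type of the remaining exponents, a finite set of labels that does not depend on \<open>n\<close>.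
  Conversely, each quadratic form of rank one in the labels gives a sum of squares
  \<open>\<Sum>\<^sub>S g(x\<^sub>S; rest)\<^sup>2\<close> with the same power sum coefficients for all \<open>n\<close>. Hence a functional is in the
  dual cone iff a fixed finite matrix of its moments is positive semidefinite.

  Both cones are the cases \<open>m = 1, 2\<close> of partitions with all parts divisible by \<open>m\<close>. For these \<open>m\<close>,
  \<open>m dvd a + b\<close> is equivalent to \<open>a mod m = b mod m\<close>, so the entries of \<open>Q\<close> with \<open>\<alpha>\<close> and \<open>\<beta>\<close> not
  congruent modulo \<open>m\<close> do not contribute and can be replaced by \<open>0\<close>.
\<close>

text \<open>The Gram matrices obtained for different \<open>n\<close> are unrelated to each other,
  so no limit of them is formed. Instead \<open>c\<close> is fixed, and its pairing with the
  functional is written as the trace of \<open>kern q\<close> against the moment matrix. One Gram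
  matrix in a number of variables depending on \<open>N\<close> bounds this trace below by a fixed
  multiple of \<open>- 1 / N\<close>. This requires a bound on the diagonal that depends on
  \<open>c\<close> but not on \<open>n\<close>. Symmetry provides it: a diagonal entry depends only
  on the type of its monomial, and every type of degree \<open>d\<close> already occurs in
  \<open>d\<close> variables. The obstacle is that \<open>kern q\<close> is not itself a Gram
  matrix. The entry at \<open>(j, j')\<close> describes two monomials whose remaining variables are
  disjoint, even for \<open>j = j'\<close>, whereas a monomial paired with itself shares all its
  variables. For this reason each label is represented by many copies on disjoint blocks of fresh
  variables.\<close>

type_synonym mono = "nat \<Rightarrow>\<^sub>0 nat"

abbreviation "lookup \<equiv> Poly_Mapping.lookup"
abbreviation "keys \<equiv> Poly_Mapping.keys"
abbreviation "single \<equiv> Poly_Mapping.single"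
abbreviation "rename \<equiv> Poly_Mapping.map_key"

definition mdeg :: "mono \<Rightarrow> nat" where
  "mdeg \<alpha> = (\<Sum>i\<in>keys \<alpha>. lookup \<alpha> i)"

definition mtype :: "mono \<Rightarrow> nat multiset" where
  "mtype \<alpha> = image_mset (lookup \<alpha>) (mset_set (keys \<alpha>))"

text \<open>Complete invariant of the orbit of a pair of monomials under simultaneous permutation of
  the variables. Positions where both exponents vanish are omitted, so it does not depend on the
  number of variables.\<close>

definition ptype :: "mono \<Rightarrow> mono \<Rightarrow> (nat \<times> nat) multiset" where
  "ptype \<alpha> \<beta> = image_mset (\<lambda>i. (lookup \<alpha> i, lookup \<beta> i)) (mset_set (keys \<alpha> \<union> keys \<beta>))"

definition splits :: "mono \<Rightarrow> (mono \<times> mono) set" where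
  "splits \<gamma> = {(\<alpha>, \<beta>). \<alpha> + \<beta> = \<gamma>}"

subsection \<open>Monomials\<close>

lemma keys_plus_nat: "keys (\<alpha> + \<beta> :: mono) = keys \<alpha> \<union> keys \<beta>"
  by (auto simp: in_keys_iff lookup_add)

lemma finite_bounded_monos:
  assumes "finite A"
  shows "finite {\<alpha> :: mono. keys \<alpha> \<subseteq> A \<and> (\<forall>i. lookup \<alpha> i \<le> k)}"
proof (rule finite_imageD)
  show "finite (lookup ` {\<alpha> :: mono. keys \<alpha> \<subseteq> A \<and> (\<forall>i. lookup \<alpha> i \<le> k)})"
  proof (rule finite_subset)
    show "lookup ` {\<alpha> :: mono. keys \<alpha> \<subseteq> A \<and> (\<forall>i. lookup \<alpha> i \<le> k)} \<subseteq>
        {f. \<forall>i. (i \<in> A \<longrightarrow> f i \<in> {..k}) \<and> (i \<notin> A \<longrightarrow> f i = 0)}"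
      unfolding image_subset_iff by (simp add: subset_iff in_keys_iff) blast
  qed (intro finite_set_of_finite_funs assms finite_atMost)
  show "inj_on lookup {\<alpha> :: mono. keys \<alpha> \<subseteq> A \<and> (\<forall>i. lookup \<alpha> i \<le> k)}"
    by (simp add: inj_on_def)
qed

lemma lookup_le_mdeg: "lookup \<alpha> i \<le> mdeg \<alpha>"
proof (cases "i \<in> keys \<alpha>")
  case True
  then show ?thesis unfolding mdeg_def by (intro member_le_sum) auto
qed (auto simp: in_keys_iff)

lemma finite_monos_mdeg:
  assumes "finite A"
  shows "finite {\<alpha>. keys \<alpha> \<subseteq> A \<and> mdeg \<alpha> = k}"
  by (rule finite_subset[OF _ finite_bounded_monos[OF assms, of k]]) (auto simp: lookup_le_mdeg)

lemma finite_splits [simp]: "finite (splits \<gamma>)"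
proof (rule finite_subset)
  let ?B = "{\<alpha> :: mono. keys \<alpha> \<subseteq> keys \<gamma> \<and> (\<forall>i. lookup \<alpha> i \<le> mdeg \<gamma>)}"
  have "lookup \<alpha> i \<le> mdeg (\<alpha> + \<beta>)" "lookup \<beta> i \<le> mdeg (\<alpha> + \<beta>)" for \<alpha> \<beta> i
    using lookup_le_mdeg[of "\<alpha> + \<beta>" i] by (auto simp: lookup_add)
  then show "splits \<gamma> \<subseteq> ?B \<times> ?B"
    by (auto simp: splits_def keys_plus_nat)
  show "finite (?B \<times> ?B)"
    by (intro finite_cartesian_product finite_bounded_monos) auto
qed

lemma mdeg_altdef: "finite A \<Longrightarrow> keys \<alpha> \<subseteq> A \<Longrightarrow> mdeg \<alpha> = (\<Sum>i\<in>A. lookup \<alpha> i)"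
  unfolding mdeg_def by (intro sum.mono_neutral_left) (auto simp: in_keys_iff)

lemma mdeg_plus: "mdeg (\<alpha> + \<beta>) = mdeg \<alpha> + mdeg \<beta>"
proof -
  let ?A = "keys \<alpha> \<union> keys \<beta>"
  have "mdeg (\<alpha> + \<beta>) = (\<Sum>i\<in>?A. lookup (\<alpha> + \<beta>) i)"
    by (rule mdeg_altdef) (auto simp: keys_plus_nat)
  also have "\<dots> = mdeg \<alpha> + mdeg \<beta>"
    by (simp add: mdeg_altdef[of ?A] lookup_add sum.distrib)
  finally show ?thesis .
qed

lemma mdeg_single [simp]: "mdeg (single i r) = r"
  by (simp add: mdeg_def)

lemma sum_mtype: "sum_mset (mtype \<alpha>) = mdeg \<alpha>"
  by (simp add: mtype_def mdeg_def sum_unfold_sum_mset)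

lemma zero_notin_mtype [simp]: "0 \<notin># mtype \<alpha>"
  by (auto simp: mtype_def in_keys_iff)

lemma in_mtype_iff: "r \<in># mtype \<alpha> \<longleftrightarrow> (\<exists>i\<in>keys \<alpha>. lookup \<alpha> i = r)"
  by (auto simp: mtype_def)

lemma size_mtype [simp]: "size (mtype \<alpha>) = card (keys \<alpha>)"
  by (simp add: mtype_def)

lemma mtype_eq_empty_iff [simp]: "mtype \<alpha> = {#} \<longleftrightarrow> \<alpha> = 0"
  by (simp add: mtype_def mset_set_empty_iff)

lemma mtype_add_single:
  assumes "i \<notin> keys \<alpha>" "r > 0"
  shows "mtype (\<alpha> + single i r) = add_mset r (mtype \<alpha>)"
proof -
  have "keys (\<alpha> + single i r) = insert i (keys \<alpha>)"
    using assms by (auto simp: keys_plus_nat)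
  moreover have "image_mset (lookup (\<alpha> + single i r)) (mset_set (keys \<alpha>)) =
      image_mset (lookup \<alpha>) (mset_set (keys \<alpha>))"
    by (rule image_mset_cong) (use assms in \<open>auto simp: lookup_add lookup_single when_def\<close>)
  ultimately show ?thesis
    using assms by (simp add: mtype_def lookup_add in_keys_iff)
qed

lemma ptype_add_single:
  assumes "i \<notin> keys \<alpha> \<union> keys \<beta>" "x > 0 \<or> y > 0"
  shows "ptype (\<alpha> + single i x) (\<beta> + single i y) = add_mset (x, y) (ptype \<alpha> \<beta>)"
proof -
  let ?f = "\<lambda>\<alpha> \<beta> i. (lookup \<alpha> i, lookup \<beta> i)"
  have "keys (\<alpha> + single i x) \<union> keys (\<beta> + single i y) = insert i (keys \<alpha> \<union> keys \<beta>)"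
    using assms by (auto simp: keys_plus_nat)
  moreover have "image_mset (?f (\<alpha> + single i x) (\<beta> + single i y)) (mset_set (keys \<alpha> \<union> keys \<beta>)) =
      image_mset (?f \<alpha> \<beta>) (mset_set (keys \<alpha> \<union> keys \<beta>))"
    by (rule image_mset_cong) (use assms in \<open>auto simp: lookup_add lookup_single when_def\<close>)
  ultimately show ?thesis
    using assms by (simp add: ptype_def lookup_add in_keys_iff)
qed

lemma ptype_add_single_left:
  assumes "i \<notin> keys \<alpha> \<union> keys \<beta>" "x > 0"
  shows "ptype (\<alpha> + single i x) \<beta> = add_mset (x, 0) (ptype \<alpha> \<beta>)"
  using ptype_add_single[of i \<alpha> \<beta> x 0] assms by simp

lemma ptype_add_single_right:
  assumes "i \<notin> keys \<alpha> \<union> keys \<beta>" "y > 0"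
  shows "ptype \<alpha> (\<beta> + single i y) = add_mset (0, y) (ptype \<alpha> \<beta>)"
  using ptype_add_single[of i \<alpha> \<beta> 0 y] assms by simp

lemma ptype_same: "ptype \<alpha> \<alpha> = image_mset (\<lambda>r. (r, r)) (mtype \<alpha>)"
  by (simp add: ptype_def mtype_def multiset.map_comp o_def)

lemma ptype_disjoint:
  assumes "keys \<alpha> \<inter> keys \<beta> = {}"
  shows "ptype \<alpha> \<beta> = image_mset (\<lambda>r. (r, 0)) (mtype \<alpha>) + image_mset (\<lambda>r. (0, r)) (mtype \<beta>)"
proof -
  have "image_mset (\<lambda>i. (lookup \<alpha> i, lookup \<beta> i)) (mset_set (keys \<alpha>)) =
      image_mset (\<lambda>i. (lookup \<alpha> i, 0)) (mset_set (keys \<alpha>))"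
    by (rule image_mset_cong) (use assms in \<open>auto simp: in_keys_iff\<close>)
  moreover have "image_mset (\<lambda>i. (lookup \<alpha> i, lookup \<beta> i)) (mset_set (keys \<beta>)) =
      image_mset (\<lambda>i. (0, lookup \<beta> i)) (mset_set (keys \<beta>))"
    by (rule image_mset_cong) (use assms in \<open>auto simp: in_keys_iff\<close>)
  ultimately show ?thesis
    using assms by (simp add: ptype_def mtype_def multiset.map_comp o_def mset_set_Union)
qed

lemma exists_mono_with_mtype:
  assumes "0 \<notin># \<nu>"
  shows "\<exists>\<gamma>. mtype \<gamma> = \<nu> \<and> keys \<gamma> = {k + 1..k + size \<nu>}"
  using assms
proof (induction \<nu>)
  case empty
  then show ?case by (intro exI[of _ 0]) simp
next
  case (add r \<nu>)
  then obtain \<gamma> where g: "mtype \<gamma> = \<nu>" "keys \<gamma> = {k + 1..k + size \<nu>}" by auto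
  let ?i = "k + size \<nu> + 1"
  have "r > 0" "?i \<notin> keys \<gamma>" using add.prems g by auto
  then show ?case
    by (intro exI[of _ "\<gamma> + single ?i r"]) (auto simp: mtype_add_single g keys_plus_nat)
qed

text \<open>With \<open>k = 0\<close> this is a normal form for a type; other offsets place
  representatives on disjoint blocks of variables. Only the type and the support are ever used, so
  the choice among the candidates is immaterial.\<close>

definition mono_at :: "nat \<Rightarrow> nat multiset \<Rightarrow> mono" where
  "mono_at k \<nu> = (SOME \<gamma>. mtype \<gamma> = \<nu> \<and> keys \<gamma> = {k + 1..k + size \<nu>})"

lemma
  assumes "0 \<notin># \<nu>"
  shows mtype_mono_at: "mtype (mono_at k \<nu>) = \<nu>"
    and keys_mono_at: "keys (mono_at k \<nu>) = {k + 1..k + size \<nu>}"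
  using someI_ex[OF exists_mono_with_mtype[OF assms, of k]] by (auto simp: mono_at_def)

section \<open>The action of permutations of the variables on exponent vectors\<close>

lemma lookup_rename: "bij \<pi> \<Longrightarrow> lookup (rename \<pi> \<alpha>) i = lookup \<alpha> (\<pi> i)"
  by (simp add: map_key.rep_eq bij_is_inj)

lemma keys_rename: "bij \<pi> \<Longrightarrow> keys (rename \<pi> \<alpha>) = \<pi> -` keys \<alpha>"
  by (simp add: keys_map_key bij_is_inj)

lemma rename_plus: "bij \<pi> \<Longrightarrow> rename \<pi> (\<alpha> + \<beta>) = rename \<pi> \<alpha> + rename \<pi> (\<beta> :: mono)"
  by (simp add: map_key_plus bij_is_inj)

lemma rename_rename: "bij \<pi> \<Longrightarrow> bij \<sigma> \<Longrightarrow> rename \<sigma> (rename \<pi> \<alpha>) = rename (\<pi> \<circ> \<sigma>) (\<alpha> :: mono)"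
  by (simp add: map_key_compose bij_is_inj)

lemma rename_inv:
  assumes "bij \<pi>"
  shows "rename (inv_into UNIV \<pi>) (rename \<pi> \<alpha>) = (\<alpha> :: mono)" "rename \<pi> (rename (inv_into UNIV \<pi>) \<alpha>) = (\<alpha> :: mono)"
proof -
  have "\<pi> (inv_into UNIV \<pi> i) = i" "inv_into UNIV \<pi> (\<pi> i) = i" for i
    using assms by (simp_all add: surj_f_inv_f bij_is_surj inv_f_f bij_is_inj)
  then show "rename (inv_into UNIV \<pi>) (rename \<pi> \<alpha>) = \<alpha>" "rename \<pi> (rename (inv_into UNIV \<pi>) \<alpha>) = \<alpha>"
    by (simp_all add: poly_mapping_eqI lookup_rename assms bij_imp_bij_inv)
qed

lemma mset_set_vimage_bij:
  assumes "bij \<pi>" "finite A"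
  shows "image_mset \<pi> (mset_set (\<pi> -` A)) = mset_set A"
  using assms by (subst image_mset_mset_set) (auto simp: bij_is_surj surj_image_vimage_eq inj_on_subset[OF bij_is_inj])

lemma ptype_rename:
  assumes "bij \<pi>"
  shows "ptype (rename \<pi> \<alpha>) (rename \<pi> \<beta>) = ptype \<alpha> \<beta>"
proof -
  have "ptype (rename \<pi> \<alpha>) (rename \<pi> \<beta>) =
      image_mset (\<lambda>i. (lookup \<alpha> i, lookup \<beta> i)) (image_mset \<pi> (mset_set (\<pi> -` (keys \<alpha> \<union> keys \<beta>))))"
    using assms by (simp add: ptype_def lookup_rename keys_rename vimage_Un multiset.map_comp o_def)
  then show ?thesis
    using assms by (subst (asm) mset_set_vimage_bij) (auto simp: ptype_def)
qed

lemma mtype_via_ptype: "mtype \<alpha> = image_mset fst (ptype \<alpha> \<alpha>)"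
  by (simp add: ptype_same multiset.map_comp o_def)

lemma mtype_rename: "bij \<pi> \<Longrightarrow> mtype (rename \<pi> \<alpha>) = mtype \<alpha>"
  by (simp add: mtype_via_ptype ptype_rename)

lemma mdeg_rename: "bij \<pi> \<Longrightarrow> mdeg (rename \<pi> \<alpha>) = mdeg \<alpha>"
  by (simp add: mtype_rename flip: sum_mtype)

text \<open>Padding with pairs \<open>(0, 0)\<close> up to \<open>card A\<close> turns both pair
  types into images of the same set \<open>A\<close>; equal images of a finite set differ by a
  permutation of it. Outside \<open>A\<close> all exponents vanish and the permutation is the
  identity.\<close>

lemma ptype_eq_imp_rename:
  assumes eq: "ptype \<alpha> \<beta> = ptype \<alpha>' \<beta>'"
    and keys: "keys \<alpha> \<subseteq> A" "keys \<beta> \<subseteq> A" "keys \<alpha>' \<subseteq> A" "keys \<beta>' \<subseteq> A" and "finite A"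
  obtains \<pi> where "\<pi> permutes A" "\<alpha> = rename \<pi> \<alpha>'" "\<beta> = rename \<pi> \<beta>'"
proof -
  have pad: "image_mset (\<lambda>i. (lookup \<alpha> i, lookup \<beta> i)) (mset_set A) =
      ptype \<alpha> \<beta> + replicate_mset (card A - size (ptype \<alpha> \<beta>)) (0, 0)"
    if "keys \<alpha> \<subseteq> A" "keys \<beta> \<subseteq> A" for \<alpha> \<beta> :: mono
  proof -
    let ?K = "keys \<alpha> \<union> keys \<beta>"
    have "mset_set A = mset_set ?K + mset_set (A - ?K)"
      using that \<open>finite A\<close> by (subst mset_set_Union[symmetric]) (auto intro: arg_cong[of _ _ mset_set])
    moreover have "image_mset (\<lambda>i. (lookup \<alpha> i, lookup \<beta> i)) (mset_set (A - ?K)) =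
        image_mset (\<lambda>i. (0, 0)) (mset_set (A - ?K))"
      by (rule image_mset_cong) (use \<open>finite A\<close> in \<open>auto simp: in_keys_iff\<close>)
    ultimately show ?thesis
      using that by (simp add: ptype_def image_mset_const_eq card_Diff_subset)
  qed
  have "image_mset (\<lambda>i. (lookup \<alpha> i, lookup \<beta> i)) (mset_set A) =
      image_mset (\<lambda>i. (lookup \<alpha>' i, lookup \<beta>' i)) (mset_set A)"
    by (simp add: pad keys eq)
  from image_mset_eq_implies_permutes[OF \<open>finite A\<close> this] obtain \<pi>
    where p: "\<pi> permutes A"
      and l: "\<forall>i\<in>A. (lookup \<alpha> i, lookup \<beta> i) = (lookup \<alpha>' (\<pi> i), lookup \<beta>' (\<pi> i))" .
  have *: "\<gamma> = rename \<pi> \<gamma>'"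
    if "\<forall>i\<in>A. lookup \<gamma> i = lookup \<gamma>' (\<pi> i)" "keys \<gamma> \<subseteq> A" "keys \<gamma>' \<subseteq> A" for \<gamma> \<gamma>' :: mono
  proof (rule poly_mapping_eqI)
    fix i show "lookup \<gamma> i = lookup (rename \<pi> \<gamma>') i"
    proof (cases "i \<in> A")
      case False
      then have "lookup \<gamma> i = 0" "lookup \<gamma>' i = 0" "\<pi> i = i"
        using that p by (auto simp: in_keys_iff permutes_def)
      then show ?thesis using p by (simp add: lookup_rename permutes_bij)
    qed (use that p in \<open>auto simp: lookup_rename permutes_bij\<close>)
  qed
  show thesis
    by (rule that[OF p]) (use l keys in \<open>auto intro!: *\<close>)
qed

lemma mtype_eq_imp_rename:
  assumes "mtype \<alpha> = mtype \<alpha>'" "keys \<alpha> \<subseteq> A" "keys \<alpha>' \<subseteq> A" "finite A"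
  obtains \<pi> where "\<pi> permutes A" "\<alpha> = rename \<pi> \<alpha>'"
  using ptype_eq_imp_rename[of \<alpha> \<alpha> \<alpha>' \<alpha>' A] assms by (auto simp: ptype_same)

lemma splits_rename:
  assumes "bij \<pi>"
  shows "bij_betw (map_prod (rename \<pi>) (rename \<pi>)) (splits \<gamma>) (splits (rename \<pi> \<gamma>))"
proof (rule bij_betw_byWitness[where f' = "map_prod (rename (inv_into UNIV \<pi>)) (rename (inv_into UNIV \<pi>))"])
  have inv: "bij (inv_into UNIV \<pi>)" using assms by (rule bij_imp_bij_inv)
  show "map_prod (rename \<pi>) (rename \<pi>) ` splits \<gamma> \<subseteq> splits (rename \<pi> \<gamma>)"
    using rename_plus[OF assms] by (auto simp: splits_def)
  show "map_prod (rename (inv_into UNIV \<pi>)) (rename (inv_into UNIV \<pi>)) ` splits (rename \<pi> \<gamma>) \<subseteq> splits \<gamma>"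
    using rename_inv(1)[OF assms, of \<gamma>] by (auto simp: splits_def simp flip: rename_plus[OF inv])
qed (auto simp: rename_inv[OF assms])

subsection \<open>Coefficients of power sums\<close>

lemma lookup_mult_splits:
  fixes p q :: real_mpoly
  shows "lookup (p * q) \<gamma> = (\<Sum>(\<alpha>, \<beta>)\<in>splits \<gamma>. lookup p \<alpha> * lookup q \<beta>)"
proof -
  have inner: "(\<Sum>\<beta>. lookup q \<beta> when \<gamma> = \<alpha> + \<beta>) = (\<Sum>\<beta>\<in>{\<beta>. (\<alpha>, \<beta>) \<in> splits \<gamma>}. lookup q \<beta>)" for \<alpha>
  proof -
    have fin: "finite {\<beta>. (\<alpha>, \<beta>) \<in> splits \<gamma>}"
      by (rule finite_subset[of _ "snd ` splits \<gamma>"]) (force simp: image_iff)+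
    show ?thesis
      by (subst Sum_any.expand_superset[OF fin])
        (auto simp: splits_def when_def intro!: sum.cong)
  qed
  have fin: "finite (fst ` splits \<gamma>)" by simp
  have "lookup (p * q) \<gamma> = (\<Sum>\<alpha>\<in>fst ` splits \<gamma>. lookup p \<alpha> * (\<Sum>\<beta>\<in>{\<beta>. (\<alpha>, \<beta>) \<in> splits \<gamma>}. lookup q \<beta>))"
    unfolding lookup_mult inner
  proof (rule Sum_any.expand_superset[OF fin], clarify)
    fix \<alpha> assume "lookup p \<alpha> * (\<Sum>\<beta>\<in>{\<beta>. (\<alpha>, \<beta>) \<in> splits \<gamma>}. lookup q \<beta>) \<noteq> 0"
    then have "{\<beta>. (\<alpha>, \<beta>) \<in> splits \<gamma>} \<noteq> {}" by (metis mult_zero_right sum.empty)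
    then show "\<alpha> \<in> fst ` splits \<gamma>" by force
  qed
  also have "\<dots> = (\<Sum>(\<alpha>, \<beta>)\<in>(SIGMA \<alpha>:fst ` splits \<gamma>. {\<beta>. (\<alpha>, \<beta>) \<in> splits \<gamma>}). lookup p \<alpha> * lookup q \<beta>)"
    unfolding sum_distrib_left
  proof (rule sum.Sigma[OF fin], rule ballI)
    fix \<alpha> show "finite {\<beta>. (\<alpha>, \<beta>) \<in> splits \<gamma>}"
      by (rule finite_subset[of _ "snd ` splits \<gamma>"]) (force simp: image_iff)+
  qed
  also have "(SIGMA \<alpha>:fst ` splits \<gamma>. {\<beta>. (\<alpha>, \<beta>) \<in> splits \<gamma>}) = splits \<gamma>"
    by force
  finally show ?thesis .
qed

lemma lookup_single_mult:
  "lookup (single (single i r) 1 * p :: real_mpoly) \<gamma> = (if r \<le> lookup \<gamma> i then lookup p (\<gamma> - single i r) else 0)"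
proof -
  have "(\<alpha>, \<beta>) \<in> splits \<gamma> \<and> \<alpha> = single i r \<longleftrightarrow> r \<le> lookup \<gamma> i \<and> \<alpha> = single i r \<and> \<beta> = \<gamma> - single i r" for \<alpha> \<beta>
    by (auto simp: splits_def lookup_add lookup_minus lookup_single when_def intro!: poly_mapping_eqI)
  then have "x \<in> splits \<gamma> \<and> fst x = single i r \<longleftrightarrow> r \<le> lookup \<gamma> i \<and> x = (single i r, \<gamma> - single i r)" for x
    by (metis prod.collapse prod.inject)
  then have *: "{x \<in> splits \<gamma>. fst x = single i r} = (if r \<le> lookup \<gamma> i then {(single i r, \<gamma> - single i r)} else {})"
    by (simp add: set_eq_iff)
  have "lookup (single (single i r) 1 * p) \<gamma> =
      (\<Sum>x\<in>splits \<gamma>. if fst x = single i r then lookup p (snd x) else 0)"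
    unfolding lookup_mult_splits by (rule sum.cong) (auto simp: lookup_single when_def)
  also have "\<dots> = (\<Sum>x\<in>{x \<in> splits \<gamma>. fst x = single i r}. lookup p (snd x))"
    by (rule sum.inter_filter[symmetric]) simp
  finally show ?thesis by (simp add: *)
qed

lemma Var_power: "Var i ^ r = single (single i r) 1"
  by (induction r) (simp_all add: Var_def mult_single flip: single_add)

lemma power_sum_partition_empty [simp]: "power_sum_partition n {#} = 1"
  by (simp add: power_sum_partition_def)

text \<open>The factor for \<open>r\<close> selects the variable \<open>i\<close> that receives the
  exponent \<open>r\<close>; the condition guards the truncated subtraction. The facts on
  coefficients below are inductions along this recursion.\<close>

lemma lookup_power_sum_partition_add:
  "lookup (power_sum_partition n (add_mset r \<mu>)) \<gamma> =
     (\<Sum>i = 1..n. if r \<le> lookup \<gamma> i then lookup (power_sum_partition n \<mu>) (\<gamma> - single i r) else 0)"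
proof -
  have "power_sum_partition n (add_mset r \<mu>) =
      (\<Sum>i = 1..n. single (single i r) 1 * power_sum_partition n \<mu>)"
    by (simp add: power_sum_partition_def power_sum_def sum_distrib_right Var_power)
  then show ?thesis
    by (simp add: lookup_sum lookup_single_mult)
qed

lemma lookup_power_sum_partition_add_nonzeroE:
  assumes "lookup (power_sum_partition n (add_mset r \<mu>)) \<gamma> \<noteq> 0"
  obtains j where "j \<in> {1..n}" "r \<le> lookup \<gamma> j"
    "lookup (power_sum_partition n \<mu>) (\<gamma> - single j r) \<noteq> 0"
proof -
  obtain j where "j \<in> {1..n}" "(if r \<le> lookup \<gamma> j
      then lookup (power_sum_partition n \<mu>) (\<gamma> - single j r) else 0) \<noteq> 0"
    using assms unfolding lookup_power_sum_partition_add by (rule sum.not_neutral_contains_not_neutral)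
  then show thesis by (intro that[of j]) (auto split: if_splits)
qed

lemma minus_single_plus: "r \<le> lookup \<gamma> i \<Longrightarrow> \<gamma> - single i r + single i r = (\<gamma> :: mono)"
  by (auto intro!: poly_mapping_eqI simp: lookup_add lookup_minus lookup_single when_def)

lemma lookup_power_sum_partition_nonzeroD:
  assumes "lookup (power_sum_partition n \<mu>) \<gamma> \<noteq> 0"
  shows "keys \<gamma> \<subseteq> {1..n}" "mdeg \<gamma> = sum_mset \<mu>"
    "\<forall>r\<in>#\<mu>. m dvd r \<Longrightarrow> m dvd lookup \<gamma> i"
proof -
  have "keys \<gamma> \<subseteq> {1..n} \<and> mdeg \<gamma> = sum_mset \<mu> \<and> ((\<forall>r\<in>#\<mu>. m dvd r) \<longrightarrow> (\<forall>i. m dvd lookup \<gamma> i))"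
    using assms
  proof (induction \<mu> arbitrary: \<gamma>)
    case empty
    then show ?case by (auto simp: lookup_one when_def mdeg_def split: if_splits)
  next
    case (add r \<mu>)
    obtain j where j: "j \<in> {1..n}" "r \<le> lookup \<gamma> j"
      "lookup (power_sum_partition n \<mu>) (\<gamma> - single j r) \<noteq> 0"
      using lookup_power_sum_partition_add_nonzeroE[OF add.prems] .
    define \<delta> where "\<delta> = \<gamma> - single j r"
    have \<gamma>: "\<gamma> = \<delta> + single j r" using minus_single_plus[OF j(2)] by (simp add: \<delta>_def)
    have IH: "keys \<delta> \<subseteq> {1..n}" "mdeg \<delta> = sum_mset \<mu>"
      "\<forall>r\<in>#\<mu>. m dvd r \<Longrightarrow> m dvd lookup \<delta> i" for i
      using add.IH[OF j(3)] by (simp_all add: \<delta>_def)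
    have "keys \<gamma> \<subseteq> {1..n}" using IH(1) j(1) by (auto simp: \<gamma> keys_plus_nat split: if_splits)
    moreover have "mdeg \<gamma> = sum_mset (add_mset r \<mu>)" using IH(2) by (simp add: \<gamma> mdeg_plus)
    moreover have "m dvd lookup \<gamma> i" if "\<forall>r\<in>#add_mset r \<mu>. m dvd r" for i
      using IH(3)[of i] that by (simp add: \<gamma> lookup_add lookup_single when_def)
    ultimately show ?case by blast
  qed
  then show "keys \<gamma> \<subseteq> {1..n}" "mdeg \<gamma> = sum_mset \<mu>"
    "\<forall>r\<in>#\<mu>. m dvd r \<Longrightarrow> m dvd lookup \<gamma> i" by auto
qed

text \<open>The additional variables have exponent 0 in \<open>\<gamma>\<close>, so no positive part
  can be placed on them. A part 0 would contribute the factor \<open>n\<close>, which does change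
  with the number of variables.\<close>

lemma lookup_power_sum_partition_mono:
  assumes "keys \<gamma> \<subseteq> {1..n}" "n \<le> n'" "0 \<notin># \<mu>"
  shows "lookup (power_sum_partition n' \<mu>) \<gamma> = lookup (power_sum_partition n \<mu>) \<gamma>"
  using assms(1,3)
proof (induction \<mu> arbitrary: \<gamma>)
  case (add r \<mu>)
  have "lookup (power_sum_partition n' (add_mset r \<mu>)) \<gamma> =
     (\<Sum>i = 1..n. if r \<le> lookup \<gamma> i then lookup (power_sum_partition n' \<mu>) (\<gamma> - single i r) else 0)"
    unfolding lookup_power_sum_partition_add
  proof (rule sum.mono_neutral_right)
    show "\<forall>i\<in>{1..n'} - {1..n}. (if r \<le> lookup \<gamma> i
        then lookup (power_sum_partition n' \<mu>) (\<gamma> - single i r) else 0) = 0"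
    proof
      fix i assume "i \<in> {1..n'} - {1..n}"
      then have "lookup \<gamma> i = 0" using add.prems(1) by (meson DiffD2 in_keys_iff subsetD)
      then show "(if r \<le> lookup \<gamma> i then lookup (power_sum_partition n' \<mu>) (\<gamma> - single i r) else 0) = 0"
        using add.prems(2) by simp
    qed
  qed (use assms(2) in auto)
  also have "\<dots> = lookup (power_sum_partition n (add_mset r \<mu>)) \<gamma>"
    unfolding lookup_power_sum_partition_add
  proof (rule sum.cong[OF refl], rule if_cong[OF refl _ refl])
    fix i
    have "keys (\<gamma> - single i r) \<subseteq> {1..n}" using add.prems by (auto simp: in_keys_iff lookup_minus)
    then show "lookup (power_sum_partition n' \<mu>) (\<gamma> - single i r) = lookup (power_sum_partition n \<mu>) (\<gamma> - single i r)"
      using add by auto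
  qed
  finally show ?case .
qed simp

lemma lookup_power_sum_partition_rename:
  assumes "\<pi> permutes {1..n}"
  shows "lookup (power_sum_partition n \<mu>) (rename \<pi> \<gamma>) = lookup (power_sum_partition n \<mu>) \<gamma>"
proof (induction \<mu> arbitrary: \<gamma>)
  case empty
  have "rename \<pi> \<gamma> = 0 \<longleftrightarrow> \<gamma> = 0"
    using assms mtype_rename[of \<pi> \<gamma>] by (metis mtype_eq_empty_iff permutes_bij)
  then show ?case by (simp add: lookup_one)
next
  case (add r \<mu>)
  have b: "bij \<pi>" using assms by (rule permutes_bij)
  have sub: "rename \<pi> \<gamma> - single i r = rename \<pi> (\<gamma> - single (\<pi> i) r)" for i
    using b by (auto intro!: poly_mapping_eqI simp: lookup_minus lookup_single lookup_rename when_def bij_is_inj inj_eq)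
  show ?case
    unfolding lookup_power_sum_partition_add sub add.IH lookup_rename[OF b]
    by (subst (2) sum.permute[OF assms]) (simp add: o_def)
qed

text \<open>The coefficient of a monomial of type \<open>\<nu>\<close> in \<open>p\<^sub>\<mu>\<close>, which does not depend on
  the number of variables.\<close>

definition transition :: "nat multiset \<Rightarrow> nat multiset \<Rightarrow> real" where
  "transition \<mu> \<nu> = lookup (power_sum_partition (size \<nu>) \<mu>) (mono_at 0 \<nu>)"

lemma lookup_power_sum_partition:
  assumes "keys \<gamma> \<subseteq> {1..n}" "0 \<notin># \<mu>"
  shows "lookup (power_sum_partition n \<mu>) \<gamma> = transition \<mu> (mtype \<gamma>)"
proof -
  let ?\<delta> = "mono_at 0 (mtype \<gamma>)"
  have \<delta>: "mtype ?\<delta> = mtype \<gamma>" "keys ?\<delta> = {1..size (mtype \<gamma>)}"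
    using mtype_mono_at[of "mtype \<gamma>" 0] keys_mono_at[of "mtype \<gamma>" 0] by auto
  have sz: "size (mtype \<gamma>) \<le> n"
    using card_mono[OF _ assms(1)] by simp
  obtain \<pi> where "\<pi> permutes {1..n}" "\<gamma> = rename \<pi> ?\<delta>"
    by (rule mtype_eq_imp_rename[of \<gamma> ?\<delta> "{1..n}"]) (use \<delta> sz assms in auto)
  then have "lookup (power_sum_partition n \<mu>) \<gamma> = lookup (power_sum_partition n \<mu>) ?\<delta>"
    using lookup_power_sum_partition_rename by metis
  also have "\<dots> = transition \<mu> (mtype \<gamma>)"
    unfolding transition_def by (rule lookup_power_sum_partition_mono) (use \<delta> sz assms in auto)
  finally show ?thesis .
qed

section \<open>Triangularity of the passage from power sums to monomial symmetric functions\<close>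

lemma mtype_minus_single_cases:
  assumes "r \<le> lookup \<gamma> i" "r > 0"
  shows "(lookup \<gamma> i = r \<and> mtype \<gamma> = add_mset r (mtype (\<gamma> - single i r))) \<or>
    (lookup \<gamma> i > r \<and> card (keys (\<gamma> - single i r)) = card (keys \<gamma>))"
proof (cases "lookup \<gamma> i = r")
  case True
  then have "i \<notin> keys (\<gamma> - single i r)" by (simp add: in_keys_iff lookup_minus)
  then show ?thesis
    using mtype_add_single[of i "\<gamma> - single i r" r] assms True by (simp add: minus_single_plus)
next
  case False
  then have "keys (\<gamma> - single i r) = keys \<gamma>"
    using assms by (auto simp: in_keys_iff lookup_minus lookup_single when_def split: if_splits)
  then show ?thesis using False assms by auto
qed

text \<open>Each part of \<open>\<mu>\<close> is placed on a variable. If two parts share a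
  variable, the support is smaller than the number of parts; otherwise the parts themselves are the
  exponents.\<close>

lemma lookup_power_sum_partition_triangular:
  assumes "0 \<notin># \<mu>" "lookup (power_sum_partition n \<mu>) \<gamma> \<noteq> 0"
  shows "card (keys \<gamma>) < size \<mu> \<or> mtype \<gamma> = \<mu>"
  using assms
proof (induction \<mu> arbitrary: \<gamma>)
  case empty
  then show ?case by (auto simp: lookup_one when_def split: if_splits)
next
  case (add r \<mu>)
  obtain j where j: "j \<in> {1..n}" "r \<le> lookup \<gamma> j"
    "lookup (power_sum_partition n \<mu>) (\<gamma> - single j r) \<noteq> 0"
    using lookup_power_sum_partition_add_nonzeroE[OF add.prems(2)] .
  have "r > 0" "0 \<notin># \<mu>" using add.prems by auto
  have "card (keys (\<gamma> - single j r)) < size \<mu> \<or> mtype (\<gamma> - single j r) = \<mu>"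
    using add.IH[OF _ j(3)] \<open>0 \<notin># \<mu>\<close> by auto
  then show ?case
    using mtype_minus_single_cases[OF j(2) \<open>r > 0\<close>] size_mtype[of "\<gamma> - single j r"] size_mtype[of \<gamma>]
    by (auto simp del: size_mtype)
qed

lemma lookup_power_sum_partition_nonneg: "lookup (power_sum_partition n \<mu>) \<gamma> \<ge> 0"
proof (induction \<mu> arbitrary: \<gamma>)
  case empty
  then show ?case by (simp add: lookup_one when_def)
next
  case (add r \<mu>)
  then show ?case unfolding lookup_power_sum_partition_add by (auto intro!: sum_nonneg)
qed

lemma lookup_power_sum_partition_pos:
  assumes "keys \<gamma> \<subseteq> {1..n}" "mtype \<gamma> = \<mu>"
  shows "lookup (power_sum_partition n \<mu>) \<gamma> > 0"
  using assms
proof (induction \<mu> arbitrary: \<gamma>)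
  case empty
  then show ?case by simp
next
  case (add r \<mu>)
  then obtain j where j: "j \<in> keys \<gamma>" "lookup \<gamma> j = r" by (metis in_mtype_iff union_single_eq_member)
  then have r: "r > 0" by (auto simp: in_keys_iff)
  then have "mtype (\<gamma> - single j r) = \<mu>"
    using mtype_minus_single_cases[of r \<gamma> j] j add.prems by auto
  moreover have "keys (\<gamma> - single j r) \<subseteq> {1..n}"
    using add.prems by (auto simp: in_keys_iff lookup_minus)
  ultimately have "lookup (power_sum_partition n \<mu>) (\<gamma> - single j r) > 0" using add.IH by auto
  then show ?case
    unfolding lookup_power_sum_partition_add
    by (intro sum_pos2[of _ j]) (use j add.prems lookup_power_sum_partition_nonneg in auto)
qed

lemma transition_nonzeroD:
  assumes "transition \<mu> \<nu> \<noteq> 0" "0 \<notin># \<mu>" "0 \<notin># \<nu>"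
  shows "size \<nu> < size \<mu> \<or> \<nu> = \<mu>"
  using lookup_power_sum_partition_triangular[of \<mu> "size \<nu>" "mono_at 0 \<nu>"] assms keys_mono_at[of \<nu> 0] mtype_mono_at[of \<nu> 0]
  by (auto simp: transition_def)

lemma transition_same: "0 \<notin># \<nu> \<Longrightarrow> transition \<nu> \<nu> > 0"
  unfolding transition_def
  by (intro lookup_power_sum_partition_pos) (auto simp: keys_mono_at mtype_mono_at)

text \<open>Elements are inserted by increasing rank. The row of the new \<open>x\<close> vanishes
  at all earlier \<open>\<nu>\<close>, so the equations already solved stay intact and
  \<open>c x\<close> is free to solve the one at \<open>x\<close>. The rank is integer valued so
  that the same statement serves the transposed system with the opposite sign.\<close>

lemma triangular_solve:
  fixes e :: "'a \<Rightarrow> 'a \<Rightarrow> real" and s :: "'a \<Rightarrow> int"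
  assumes "finite \<Lambda>"
    and "\<And>\<mu> \<nu>. \<mu> \<in> \<Lambda> \<Longrightarrow> \<nu> \<in> \<Lambda> \<Longrightarrow> e \<mu> \<nu> \<noteq> 0 \<Longrightarrow> s \<mu> < s \<nu> \<or> \<mu> = \<nu>"
    and "\<And>\<nu>. \<nu> \<in> \<Lambda> \<Longrightarrow> e \<nu> \<nu> \<noteq> 0"
  shows "\<exists>c. \<forall>\<nu>\<in>\<Lambda>. (\<Sum>\<mu>\<in>\<Lambda>. c \<mu> * e \<mu> \<nu>) = h \<nu>"
  using assms
proof (induction rule: finite_ranking_induct[where f = s])
  case empty
  then show ?case by simp
next
  case (insert x S)
  show ?case
  proof (cases "x \<in> S")
    case True
    then show ?thesis using insert by (simp add: insert_absorb)
  next
    case False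
    obtain c where c: "\<forall>\<nu>\<in>S. (\<Sum>\<mu>\<in>S. c \<mu> * e \<mu> \<nu>) = h \<nu>" using insert by blast
    have 0: "e x \<nu> = 0" if "\<nu> \<in> S" for \<nu>
      using insert.prems(1)[of x \<nu>] insert.hyps(2)[OF that] that False by (auto simp: not_less)
    define c' where "c' = c(x := (h x - (\<Sum>\<mu>\<in>S. c \<mu> * e \<mu> x)) / e x x)"
    have "(\<Sum>\<mu>\<in>insert x S. c' \<mu> * e \<mu> \<nu>) = c' x * e x \<nu> + (\<Sum>\<mu>\<in>S. c \<mu> * e \<mu> \<nu>)" for \<nu>
      using False \<open>finite S\<close> by (auto simp: c'_def intro!: sum.cong)
    moreover have "e x x \<noteq> 0" using insert.prems by auto
    ultimately have "(\<Sum>\<mu>\<in>insert x S. c' \<mu> * e \<mu> \<nu>) = h \<nu>" if "\<nu> \<in> insert x S" for \<nu>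
      using that 0 c by (auto simp: c'_def)
    then show ?thesis by blast
  qed
qed

subsection \<open>Inclusion-exclusion for functions of pair types\<close>

text \<open>Compares the exponents of \<open>z\<close> sitting on one common variable with the same
  exponents placed on two different variables.\<close>

definition diff_op ::
    "nat \<times> nat \<Rightarrow> ((nat \<times> nat) multiset \<Rightarrow> real) \<Rightarrow> (nat \<times> nat) multiset \<Rightarrow> real" where
  "diff_op z F P = F (add_mset z P) - F (add_mset (fst z, 0) (add_mset (0, snd z) P))"

text \<open>Alternating sum of \<open>q\<close> over all ways to keep some pairs of \<open>M\<close>
  and to split each of the others into \<open>(a, 0)\<close> and \<open>(0, b)\<close>. The fold is
  over a multiset, which is legitimate because the difference operators commute.\<close>

definition cumulant ::
    "((nat \<times> nat) multiset \<Rightarrow> real) \<Rightarrow> (nat \<times> nat) multiset \<Rightarrow> (nat \<times> nat) multiset \<Rightarrow> real" where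
  "cumulant q M = fold_mset diff_op q M"

lemma comp_fun_commute_diff_op: "comp_fun_commute diff_op"
proof
  fix x y
  show "diff_op y \<circ> diff_op x = diff_op x \<circ> diff_op y"
    by (rule ext)+ (simp add: diff_op_def add_mset_commute algebra_simps)
qed

lemma cumulant_empty [simp]: "cumulant q {#} P = q P"
  by (simp add: cumulant_def)

lemma cumulant_add_mset:
  "cumulant q (add_mset z M) P =
     cumulant q M (add_mset z P) - cumulant q M (add_mset (fst z, 0) (add_mset (0, snd z) P))"
  by (simp add: cumulant_def comp_fun_commute.fold_mset_add_mset[OF comp_fun_commute_diff_op] diff_op_def)

text \<open>All values of \<open>q\<close> in the alternating sum are taken at multisets containing
  \<open>P\<close>. This discards labels whose remaining exponents already violate the congruence
  modulo \<open>m\<close>.\<close>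

lemma cumulant_eq_0:
  assumes "\<And>P'. P \<subseteq># P' \<Longrightarrow> q P' = 0"
  shows "cumulant q M P = 0"
  using assms
proof (induction M arbitrary: P)
  case (add z M)
  have sub: "P \<subseteq># P'" if "add_mset a P \<subseteq># P'" for a and P P' :: "(nat \<times> nat) multiset"
    using that by (metis add_mset_add_single mset_subset_eq_add_left subset_mset.trans)
  have "q P' = 0" if "add_mset a P \<subseteq># P'" for a P'
    using sub[OF that] add.prems by blast
  moreover have "q P' = 0" if "add_mset a (add_mset b P) \<subseteq># P'" for a b P'
    using sub[OF sub[OF that]] add.prems by blast
  ultimately show ?case
    by (simp add: cumulant_add_mset add.IH)
qed auto

text \<open>Adding a common position \<open>a\<close> writes the value at the joined pair as
  difference plus value at the split pair. Subsets containing \<open>a\<close> collect the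
  differences, those without \<open>a\<close> the split values, and the sum telescopes.\<close>

lemma cumulant_expansion:
  assumes "finite C"
  shows "q (P + image_mset (\<lambda>i. (x i, y i)) (mset_set C)) =
    (\<Sum>S\<in>Pow C. cumulant q (image_mset (\<lambda>i. (x i, y i)) (mset_set S))
       (P + image_mset (\<lambda>i. (x i, 0)) (mset_set (C - S)) + image_mset (\<lambda>i. (0, y i)) (mset_set (C - S))))"
    (is "_ = (\<Sum>S\<in>Pow C. ?c S (P + ?l (C - S) + ?r (C - S)))")
  using assms
proof (induction C arbitrary: P rule: finite_induct)
  case empty
  then show ?case by simp
next
  case (insert a C)
  let ?P' = "\<lambda>S. P + ?l (C - S) + ?r (C - S)"
  have fin: "finite S" if "S \<in> Pow C" for S
    using that insert.hyps(1) finite_subset by auto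
  have "(\<Sum>S\<in>Pow (insert a C). ?c S (P + ?l (insert a C - S) + ?r (insert a C - S))) =
      (\<Sum>S\<in>Pow C. ?c S (P + ?l (insert a C - S) + ?r (insert a C - S))) +
      (\<Sum>S\<in>insert a ` Pow C. ?c S (P + ?l (insert a C - S) + ?r (insert a C - S)))"
    unfolding Pow_insert using insert.hyps by (intro sum.union_disjoint) auto
  also have "(\<Sum>S\<in>Pow C. ?c S (P + ?l (insert a C - S) + ?r (insert a C - S))) =
      (\<Sum>S\<in>Pow C. ?c S (add_mset (x a, 0) (add_mset (0, y a) (?P' S))))"
  proof (rule sum.cong[OF refl])
    fix S assume "S \<in> Pow C"
    then have "insert a C - S = insert a (C - S)" using insert.hyps(2) by auto
    then show "?c S (P + ?l (insert a C - S) + ?r (insert a C - S)) =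
        ?c S (add_mset (x a, 0) (add_mset (0, y a) (?P' S)))"
      using insert.hyps by (simp add: add_mset_commute)
  qed
  also have "(\<Sum>S\<in>insert a ` Pow C. ?c S (P + ?l (insert a C - S) + ?r (insert a C - S))) =
      (\<Sum>S\<in>Pow C. ?c (insert a S) (?P' S))"
  proof (subst sum.reindex)
    show "inj_on (insert a) (Pow C)"
      using insert.hyps(2) by (intro inj_onI) (auto simp: insert_eq_iff)
    have "insert a C - insert a S = C - S" if "S \<in> Pow C" for S
      using insert.hyps(2) by auto
    then show "sum ((\<lambda>S. ?c S (P + ?l (insert a C - S) + ?r (insert a C - S))) \<circ> insert a) (Pow C) =
        (\<Sum>S\<in>Pow C. ?c (insert a S) (?P' S))"
      by (intro sum.cong) auto
  qed
  also have "\<dots> = (\<Sum>S\<in>Pow C. ?c S (add_mset (x a, y a) (?P' S)) -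
      ?c S (add_mset (x a, 0) (add_mset (0, y a) (?P' S))))"
  proof (rule sum.cong[OF refl])
    fix S assume S: "S \<in> Pow C"
    then have "a \<notin> S" using insert.hyps(2) by auto
    then show "?c (insert a S) (?P' S) = ?c S (add_mset (x a, y a) (?P' S)) -
      ?c S (add_mset (x a, 0) (add_mset (0, y a) (?P' S)))"
      using fin[OF S] by (simp add: cumulant_add_mset)
  qed
  also have "(\<Sum>S\<in>Pow C. ?c S (add_mset (x a, 0) (add_mset (0, y a) (?P' S)))) +
      (\<Sum>S\<in>Pow C. ?c S (add_mset (x a, y a) (?P' S)) - ?c S (add_mset (x a, 0) (add_mset (0, y a) (?P' S)))) =
      (\<Sum>S\<in>Pow C. ?c S (add_mset (x a, y a) P + ?l (C - S) + ?r (C - S)))"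
    by (simp add: sum_subtractf)
  also have "\<dots> = q (P + image_mset (\<lambda>i. (x i, y i)) (mset_set (insert a C)))"
    using insert.IH[of "add_mset (x a, y a) P"] insert.hyps by simp
  finally show ?case ..
qed

section \<open>Ordered selections of common variables and the kernel on labels\<close>

definition arrangements :: "nat set \<Rightarrow> nat list set" where
  "arrangements C = {ps. distinct ps \<and> set ps \<subseteq> C}"

lemma arrangements_eq: "arrangements C = (\<Union>S\<in>Pow C. permutations_of_set S)"
  by (auto simp: arrangements_def permutations_of_set_def)

lemma finite_arrangements [simp]: "finite C \<Longrightarrow> finite (arrangements C)"
  by (auto simp: arrangements_eq)

lemma sum_arrangements:
  assumes "finite C"
  shows "(\<Sum>ps\<in>arrangements C. f ps) = (\<Sum>S\<in>Pow C. \<Sum>ps\<in>permutations_of_set S. f ps)"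
  unfolding arrangements_eq
proof (rule sum.UNION_disjoint)
  show "\<forall>S\<in>Pow C. finite (permutations_of_set S)" by simp
qed (use assms in \<open>auto simp: permutations_of_set_def\<close>)

text \<open>Along \<open>ps\<close> the exponents stay ordered, so that two labels can be matched
  position by position. The exponents elsewhere matter only up to permutation, since they are
  compared with those of another monomial after being moved apart.\<close>

definition label :: "mono \<Rightarrow> nat list \<Rightarrow> nat list \<times> nat multiset" where
  "label \<alpha> ps = (map (lookup \<alpha>) ps, image_mset (lookup \<alpha>) (mset_set (keys \<alpha> - set ps)))"

definition apart :: "nat multiset \<Rightarrow> nat multiset \<Rightarrow> (nat \<times> nat) multiset" where
  "apart \<kappa> \<kappa>' = image_mset (\<lambda>r. (r, 0)) \<kappa> + image_mset (\<lambda>r. (0, r)) \<kappa>'"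

text \<open>The factorial compensates for the orderings of one set of common variables. Only labels
  with lists of equal length are relevant: both come from the same \<open>ps\<close>.\<close>

definition kern ::
    "((nat \<times> nat) multiset \<Rightarrow> real) \<Rightarrow> nat list \<times> nat multiset \<Rightarrow> nat list \<times> nat multiset \<Rightarrow> real" where
  "kern q j j' = cumulant q (mset (zip (fst j) (fst j'))) (apart (snd j) (snd j')) / fact (length (fst j))"

text \<open>This is \<open>cumulant_expansion\<close> with \<open>C\<close> the common support and
  \<open>P\<close> formed by the variables of one monomial only; each subset \<open>S\<close> is
  then distributed evenly over its \<open>card S\<close> factorial orderings.\<close>

lemma kern_expansion:
  "q (ptype \<alpha> \<beta>) = (\<Sum>ps\<in>arrangements (keys \<alpha> \<inter> keys \<beta>). kern q (label \<alpha> ps) (label \<beta> ps))"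
proof -
  let ?C = "keys \<alpha> \<inter> keys \<beta>"
  let ?pr = "\<lambda>i. (lookup \<alpha> i, lookup \<beta> i)"
  let ?l = "\<lambda>A. image_mset (\<lambda>i. (lookup \<alpha> i, 0::nat)) (mset_set A)"
  let ?r = "\<lambda>A. image_mset (\<lambda>i. (0::nat, lookup \<beta> i)) (mset_set A)"
  have "ptype \<alpha> \<beta> = image_mset ?pr (mset_set ((keys \<alpha> - ?C) \<union> ((keys \<beta> - ?C) \<union> ?C)))"
    unfolding ptype_def by (intro arg_cong[of _ _ "\<lambda>A. image_mset ?pr (mset_set A)"]) auto
  also have "\<dots> = image_mset ?pr (mset_set (keys \<alpha> - ?C)) + (image_mset ?pr (mset_set (keys \<beta> - ?C)) + image_mset ?pr (mset_set ?C))"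
    by (subst mset_set_Union, (auto)[3], subst mset_set_Union) auto
  also have "image_mset ?pr (mset_set (keys \<alpha> - ?C)) = ?l (keys \<alpha> - ?C)"
    by (rule image_mset_cong) (auto simp: in_keys_iff)
  also have "image_mset ?pr (mset_set (keys \<beta> - ?C)) = ?r (keys \<beta> - ?C)"
    by (rule image_mset_cong) (auto simp: in_keys_iff)
  finally have "q (ptype \<alpha> \<beta>) = q (?l (keys \<alpha> - ?C) + ?r (keys \<beta> - ?C) + image_mset ?pr (mset_set ?C))"
    by (simp add: ac_simps)
  also have "\<dots> = (\<Sum>S\<in>Pow ?C. cumulant q (image_mset ?pr (mset_set S))
      (?l (keys \<alpha> - ?C) + ?r (keys \<beta> - ?C) + ?l (?C - S) + ?r (?C - S)))"
    by (rule cumulant_expansion) simp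
  also have "\<dots> = (\<Sum>S\<in>Pow ?C. \<Sum>ps\<in>permutations_of_set S. kern q (label \<alpha> ps) (label \<beta> ps))"
  proof (rule sum.cong[OF refl])
    fix S assume S: "S \<in> Pow ?C"
    then have fin: "finite S" using finite_subset[of S "keys \<alpha>"] by auto
    have "?l (keys \<alpha> - S) = ?l ((keys \<alpha> - ?C) \<union> (?C - S))"
      using S by (intro arg_cong[of _ _ ?l]) auto
    also have "\<dots> = ?l (keys \<alpha> - ?C) + ?l (?C - S)"
      by (subst mset_set_Union) auto
    finally have l: "?l (keys \<alpha> - S) = ?l (keys \<alpha> - ?C) + ?l (?C - S)" .
    have "?r (keys \<beta> - S) = ?r ((keys \<beta> - ?C) \<union> (?C - S))"
      using S by (intro arg_cong[of _ _ ?r]) auto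
    also have "\<dots> = ?r (keys \<beta> - ?C) + ?r (?C - S)"
      by (subst mset_set_Union) auto
    finally have r: "?r (keys \<beta> - S) = ?r (keys \<beta> - ?C) + ?r (?C - S)" .
    have "kern q (label \<alpha> ps) (label \<beta> ps) = cumulant q (image_mset ?pr (mset_set S))
        (?l (keys \<alpha> - ?C) + ?r (keys \<beta> - ?C) + ?l (?C - S) + ?r (?C - S)) / fact (card S)"
      if ps: "ps \<in> permutations_of_set S" for ps
    proof -
      have "set ps = S" "distinct ps" using ps by (auto simp: permutations_of_set_def)
      then have "mset ps = mset_set S" "length ps = card S"
        by (auto simp: mset_set_set distinct_card)
      moreover have "mset (zip (map (lookup \<alpha>) ps) (map (lookup \<beta>) ps)) = image_mset ?pr (mset ps)"
        by (simp add: zip_map_map zip_same_conv_map o_def flip: mset_map)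
      ultimately show ?thesis
        by (simp add: kern_def label_def apart_def \<open>set ps = S\<close> multiset.map_comp o_def l r ac_simps)
    qed
    then show "cumulant q (image_mset ?pr (mset_set S))
        (?l (keys \<alpha> - ?C) + ?r (keys \<beta> - ?C) + ?l (?C - S) + ?r (?C - S)) =
        (\<Sum>ps\<in>permutations_of_set S. kern q (label \<alpha> ps) (label \<beta> ps))"
      using fin by (simp add: card_permutations_of_set)
  qed
  also have "\<dots> = (\<Sum>ps\<in>arrangements ?C. kern q (label \<alpha> ps) (label \<beta> ps))"
    by (simp add: sum_arrangements)
  finally show ?thesis .
qed

subsection \<open>Labels\<close>

text \<open>The coefficient at \<open>\<gamma>\<close> of the symmetric form that a matrix
  \<open>G\<close> on labels stands for. It depends on \<open>G\<close> linearly and does not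
  mention the number of variables.\<close>

definition pair_sum ::
    "(nat list \<times> nat multiset \<Rightarrow> nat list \<times> nat multiset \<Rightarrow> real) \<Rightarrow> mono \<Rightarrow> real" where
  "pair_sum G \<gamma> = (\<Sum>(\<alpha>, \<beta>)\<in>splits \<gamma>. \<Sum>ps\<in>arrangements (keys \<alpha> \<inter> keys \<beta>). G (label \<alpha> ps) (label \<beta> ps))"

lemma label_rename:
  assumes "bij \<pi>"
  shows "label (rename \<pi> \<alpha>) ps = label \<alpha> (map \<pi> ps)"
proof -
  have "keys (rename \<pi> \<alpha>) - set ps = \<pi> -` (keys \<alpha> - \<pi> ` set ps)"
    using assms by (auto simp: keys_rename bij_is_inj inj_eq)
  moreover have "lookup (rename \<pi> \<alpha>) = lookup \<alpha> \<circ> \<pi>"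
    using assms by (auto simp: lookup_rename)
  then have "image_mset (lookup (rename \<pi> \<alpha>)) M = image_mset (lookup \<alpha>) (image_mset \<pi> M)" for M
    by (simp add: multiset.map_comp)
  ultimately show ?thesis
    using assms by (simp add: label_def lookup_rename mset_set_vimage_bij)
qed

lemma pair_sum_rename:
  assumes "bij \<pi>"
  shows "pair_sum G (rename \<pi> \<gamma>) = pair_sum G \<gamma>"
proof -
  have arr: "bij_betw (map \<pi>) (arrangements (\<pi> -` K)) (arrangements K)" for K
  proof (rule bij_betw_byWitness[where f' = "map (inv_into UNIV \<pi>)"])
    have i: "inj \<pi>" "inj (inv_into UNIV \<pi>)" "\<And>x. \<pi> (inv_into UNIV \<pi> x) = x" "\<And>x. inv_into UNIV \<pi> (\<pi> x) = x"
      using assms by (auto simp: bij_is_inj bij_is_surj surj_f_inv_f surj_imp_inj_inv)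
    show "\<forall>ps\<in>arrangements (\<pi> -` K). map (inv_into UNIV \<pi>) (map \<pi> ps) = ps"
      "\<forall>ps\<in>arrangements K. map \<pi> (map (inv_into UNIV \<pi>) ps) = ps"
      by (simp_all add: o_def i)
    show "map \<pi> ` arrangements (\<pi> -` K) \<subseteq> arrangements K"
      by (auto simp: arrangements_def distinct_map inj_on_subset[OF i(1)])
    show "map (inv_into UNIV \<pi>) ` arrangements K \<subseteq> arrangements (\<pi> -` K)"
      by (auto simp: arrangements_def distinct_map inj_on_subset[OF i(2)] i subset_iff)
  qed
  have "pair_sum G (rename \<pi> \<gamma>) = (\<Sum>(\<alpha>, \<beta>)\<in>splits \<gamma>.
      \<Sum>ps\<in>arrangements (\<pi> -` (keys \<alpha> \<inter> keys \<beta>)). G (label \<alpha> (map \<pi> ps)) (label \<beta> (map \<pi> ps)))"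
    unfolding pair_sum_def
    by (subst sum.reindex_bij_betw[OF splits_rename[OF assms], symmetric])
      (simp add: case_prod_beta keys_rename label_rename assms vimage_Int)
  also have "\<dots> = pair_sum G \<gamma>"
    unfolding pair_sum_def
  proof (intro sum.cong refl)
    fix x
    show "(case x of (\<alpha>, \<beta>) \<Rightarrow> \<Sum>ps\<in>arrangements (\<pi> -` (keys \<alpha> \<inter> keys \<beta>)). G (label \<alpha> (map \<pi> ps)) (label \<beta> (map \<pi> ps))) =
        (case x of (\<alpha>, \<beta>) \<Rightarrow> \<Sum>ps\<in>arrangements (keys \<alpha> \<inter> keys \<beta>). G (label \<alpha> ps) (label \<beta> ps))"
      using sum.reindex_bij_betw[OF arr, of "\<lambda>ps. G (label (fst x) ps) (label (snd x) ps)" "keys (fst x) \<inter> keys (snd x)"]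
      by (simp add: case_prod_beta)
  qed
  finally show ?thesis .
qed

lemma pair_sum_mtype:
  "pair_sum G (mono_at 0 (mtype \<gamma>)) = pair_sum G \<gamma>"
proof -
  have "mtype (mono_at 0 (mtype \<gamma>)) = mtype \<gamma>" by (simp add: mtype_mono_at)
  from mtype_eq_imp_rename[OF this, of "keys (mono_at 0 (mtype \<gamma>)) \<union> keys \<gamma>"]
  obtain \<pi> where "\<pi> permutes (keys (mono_at 0 (mtype \<gamma>)) \<union> keys \<gamma>)" "mono_at 0 (mtype \<gamma>) = rename \<pi> \<gamma>" by auto
  then show ?thesis by (simp add: pair_sum_rename permutes_bij)
qed

lemma pair_sum_linear:
  "pair_sum (\<lambda>a b. \<Sum>x\<in>X. c x * G x a b) \<gamma> = (\<Sum>x\<in>X. c x * pair_sum (G x) \<gamma>)"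
  unfolding pair_sum_def case_prod_beta sum_distrib_left
  by (subst sum.swap, subst sum.swap) (rule refl)

text \<open>Exponents in the list meet another exponent on the same variable and need only be
  congruent to it modulo \<open>m\<close>. A remaining exponent meets the exponent 0, which is why
  divisibility is imposed on \<open>\<kappa>\<close> alone.\<close>

definition labels :: "nat \<Rightarrow> nat \<Rightarrow> (nat list \<times> nat multiset) set" where
  "labels d m = {(l, \<kappa>). 0 \<notin> set l \<and> 0 \<notin># \<kappa> \<and> (\<forall>r\<in>#\<kappa>. m dvd r) \<and> sum_list l + sum_mset \<kappa> = d}"

lemma finite_labels [simp]: "finite (labels d m)"
proof (rule finite_subset)
  show "labels d m \<subseteq> {l. set l \<subseteq> {..d} \<and> length l \<le> d} \<times> (\<Union>k\<le>d. partitions_of k)"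
  proof
    fix j assume "j \<in> labels d m"
    then obtain l \<kappa> where j: "j = (l, \<kappa>)" and l: "0 \<notin> set l" "0 \<notin># \<kappa>" "sum_list l + sum_mset \<kappa> = d" by (auto simp: labels_def)
    have "length l \<le> sum_list l" using l(1) by (induction l) auto
    moreover have "x \<le> sum_list l" if "x \<in> set l" for x using that by (intro member_le_sum_list) auto
    ultimately show "j \<in> {l. set l \<subseteq> {..d} \<and> length l \<le> d} \<times> (\<Union>k\<le>d. partitions_of k)"
      using l by (fastforce simp: j partitions_of_def)
  qed
  show "finite ({l. set l \<subseteq> {..d} \<and> length l \<le> d} \<times> (\<Union>k\<le>d. partitions_of k))"
    by (intro finite_cartesian_product finite_lists_length_le finite_UN_I finite_partitions_of) auto
qed

lemma label_in_labels_iff: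
  assumes "ps \<in> arrangements (keys \<alpha>)"
  shows "label \<alpha> ps \<in> labels d m \<longleftrightarrow> mdeg \<alpha> = d \<and> (\<forall>i\<in>keys \<alpha> - set ps. m dvd lookup \<alpha> i)"
proof -
  have ps: "distinct ps" "set ps \<subseteq> keys \<alpha>" using assms by (auto simp: arrangements_def)
  have "mdeg \<alpha> = (\<Sum>i\<in>set ps. lookup \<alpha> i) + (\<Sum>i\<in>keys \<alpha> - set ps. lookup \<alpha> i)"
    unfolding mdeg_def using ps by (simp add: sum.subset_diff add.commute)
  also have "(\<Sum>i\<in>set ps. lookup \<alpha> i) = sum_list (map (lookup \<alpha>) ps)"
    using ps by (simp add: sum_list_distinct_conv_sum_set)
  also have "(\<Sum>i\<in>keys \<alpha> - set ps. lookup \<alpha> i) = sum_mset (image_mset (lookup \<alpha>) (mset_set (keys \<alpha> - set ps)))"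
    by (simp add: sum_unfold_sum_mset)
  finally show ?thesis
    using ps by (auto simp: label_def labels_def in_keys_iff)
qed

definition congruent_labels :: "nat \<Rightarrow> nat list \<times> nat multiset \<Rightarrow> nat list \<times> nat multiset \<Rightarrow> bool" where
  "congruent_labels m j j' \<longleftrightarrow> map (\<lambda>r. r mod m) (fst j) = map (\<lambda>r. r mod m) (fst j')"

text \<open>Modulo 1 and 2 every number is congruent to its negative. Divisibility of a product's
  exponents thus becomes equality of residues of the two factors, an equivalence relation along
  which a Gram matrix can be cut into diagonal blocks.\<close>

lemma dvd_add_iff_mod_eq:
  fixes a b m :: nat
  assumes "m = 1 \<or> m = 2"
  shows "m dvd a + b \<longleftrightarrow> a mod m = b mod m"
  using assms by (auto simp: even_add mod_2_eq_odd)

lemma congruent_labels_label: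
  assumes "m = 1 \<or> m = 2"
  shows "congruent_labels m (label \<alpha> ps) (label \<beta> ps) \<longleftrightarrow> (\<forall>i\<in>set ps. m dvd lookup (\<alpha> + \<beta>) i)"
  by (simp add: congruent_labels_def label_def lookup_add dvd_add_iff_mod_eq[OF assms])

lemma pair_sum_congruent:
  assumes "m = 1 \<or> m = 2" "\<And>i. m dvd lookup \<gamma> i"
  shows "pair_sum (\<lambda>j j'. if congruent_labels m j j' then G j j' else 0) \<gamma> = pair_sum G \<gamma>"
proof -
  have "congruent_labels m (label \<alpha> ps) (label \<beta> ps)" if "(\<alpha>, \<beta>) \<in> splits \<gamma>" for \<alpha> \<beta> ps
    using that assms(2) by (auto simp: splits_def congruent_labels_label[OF assms(1)])
  then show ?thesis
    unfolding pair_sum_def by (intro sum.cong refl) (simp add: case_prod_beta)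
qed

text \<open>Ensures that squares built from such labels produce no monomial outside the types in
  \<open>parts m d\<close>, as must hold for a combination of the corresponding power sums.\<close>

lemma pair_sum_nonzeroD:
  assumes m: "m = 1 \<or> m = 2" and nz: "pair_sum G \<gamma> \<noteq> 0"
    and G: "\<And>j j'. G j j' \<noteq> 0 \<Longrightarrow> j \<in> labels d m \<and> j' \<in> labels d m \<and> congruent_labels m j j'"
  shows "mdeg \<gamma> = 2 * d \<and> (\<forall>i. m dvd lookup \<gamma> i)"
proof -
  obtain x where x: "x \<in> splits \<gamma>"
    "(case x of (\<alpha>, \<beta>) \<Rightarrow> \<Sum>ps\<in>arrangements (keys \<alpha> \<inter> keys \<beta>). G (label \<alpha> ps) (label \<beta> ps)) \<noteq> 0"
    using nz unfolding pair_sum_def by (rule sum.not_neutral_contains_not_neutral)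
  obtain \<alpha> \<beta> where \<gamma>: "\<gamma> = \<alpha> + \<beta>" and
    "(\<Sum>ps\<in>arrangements (keys \<alpha> \<inter> keys \<beta>). G (label \<alpha> ps) (label \<beta> ps)) \<noteq> 0"
    using x by (cases x) (auto simp: splits_def)
  then obtain ps where ps: "ps \<in> arrangements (keys \<alpha> \<inter> keys \<beta>)" "G (label \<alpha> ps) (label \<beta> ps) \<noteq> 0"
    by (meson sum.not_neutral_contains_not_neutral)
  then have "ps \<in> arrangements (keys \<alpha>)" "ps \<in> arrangements (keys \<beta>)" by (auto simp: arrangements_def)
  note L = this[THEN label_in_labels_iff[of _ _ d m]]
  have *: "mdeg \<alpha> = d" "mdeg \<beta> = d" "\<forall>i\<in>keys \<alpha> - set ps. m dvd lookup \<alpha> i"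
    "\<forall>i\<in>keys \<beta> - set ps. m dvd lookup \<beta> i" "\<forall>i\<in>set ps. m dvd lookup (\<alpha> + \<beta>) i"
    using G[OF ps(2)] L by (auto simp: congruent_labels_label[OF m])
  have "m dvd lookup (\<alpha> + \<beta>) i" for i
  proof (cases "i \<in> set ps")
    case False
    then have "m dvd lookup \<alpha> i" "m dvd lookup \<beta> i"
      using * by (cases "i \<in> keys \<alpha>"; cases "i \<in> keys \<beta>"; auto simp: in_keys_iff)+
    then show ?thesis by (simp add: lookup_add)
  qed (use * in auto)
  then show ?thesis using * by (simp add: \<gamma> mdeg_plus)
qed

subsection \<open>Spectrahedral cones from finite quadratic forms\<close>

lemma linear_form_on_lincomb:
  fixes l :: "'x \<Rightarrow> ('i \<Rightarrow> real) \<Rightarrow> real"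
  assumes "\<And>x. x \<in> X \<Longrightarrow> linear_form_on I (l x)"
  shows "linear_form_on I (\<lambda>\<phi>. \<Sum>x\<in>X. c x * l x \<phi>)"
proof -
  from assms have "\<forall>x\<in>X. \<exists>a. \<forall>\<phi>\<in>coord_space I. l x \<phi> = (\<Sum>i\<in>I. a i * \<phi> i)"
    by (simp add: linear_form_on_def)
  then obtain a where a: "\<forall>x\<in>X. \<forall>\<phi>\<in>coord_space I. l x \<phi> = (\<Sum>i\<in>I. a x i * \<phi> i)"
    by metis
  show ?thesis
    unfolding linear_form_on_def
  proof (intro exI ballI)
    fix \<phi> :: "'i \<Rightarrow> real" assume "\<phi> \<in> coord_space I"
    then have "(\<Sum>x\<in>X. c x * l x \<phi>) = (\<Sum>x\<in>X. \<Sum>i\<in>I. c x * a x i * \<phi> i)"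
      using a by (intro sum.cong) (auto simp: sum_distrib_left mult.assoc)
    also have "\<dots> = (\<Sum>i\<in>I. (\<Sum>x\<in>X. c x * a x i) * \<phi> i)"
      by (subst sum.swap) (simp add: sum_distrib_right)
    finally show "(\<Sum>x\<in>X. c x * l x \<phi>) = (\<Sum>i\<in>I. (\<Sum>x\<in>X. c x * a x i) * \<phi> i)" .
  qed
qed

text \<open>A quadratic form only sees the symmetric part of its matrix, so \<open>A\<close> may be
  given without symmetry; \<open>L\<close> is its symmetrization, transported along an enumeration
  of \<open>J\<close>.\<close>

lemma spectrahedral_coneI:
  fixes A :: "('i \<Rightarrow> real) \<Rightarrow> 'j \<Rightarrow> 'j \<Rightarrow> real"
  assumes "finite J"
    and lin: "\<And>j j'. linear_form_on I (\<lambda>\<phi>. A \<phi> j j')"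
    and K: "K = {\<phi> \<in> coord_space I. \<forall>g. (\<Sum>j\<in>J. \<Sum>j'\<in>J. g j * g j' * A \<phi> j j') \<ge> 0}"
  shows "spectrahedral_cone I K"
proof -
  define m where "m = card J"
  obtain e where e: "bij_betw e {0..<m} J"
    using ex_bij_betw_nat_finite[OF \<open>finite J\<close>] by (auto simp: m_def)
  define L where "L = (\<lambda>\<phi>. mat m m (\<lambda>(i, k). (A \<phi> (e i) (e k) + A \<phi> (e k) (e i)) / 2))"
  have sym: "symmetric_mat m (L \<phi>)" for \<phi>
    by (auto simp: symmetric_mat_def L_def intro!: eq_matI)
  have lf: "linear_form_on I (\<lambda>\<phi>. L \<phi> $$ (i, k))" if "i < m" "k < m" for i k
  proof -
    have "linear_form_on I (\<lambda>\<phi>. \<Sum>b\<in>UNIV. 1 / 2 * (if b then A \<phi> (e i) (e k) else A \<phi> (e k) (e i)))"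
    proof (rule linear_form_on_lincomb)
      fix b show "linear_form_on I (\<lambda>\<phi>. if b then A \<phi> (e i) (e k) else A \<phi> (e k) (e i))"
        by (cases b) (simp_all add: lin)
    qed
    moreover have "(\<lambda>\<phi>. L \<phi> $$ (i, k)) =
        (\<lambda>\<phi>. \<Sum>b\<in>UNIV. 1 / 2 * (if b then A \<phi> (e i) (e k) else A \<phi> (e k) (e i)))"
      using that by (simp add: L_def UNIV_bool add_divide_distrib add.commute)
    ultimately show ?thesis by simp
  qed
  have quad: "v \<bullet> (L \<phi> *\<^sub>v v) = (\<Sum>i<m. \<Sum>k<m. v $ i * v $ k * A \<phi> (e i) (e k))"
    if v: "v \<in> carrier_vec m" for v \<phi>
  proof -
    have "v \<bullet> (L \<phi> *\<^sub>v v) = (\<Sum>i<m. \<Sum>k<m. v $ i * v $ k * (A \<phi> (e i) (e k) + A \<phi> (e k) (e i)) / 2)"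
      using v by (auto simp: scalar_prod_def L_def sum_distrib_left atLeast0LessThan algebra_simps intro!: sum.cong)
    also have "\<dots> = ((\<Sum>i<m. \<Sum>k<m. v $ i * v $ k * A \<phi> (e i) (e k)) +
        (\<Sum>i<m. \<Sum>k<m. v $ i * v $ k * A \<phi> (e k) (e i))) / 2"
      by (simp add: sum.distrib distrib_left add_divide_distrib sum_divide_distrib)
    also have "(\<Sum>i<m. \<Sum>k<m. v $ i * v $ k * A \<phi> (e k) (e i)) = (\<Sum>i<m. \<Sum>k<m. v $ i * v $ k * A \<phi> (e i) (e k))"
      by (subst sum.swap) (simp add: mult.commute)
    finally show ?thesis by simp
  qed
  have reidx: "(\<Sum>j\<in>J. \<Sum>j'\<in>J. g j * g j' * A \<phi> j j') =
      (\<Sum>i<m. \<Sum>k<m. g (e i) * g (e k) * A \<phi> (e i) (e k))" for g :: "'j \<Rightarrow> real" and \<phi>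
    by (simp add: sum.reindex_bij_betw[OF e, symmetric] atLeast0LessThan)
  have "(\<forall>g. (\<Sum>j\<in>J. \<Sum>j'\<in>J. g j * g j' * A \<phi> j j') \<ge> 0) \<longleftrightarrow> psd_mat m (L \<phi>)" for \<phi>
  proof
    assume *: "\<forall>g. (\<Sum>j\<in>J. \<Sum>j'\<in>J. g j * g j' * A \<phi> j j') \<ge> 0"
    show "psd_mat m (L \<phi>)"
      unfolding psd_mat_def
    proof (intro conjI ballI sym)
      fix v :: "real vec" assume v: "v \<in> carrier_vec m"
      define g where "g = (\<lambda>j. v $ (the_inv_into {0..<m} e j))"
      have "g (e i) = v $ i" if "i < m" for i
        using that e by (simp add: g_def the_inv_into_f_f bij_betw_imp_inj_on)
      then have "(\<Sum>i<m. \<Sum>k<m. v $ i * v $ k * A \<phi> (e i) (e k)) = (\<Sum>j\<in>J. \<Sum>j'\<in>J. g j * g j' * A \<phi> j j')"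
        unfolding reidx by (intro sum.cong) auto
      then show "v \<bullet> (L \<phi> *\<^sub>v v) \<ge> 0" using * quad[OF v] by simp
    qed
  next
    assume psd: "psd_mat m (L \<phi>)"
    show "\<forall>g. (\<Sum>j\<in>J. \<Sum>j'\<in>J. g j * g j' * A \<phi> j j') \<ge> 0"
    proof
      fix g :: "'j \<Rightarrow> real"
      have "vec m (\<lambda>i. g (e i)) \<bullet> (L \<phi> *\<^sub>v vec m (\<lambda>i. g (e i))) \<ge> 0"
        using psd by (auto simp: psd_mat_def)
      also have "vec m (\<lambda>i. g (e i)) \<bullet> (L \<phi> *\<^sub>v vec m (\<lambda>i. g (e i))) = (\<Sum>j\<in>J. \<Sum>j'\<in>J. g j * g j' * A \<phi> j j')"
        by (subst quad) (auto simp: reidx)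
      finally show "(\<Sum>j\<in>J. \<Sum>j'\<in>J. g j * g j' * A \<phi> j j') \<ge> 0" .
    qed
  qed
  then show ?thesis
    unfolding spectrahedral_cone_def K using sym lf by (intro exI[of _ m] exI[of _ L]) auto
qed

subsection \<open>Change of coordinates\<close>

definition parts :: "nat \<Rightarrow> nat \<Rightarrow> nat multiset set" where
  "parts m d = {\<mu> \<in> partitions_of (2 * d). \<forall>r\<in>#\<mu>. m dvd r}"

lemma finite_parts [simp]: "finite (parts m d)"
  unfolding parts_def by (simp add: finite_partitions_of)

lemma zero_notin_parts: "\<mu> \<in> parts m d \<Longrightarrow> 0 \<notin># \<mu>"
  by (simp add: parts_def partitions_of_def)

lemma mtype_in_parts_iff:
  "mtype \<gamma> \<in> parts m d \<longleftrightarrow> mdeg \<gamma> = 2 * d \<and> (\<forall>i. m dvd lookup \<gamma> i)"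
proof -
  have "(\<forall>r\<in>#mtype \<gamma>. m dvd r) \<longleftrightarrow> (\<forall>i. m dvd lookup \<gamma> i)"
    by (metis dvd_0_right in_keys_iff in_mtype_iff)
  then show ?thesis by (simp add: parts_def partitions_of_def sum_mtype)
qed

lemma exists_power_sum_coordinates:
  "\<exists>c. \<forall>\<nu>\<in>parts m d. (\<Sum>\<mu>\<in>parts m d. c \<mu> * transition \<mu> \<nu>) = h \<nu>"
proof (rule triangular_solve[where s = "\<lambda>\<mu>. - int (size \<mu>)"])
  fix \<mu> \<nu> assume "\<mu> \<in> parts m d" "\<nu> \<in> parts m d" "transition \<mu> \<nu> \<noteq> 0"
  then show "- int (size \<mu>) < - int (size \<nu>) \<or> \<mu> = \<nu>"
    using transition_nonzeroD[of \<mu> \<nu>] by (auto simp: zero_notin_parts)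
next
  fix \<nu> assume "\<nu> \<in> parts m d"
  then show "transition \<nu> \<nu> \<noteq> 0" using transition_same[of \<nu>] by (auto simp: zero_notin_parts)
qed simp

text \<open>The transposed triangular system is inverted one unit vector at a time. For a functional
  with values \<open>\<phi>\<close> on power sums, the inner sums are its values on monomial
  symmetric functions. Their linearity in \<open>\<phi>\<close> later makes the matrix entries
  linear forms.\<close>

lemma exists_dual_coordinates:
  "\<exists>D. \<forall>\<phi>. \<forall>\<mu>\<in>parts m d.
     (\<Sum>\<nu>\<in>parts m d. transition \<mu> \<nu> * (\<Sum>\<mu>'\<in>parts m d. D \<nu> \<mu>' * \<phi> \<mu>')) = (\<phi> \<mu> :: real)"
proof -
  have "\<exists>c. \<forall>\<mu>\<in>parts m d. (\<Sum>\<nu>\<in>parts m d. c \<nu> * transition \<mu> \<nu>) = (if \<mu> = \<mu>' then 1 else 0)" for \<mu>'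
  proof (rule triangular_solve[where s = "\<lambda>\<mu>. int (size \<mu>)"])
    fix \<nu> \<mu> assume "\<mu> \<in> parts m d" "\<nu> \<in> parts m d" "transition \<mu> \<nu> \<noteq> 0"
    then show "int (size \<nu>) < int (size \<mu>) \<or> \<nu> = \<mu>"
      using transition_nonzeroD[of \<mu> \<nu>] by (auto simp: zero_notin_parts)
  next
    fix \<nu> assume "\<nu> \<in> parts m d"
    then show "transition \<nu> \<nu> \<noteq> 0" using transition_same[of \<nu>] by (auto simp: zero_notin_parts)
  qed simp
  then obtain D where D: "\<And>\<mu>' \<mu>. \<mu> \<in> parts m d \<Longrightarrow>
      (\<Sum>\<nu>\<in>parts m d. D \<mu>' \<nu> * transition \<mu> \<nu>) = (if \<mu> = \<mu>' then 1 else 0)"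
    by metis
  show ?thesis
  proof (intro exI[of _ "\<lambda>\<nu> \<mu>'. D \<mu>' \<nu>"] allI ballI)
    fix \<phi> :: "nat multiset \<Rightarrow> real" and \<mu> assume \<mu>: "\<mu> \<in> parts m d"
    have "(\<Sum>\<nu>\<in>parts m d. transition \<mu> \<nu> * (\<Sum>\<mu>'\<in>parts m d. D \<mu>' \<nu> * \<phi> \<mu>')) =
        (\<Sum>\<mu>'\<in>parts m d. (\<Sum>\<nu>\<in>parts m d. D \<mu>' \<nu> * transition \<mu> \<nu>) * \<phi> \<mu>')"
      unfolding sum_distrib_left sum_distrib_right by (subst sum.swap) (simp add: mult_ac)
    also have "\<dots> = (\<Sum>\<mu>'\<in>parts m d. if \<mu> = \<mu>' then \<phi> \<mu>' else 0)"
      by (intro sum.cong refl) (simp add: D[OF \<mu>])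
    finally show "(\<Sum>\<nu>\<in>parts m d. transition \<mu> \<nu> * (\<Sum>\<mu>'\<in>parts m d. D \<mu>' \<nu> * \<phi> \<mu>')) = \<phi> \<mu>"
      using \<mu> by simp
  qed
qed

lemma pairing_change_coordinates:
  assumes D: "\<And>\<mu>. \<mu> \<in> parts m d \<Longrightarrow> (\<Sum>\<nu>\<in>parts m d. transition \<mu> \<nu> * \<psi> \<nu>) = (\<phi> \<mu> :: real)"
    and h: "\<And>\<nu>. \<nu> \<in> parts m d \<Longrightarrow> (\<Sum>\<mu>\<in>parts m d. c \<mu> * transition \<mu> \<nu>) = h \<nu>"
  shows "(\<Sum>\<mu>\<in>parts m d. c \<mu> * \<phi> \<mu>) = (\<Sum>\<nu>\<in>parts m d. h \<nu> * \<psi> \<nu>)"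
proof -
  have "(\<Sum>\<mu>\<in>parts m d. c \<mu> * \<phi> \<mu>) = (\<Sum>\<mu>\<in>parts m d. \<Sum>\<nu>\<in>parts m d. c \<mu> * transition \<mu> \<nu> * \<psi> \<nu>)"
    by (intro sum.cong refl) (simp add: D[symmetric] sum_distrib_left mult.assoc)
  also have "\<dots> = (\<Sum>\<nu>\<in>parts m d. h \<nu> * \<psi> \<nu>)"
    by (subst sum.swap) (simp add: h[symmetric] sum_distrib_right)
  finally show ?thesis .
qed

text \<open>The adjoint of \<open>pair_sum\<close>: the functional with values \<open>\<psi>\<close>
  on monomial symmetric functions, evaluated on the form of the elementary matrix at
  \<open>(j, j')\<close>.\<close>

definition moment_form ::
    "nat \<Rightarrow> nat \<Rightarrow> (nat multiset \<Rightarrow> real) \<Rightarrow> nat list \<times> nat multiset \<Rightarrow> nat list \<times> nat multiset \<Rightarrow> real" where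
  "moment_form m d \<psi> j j' = (\<Sum>\<nu>\<in>parts m d.
     pair_sum (\<lambda>a b. if a = j \<and> b = j' then 1 else 0) (mono_at 0 \<nu>) * \<psi> \<nu>)"

lemma moment_form_sum:
  assumes "\<And>j j'. G j j' \<noteq> 0 \<Longrightarrow> j \<in> labels d m \<and> j' \<in> labels d m"
  shows "(\<Sum>j\<in>labels d m. \<Sum>j'\<in>labels d m. G j j' * moment_form m d \<psi> j j') =
    (\<Sum>\<nu>\<in>parts m d. pair_sum G (mono_at 0 \<nu>) * \<psi> \<nu>)"
proof -
  let ?J = "labels d m"
  have G: "(\<lambda>a b. \<Sum>x\<in>?J \<times> ?J. G (fst x) (snd x) * (if a = fst x \<and> b = snd x then 1 else 0)) = G"
  proof (intro ext)
    fix a b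
    have "(\<Sum>x\<in>?J \<times> ?J. G (fst x) (snd x) * (if a = fst x \<and> b = snd x then 1 else 0)) =
        (\<Sum>x\<in>?J \<times> ?J. if (a, b) = x then G a b else 0)"
      by (intro sum.cong refl) auto
    also have "\<dots> = G a b" using assms[of a b] by (auto simp: sum.delta')
    finally show "(\<Sum>x\<in>?J \<times> ?J. G (fst x) (snd x) * (if a = fst x \<and> b = snd x then 1 else 0)) = G a b" .
  qed
  have "pair_sum G \<gamma> = (\<Sum>x\<in>?J \<times> ?J. G (fst x) (snd x) *
      pair_sum (\<lambda>a b. if a = fst x \<and> b = snd x then 1 else 0) \<gamma>)" for \<gamma>
    using pair_sum_linear[of "\<lambda>x. G (fst x) (snd x)" "\<lambda>x a b. if a = fst x \<and> b = snd x then 1 else 0" "?J \<times> ?J" \<gamma>]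
    unfolding G .
  then have *: "pair_sum G \<gamma> = (\<Sum>j\<in>?J. \<Sum>j'\<in>?J. G j j' *
      pair_sum (\<lambda>a b. if a = j \<and> b = j' then 1 else 0) \<gamma>)" for \<gamma>
    by (simp add: sum.cartesian_product case_prod_beta)
  have "(\<Sum>\<nu>\<in>parts m d. pair_sum G (mono_at 0 \<nu>) * \<psi> \<nu>) = (\<Sum>\<nu>\<in>parts m d. \<Sum>j\<in>?J. \<Sum>j'\<in>?J. G j j' *
      pair_sum (\<lambda>a b. if a = j \<and> b = j' then 1 else 0) (mono_at 0 \<nu>) * \<psi> \<nu>)"
    unfolding * by (simp add: sum_distrib_right)
  also have "\<dots> = (\<Sum>j\<in>?J. \<Sum>\<nu>\<in>parts m d. \<Sum>j'\<in>?J. G j j' *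
      pair_sum (\<lambda>a b. if a = j \<and> b = j' then 1 else 0) (mono_at 0 \<nu>) * \<psi> \<nu>)"
    by (rule sum.swap)
  also have "\<dots> = (\<Sum>j\<in>?J. \<Sum>j'\<in>?J. \<Sum>\<nu>\<in>parts m d. G j j' *
      pair_sum (\<lambda>a b. if a = j \<and> b = j' then 1 else 0) (mono_at 0 \<nu>) * \<psi> \<nu>)"
    by (intro sum.cong refl, rule sum.swap)
  finally show ?thesis
    by (simp add: moment_form_def sum_distrib_left mult.assoc)
qed

text \<open>Both labels of a term are read off along the same list \<open>ps\<close>. Hence inner
  products of Gram vectors have to be controlled only for labels with lists of equal length.\<close>

lemma moment_form_eq_0:
  assumes "length (fst j) \<noteq> length (fst j')"
  shows "moment_form m d \<psi> j j' = 0"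
proof -
  have "\<not> (label \<alpha> ps = j \<and> label \<beta> ps = j')" for \<alpha> \<beta> ps
    using assms by (auto simp: label_def)
  then have "pair_sum (\<lambda>a b. if a = j \<and> b = j' then 1 else 0) \<gamma> = 0" for \<gamma>
    unfolding pair_sum_def by (auto simp: case_prod_beta intro!: sum.neutral)
  then show ?thesis by (simp add: moment_form_def)
qed

subsection \<open>Sums of squares with prescribed coefficients\<close>

lemma lookup_Const_mult: "lookup (Const a * p) \<gamma> = a * lookup p \<gamma>"
proof -
  have "{x \<in> splits \<gamma>. fst x = 0} = {(0, \<gamma>)}" by (auto simp: splits_def)
  moreover have "lookup (Const a * p) \<gamma> = (\<Sum>x\<in>splits \<gamma>. if fst x = 0 then a * lookup p (snd x) else 0)"
    unfolding lookup_mult_splits by (rule sum.cong) (auto simp: Const_def lookup_single when_def)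
  ultimately show ?thesis by (simp flip: sum.inter_filter)
qed

lemma lookup_power_sum_combination:
  "lookup (\<Sum>\<mu>\<in>\<Lambda>. Const (c \<mu>) * power_sum_partition n \<mu>) \<gamma> =
     (\<Sum>\<mu>\<in>\<Lambda>. c \<mu> * lookup (power_sum_partition n \<mu>) \<gamma>)"
  by (simp add: lookup_sum lookup_Const_mult)

lemma lookup_power_sum_combination_eq:
  assumes "keys \<gamma> \<subseteq> {1..n}"
  shows "lookup (\<Sum>\<mu>\<in>parts m d. Const (c \<mu>) * power_sum_partition n \<mu>) \<gamma> =
     (\<Sum>\<mu>\<in>parts m d. c \<mu> * transition \<mu> (mtype \<gamma>))"
  unfolding lookup_power_sum_combination
  by (intro sum.cong refl) (simp add: lookup_power_sum_partition[OF assms] zero_notin_parts)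

lemma lookup_power_sum_combination_nonzeroD:
  assumes "lookup (\<Sum>\<mu>\<in>parts m d. Const (c \<mu>) * power_sum_partition n \<mu>) \<gamma> \<noteq> 0"
  shows "keys \<gamma> \<subseteq> {1..n} \<and> mtype \<gamma> \<in> parts m d"
proof -
  obtain \<mu> where \<mu>: "\<mu> \<in> parts m d" "c \<mu> * lookup (power_sum_partition n \<mu>) \<gamma> \<noteq> 0"
    using assms unfolding lookup_power_sum_combination by (rule sum.not_neutral_contains_not_neutral)
  then have nz: "lookup (power_sum_partition n \<mu>) \<gamma> \<noteq> 0" by auto
  have p: "\<forall>r\<in>#\<mu>. m dvd r" "sum_mset \<mu> = 2 * d" using \<mu> by (auto simp: parts_def partitions_of_def)
  show ?thesis
    using lookup_power_sum_partition_nonzeroD(1,2)[OF nz] lookup_power_sum_partition_nonzeroD(3)[OF nz p(1)] p(2)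
    by (simp add: mtype_in_parts_iff)
qed

lemma sum_of_squares_inI:
  assumes "finite X" "\<And>x. x \<in> X \<Longrightarrow> p x \<in> polys_in n"
  shows "sum_of_squares_in n (\<Sum>x\<in>X. p x ^ 2)"
proof -
  obtain xs where xs: "set xs = X" "distinct xs" using finite_distinct_list[OF assms(1)] by auto
  then have "(\<Sum>x\<in>X. p x ^ 2) = (\<Sum>q\<leftarrow>map p xs. q ^ 2)"
    by (simp add: sum_list_distinct_conv_sum_set o_def)
  then show ?thesis
    unfolding sum_of_squares_in_def using xs assms(2) by (intro exI[of _ "map p xs"]) auto
qed

lemma lookup_sum_single:
  assumes "finite M"
  shows "lookup (\<Sum>\<alpha>\<in>M. single \<alpha> (w \<alpha>)) \<beta> = (if \<beta> \<in> M then w \<beta> else (0::real))"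
  using assms by (simp add: lookup_sum lookup_single when_def)

text \<open>For every list \<open>ps\<close> of distinct variables, the monomials
  \<open>\<alpha>\<close> containing them are collected with coefficient
  \<open>g (label \<alpha> ps)\<close>, separated by residues along \<open>ps\<close>. The squares
  of these polynomials add up to coefficients \<open>pair_sum G'\<close>, whatever \<open>n\<close>
  is, so one \<open>c\<close> serves all \<open>n\<close>.\<close>

lemma exists_stable_sos_with_pair_sum:
  fixes g :: "nat list \<times> nat multiset \<Rightarrow> real" and d m :: nat
  assumes m: "m = 1 \<or> m = 2"
  defines "G \<equiv> \<lambda>j j'. if j \<in> labels d m \<and> j' \<in> labels d m then g j * g j' else 0"
  shows "\<exists>c\<in>stable_sos (parts m d) (2 * d). \<forall>\<nu>\<in>parts m d.
    (\<Sum>\<mu>\<in>parts m d. c \<mu> * transition \<mu> \<nu>) = pair_sum G (mono_at 0 \<nu>)"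
proof -
  let ?J = "labels d m" and ?\<Lambda> = "parts m d"
  \<comment> \<open>\<open>G'\<close> is what the squares produce; on types in
    \<open>parts m d\<close> it has the same \<open>pair_sum\<close> as \<open>G\<close>.\<close>
  define G' where "G' = (\<lambda>j j'. if congruent_labels m j j' then G j j' else 0)"
  obtain c0 where c0: "\<forall>\<nu>\<in>?\<Lambda>. (\<Sum>\<mu>\<in>?\<Lambda>. c0 \<mu> * transition \<mu> \<nu>) = pair_sum G' (mono_at 0 \<nu>)"
    using exists_power_sum_coordinates[of m d "\<lambda>\<nu>. pair_sum G' (mono_at 0 \<nu>)"] by blast
  define c where "c = restrict c0 ?\<Lambda>"
  have c: "(\<Sum>\<mu>\<in>?\<Lambda>. c \<mu> * transition \<mu> \<nu>) = pair_sum G' (mono_at 0 \<nu>)" if "\<nu> \<in> ?\<Lambda>" for \<nu>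
    using c0 that by (auto simp: c_def cong: sum.cong)
  have "sum_of_squares_in n (\<Sum>\<mu>\<in>?\<Lambda>. Const (c \<mu>) * power_sum_partition n \<mu>)" for n
  proof -
    \<comment> \<open>Without the separation by residues, cross terms of noncongruent labels would
      yield monomials with exponents not divisible by \<open>m\<close>.\<close>
    define res where "res = (\<lambda>j :: nat list \<times> nat multiset. map (\<lambda>r. r mod m) (fst j))"
    define M where "M = (\<lambda>ps \<rho>. {\<alpha>. keys \<alpha> \<subseteq> {1..n} \<and> mdeg \<alpha> = d \<and> set ps \<subseteq> keys \<alpha> \<and>
        label \<alpha> ps \<in> ?J \<and> res (label \<alpha> ps) = \<rho>})"
    have finM: "finite (M ps \<rho>)" for ps \<rho>
      by (rule finite_subset[OF _ finite_monos_mdeg[of "{1..n}" d]]) (auto simp: M_def)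
    define p :: "nat list \<times> nat list \<Rightarrow> real_mpoly"
      where "p = (\<lambda>(ps, \<rho>). \<Sum>\<alpha>\<in>M ps \<rho>. single \<alpha> (g (label \<alpha> ps)))"
    have lookup_p: "lookup (p (ps, \<rho>)) \<alpha> = (if \<alpha> \<in> M ps \<rho> then g (label \<alpha> ps) else 0)" for ps \<rho> \<alpha>
      by (simp add: p_def lookup_sum_single finM)
    let ?X = "arrangements {1..n} \<times> res ` ?J"
    have sos: "sum_of_squares_in n (\<Sum>x\<in>?X. p x ^ 2)"
    proof (rule sum_of_squares_inI)
      fix x assume "x \<in> ?X"
      show "p x \<in> polys_in n"
        unfolding polys_in_def
      proof (intro CollectI ballI)
        fix \<alpha> assume "\<alpha> \<in> keys (p x)"
        then show "keys \<alpha> \<subseteq> {1..n}"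
          by (cases x) (simp add: in_keys_iff lookup_p M_def split: if_splits)
      qed
    qed auto
    have inner: "(\<Sum>\<rho>\<in>res ` ?J. lookup (p (ps, \<rho>)) \<alpha> * lookup (p (ps, \<rho>)) \<beta>) =
        (if set ps \<subseteq> keys \<alpha> \<inter> keys \<beta> then G' (label \<alpha> ps) (label \<beta> ps) else 0)"
      if "keys \<alpha> \<subseteq> {1..n}" "keys \<beta> \<subseteq> {1..n}" "distinct ps" for ps \<alpha> \<beta>
    proof (cases "set ps \<subseteq> keys \<alpha> \<inter> keys \<beta>")
      case True
      then have "ps \<in> arrangements (keys \<alpha>)" "ps \<in> arrangements (keys \<beta>)"
        using that by (auto simp: arrangements_def)
      note deg = this[THEN label_in_labels_iff[of _ _ d m]]
      have "lookup (p (ps, \<rho>)) \<alpha> * lookup (p (ps, \<rho>)) \<beta> =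
          (if res (label \<alpha> ps) = \<rho> then G' (label \<alpha> ps) (label \<beta> ps) else 0)" for \<rho>
        using that True deg
        by (auto simp: lookup_p M_def G'_def G_def congruent_labels_def res_def)
      then show ?thesis
        using True by (auto simp: G'_def G_def)
    next
      case False
      then show ?thesis by (auto simp: lookup_p M_def intro!: sum.neutral)
    qed
    have coeff: "lookup (\<Sum>x\<in>?X. p x ^ 2) \<gamma> = pair_sum G' \<gamma>" if "keys \<gamma> \<subseteq> {1..n}" for \<gamma>
    proof -
      have "lookup (\<Sum>x\<in>?X. p x ^ 2) \<gamma> =
          (\<Sum>x\<in>?X. \<Sum>(\<alpha>, \<beta>)\<in>splits \<gamma>. lookup (p x) \<alpha> * lookup (p x) \<beta>)"
        by (simp add: lookup_sum power2_eq_square lookup_mult_splits)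
      also have "\<dots> = (\<Sum>(\<alpha>, \<beta>)\<in>splits \<gamma>. \<Sum>x\<in>?X. lookup (p x) \<alpha> * lookup (p x) \<beta>)"
        by (subst sum.swap) (simp add: case_prod_beta)
      also have "\<dots> = (\<Sum>(\<alpha>, \<beta>)\<in>splits \<gamma>. \<Sum>ps\<in>arrangements {1..n}.
          \<Sum>\<rho>\<in>res ` ?J. lookup (p (ps, \<rho>)) \<alpha> * lookup (p (ps, \<rho>)) \<beta>)"
        by (simp add: sum.cartesian_product case_prod_beta)
      also have "\<dots> = pair_sum G' \<gamma>"
        unfolding pair_sum_def
      proof (intro sum.cong refl, clarify)
        fix \<alpha> \<beta> assume "(\<alpha>, \<beta>) \<in> splits \<gamma>"
        then have k: "keys \<alpha> \<subseteq> {1..n}" "keys \<beta> \<subseteq> {1..n}"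
          using that by (auto simp: splits_def keys_plus_nat)
        have "(\<Sum>ps\<in>arrangements {1..n}. \<Sum>\<rho>\<in>res ` ?J. lookup (p (ps, \<rho>)) \<alpha> * lookup (p (ps, \<rho>)) \<beta>) =
            (\<Sum>ps\<in>arrangements {1..n}. if set ps \<subseteq> keys \<alpha> \<inter> keys \<beta> then G' (label \<alpha> ps) (label \<beta> ps) else 0)"
          by (intro sum.cong refl inner k) (simp add: arrangements_def)
        also have "\<dots> = (\<Sum>ps\<in>{ps \<in> arrangements {1..n}. set ps \<subseteq> keys \<alpha> \<inter> keys \<beta>}. G' (label \<alpha> ps) (label \<beta> ps))"
          by (rule sum.inter_filter[symmetric]) simp
        also have "{ps \<in> arrangements {1..n}. set ps \<subseteq> keys \<alpha> \<inter> keys \<beta>} = arrangements (keys \<alpha> \<inter> keys \<beta>)"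
          using k unfolding arrangements_def by blast
        finally show "(\<Sum>ps\<in>arrangements {1..n}. \<Sum>\<rho>\<in>res ` ?J. lookup (p (ps, \<rho>)) \<alpha> * lookup (p (ps, \<rho>)) \<beta>) =
            (\<Sum>ps\<in>arrangements (keys \<alpha> \<inter> keys \<beta>). G' (label \<alpha> ps) (label \<beta> ps))" .
      qed
      finally show ?thesis .
    qed
    have "(\<Sum>\<mu>\<in>?\<Lambda>. Const (c \<mu>) * power_sum_partition n \<mu>) = (\<Sum>x\<in>?X. p x ^ 2)" (is "?f = ?g")
    proof (rule poly_mapping_eqI)
      fix \<gamma>
      consider "keys \<gamma> \<subseteq> {1..n}" "mtype \<gamma> \<in> ?\<Lambda>" | "keys \<gamma> \<subseteq> {1..n}" "mtype \<gamma> \<notin> ?\<Lambda>" | "\<not> keys \<gamma> \<subseteq> {1..n}"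
        by blast
      then show "lookup ?f \<gamma> = lookup ?g \<gamma>"
      proof cases
        case 1
        then show ?thesis
          unfolding lookup_power_sum_combination_eq[OF 1(1)] coeff[OF 1(1)] c[OF 1(2)] by (intro pair_sum_mtype)
      next
        case 2
        have "pair_sum G' \<gamma> = 0"
        proof (rule ccontr)
          assume "pair_sum G' \<gamma> \<noteq> 0"
          moreover have "j \<in> ?J \<and> j' \<in> ?J \<and> congruent_labels m j j'" if "G' j j' \<noteq> 0" for j j'
            using that by (simp add: G'_def G_def split: if_splits)
          ultimately have "mtype \<gamma> \<in> ?\<Lambda>"
            unfolding mtype_in_parts_iff by (rule pair_sum_nonzeroD[OF m])
          then show False using 2 by simp
        qed
        moreover have "lookup ?f \<gamma> = 0"
          using 2(2) lookup_power_sum_combination_nonzeroD[of c n m d \<gamma>] by blast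
        ultimately show ?thesis unfolding coeff[OF 2(1)] by (simp only:)
      next
        case 3
        have "lookup ?g \<gamma> = 0"
        proof (rule ccontr)
          assume "lookup ?g \<gamma> \<noteq> 0"
          then obtain x where "lookup (p x * p x) \<gamma> \<noteq> 0"
            by (auto simp: lookup_sum power2_eq_square elim: sum.not_neutral_contains_not_neutral)
          then obtain y where y: "y \<in> splits \<gamma>" "(case y of (\<alpha>, \<beta>) \<Rightarrow> lookup (p x) \<alpha> * lookup (p x) \<beta>) \<noteq> 0"
            unfolding lookup_mult_splits by (rule sum.not_neutral_contains_not_neutral)
          obtain \<alpha> \<beta> where "y = (\<alpha>, \<beta>)" by (cases y)
          moreover obtain ps \<rho> where "x = (ps, \<rho>)" by (cases x)
          ultimately have "keys \<alpha> \<subseteq> {1..n}" "keys \<beta> \<subseteq> {1..n}" "\<gamma> = \<alpha> + \<beta>"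
            using y by (auto simp: lookup_p M_def splits_def split: if_splits)
          then show False using 3 by (auto simp: keys_plus_nat)
        qed
        moreover have "lookup ?f \<gamma> = 0"
          using 3 lookup_power_sum_combination_nonzeroD[of c n m d \<gamma>] by blast
        ultimately show ?thesis by (simp only:)
      qed
    qed
    then show ?thesis using sos by simp
  qed
  moreover have "c \<in> coord_space ?\<Lambda>" by (simp add: c_def coord_space_def)
  ultimately have "c \<in> stable_sos ?\<Lambda> (2 * d)" by (simp add: stable_sos_def)
  moreover have "pair_sum G' (mono_at 0 \<nu>) = pair_sum G (mono_at 0 \<nu>)" if "\<nu> \<in> ?\<Lambda>" for \<nu>
    unfolding G'_def
  proof (rule pair_sum_congruent[OF m])
    show "m dvd lookup (mono_at 0 \<nu>) i" for i
      using that mtype_in_parts_iff[of "mono_at 0 \<nu>" m d] by (simp add: mtype_mono_at zero_notin_parts)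
  qed
  ultimately show ?thesis using c by metis
qed

subsection \<open>Bounding Gram matrices\<close>

text \<open>Squared Euclidean norm of the exponent vector; its strict convexity makes it the
  exponent of the weights in \<open>gram_bound\<close>.\<close>

definition nsq :: "mono \<Rightarrow> nat" where
  "nsq \<alpha> = (\<Sum>i\<in>keys \<alpha>. (lookup \<alpha> i)\<^sup>2)"

lemma nsq_altdef: "finite A \<Longrightarrow> keys \<alpha> \<subseteq> A \<Longrightarrow> nsq \<alpha> = (\<Sum>i\<in>A. (lookup \<alpha> i)\<^sup>2)"
  unfolding nsq_def by (intro sum.mono_neutral_left) (auto simp: in_keys_iff)

lemma double_mono_eq_iff: "\<alpha> + \<alpha> = \<beta> + \<beta> \<longleftrightarrow> \<alpha> = (\<beta> :: mono)"
proof
  assume eq: "\<alpha> + \<alpha> = \<beta> + \<beta>"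
  have "lookup \<alpha> i = lookup \<beta> i" for i
    using arg_cong[OF eq, of "\<lambda>\<gamma>. lookup \<gamma> i"] by (simp add: lookup_add)
  then show "\<alpha> = \<beta>" by (rule poly_mapping_eqI)
qed simp

text \<open>Parallelogram law: the right side exceeds \<open>2 * nsq \<alpha>\<close> by twice the
  squared length of \<open>\<beta> - \<alpha>\<close>, a nonzero integer vector.\<close>

lemma nsq_midpoint:
  assumes eq: "\<beta> + \<gamma> = \<alpha> + \<alpha>" and ne: "\<beta> \<noteq> \<gamma>"
  shows "2 * nsq \<alpha> + 2 \<le> nsq \<beta> + nsq \<gamma>"
proof -
  let ?A = "keys \<beta> \<union> keys \<gamma>"
  have sum: "lookup \<beta> i + lookup \<gamma> i = 2 * lookup \<alpha> i" for i
    using arg_cong[OF eq, of "\<lambda>\<gamma>. lookup \<gamma> i"] by (simp add: lookup_add)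
  have keys: "keys \<alpha> \<subseteq> ?A"
  proof
    fix i assume "i \<in> keys \<alpha>"
    then show "i \<in> ?A" using sum[of i] by (auto simp: in_keys_iff)
  qed
  have sq: "int (2 * a\<^sup>2) + 2 * (int b - int a)\<^sup>2 = int (b\<^sup>2 + c\<^sup>2)" if "b + c = 2 * a" for a b c :: nat
  proof -
    have c: "int c = 2 * int a - int b" using that by linarith
    then show ?thesis
      unfolding of_nat_add of_nat_mult of_nat_power c by (simp add: power2_eq_square algebra_simps)
  qed
  have le: "2 * (lookup \<alpha> i)\<^sup>2 \<le> (lookup \<beta> i)\<^sup>2 + (lookup \<gamma> i)\<^sup>2" for i
    using sq[OF sum[of i]] zero_le_power2[of "int (lookup \<beta> i) - int (lookup \<alpha> i)"] by linarith
  obtain k where "lookup \<beta> k \<noteq> lookup \<gamma> k" using ne poly_mapping_eqI by metis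
  then have k: "lookup \<beta> k \<noteq> lookup \<alpha> k" using sum[of k] by linarith
  then have "(int (lookup \<beta> k) - int (lookup \<alpha> k))\<^sup>2 > 0" by simp
  then have le': "2 * (lookup \<alpha> k)\<^sup>2 + 2 \<le> (lookup \<beta> k)\<^sup>2 + (lookup \<gamma> k)\<^sup>2"
    using sq[OF sum[of k]] by linarith
  have kA: "k \<in> ?A" using \<open>lookup \<beta> k \<noteq> lookup \<gamma> k\<close> by (auto simp: in_keys_iff)
  have "2 * nsq \<alpha> + 2 = (\<Sum>i\<in>?A - {k}. 2 * (lookup \<alpha> i)\<^sup>2) + (2 * (lookup \<alpha> k)\<^sup>2 + 2)"
    using kA by (simp add: nsq_altdef[OF _ keys] sum_distrib_left sum.remove)
  also have "\<dots> \<le> (\<Sum>i\<in>?A - {k}. (lookup \<beta> i)\<^sup>2 + (lookup \<gamma> i)\<^sup>2) + ((lookup \<beta> k)\<^sup>2 + (lookup \<gamma> k)\<^sup>2)"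
    by (intro add_mono sum_mono le le')
  also have "\<dots> = (\<Sum>i\<in>?A. (lookup \<beta> i)\<^sup>2 + (lookup \<gamma> i)\<^sup>2)"
    using kA by (subst (2) sum.remove[of _ k]) auto
  also have "\<dots> = nsq \<beta> + nsq \<gamma>"
    by (simp add: nsq_altdef[of ?A] sum.distrib)
  finally show ?thesis .
qed

text \<open>The weights are strictly log-convex in the exponent, so that the off-diagonal entries with
  \<open>\<beta> + \<gamma> = 2\<alpha>\<close> use up at most half of the weighted diagonal.\<close>

lemma gram_bound:
  fixes v :: "'x \<Rightarrow> mono \<Rightarrow> real"
  assumes M: "finite M"
    and h: "\<And>\<alpha>. \<alpha> \<in> M \<Longrightarrow> (\<Sum>(\<beta>, \<gamma>)\<in>splits (\<alpha> + \<alpha>). \<Sum>x\<in>X. v x \<beta> * v x \<gamma>) \<le> h \<alpha>"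
    and zero: "\<And>\<alpha> \<beta> \<gamma>. \<alpha> \<in> M \<Longrightarrow> \<beta> + \<gamma> = \<alpha> + \<alpha> \<Longrightarrow> (\<beta>, \<gamma>) \<notin> M \<times> M \<Longrightarrow> (\<Sum>x\<in>X. v x \<beta> * v x \<gamma>) = 0"
    and \<alpha>: "\<alpha> \<in> M"
  shows "(\<Sum>x\<in>X. (v x \<alpha>)\<^sup>2) \<le> 2 * (\<Sum>\<beta>\<in>M. real (card M + 1) ^ (2 * nsq \<beta>) * h \<beta>)"
proof -
  \<comment> \<open>This base is large enough for \<open>card M / T\<^sup>2\<close> to be at most
    1/2, which is the share of the weighted diagonal lost below.\<close>
  define T where "T = real (card M + 1)"
  define Q where "Q = (\<lambda>\<beta> \<gamma>. \<Sum>x\<in>X. v x \<beta> * v x \<gamma>)"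
  define w where "w = (\<lambda>\<beta>. T ^ (2 * nsq \<beta>) * Q \<beta> \<beta>)"
  define P where "P = (\<lambda>\<alpha>. {x \<in> M \<times> M. fst x + snd x = \<alpha> + \<alpha> \<and> fst x \<noteq> snd x})"
  have T: "T \<ge> 1" by (simp add: T_def)
  have Q0: "Q \<beta> \<beta> \<ge> 0" for \<beta> unfolding Q_def by (intro sum_nonneg) simp
  then have w0: "w \<beta> \<ge> 0" for \<beta> using T by (simp add: w_def)
  have finP: "finite (P \<alpha>)" for \<alpha> using M by (simp add: P_def)
  have diag: "(\<Sum>(\<beta>, \<gamma>)\<in>splits (\<alpha> + \<alpha>). Q \<beta> \<gamma>) = Q \<alpha> \<alpha> + (\<Sum>x\<in>P \<alpha>. Q (fst x) (snd x))" if "\<alpha> \<in> M" for \<alpha>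
  proof -
    have "(\<Sum>(\<beta>, \<gamma>)\<in>splits (\<alpha> + \<alpha>). Q \<beta> \<gamma>) = (\<Sum>(\<beta>, \<gamma>)\<in>insert (\<alpha>, \<alpha>) (P \<alpha>). Q \<beta> \<gamma>)"
    proof (rule sum.mono_neutral_right)
      show "insert (\<alpha>, \<alpha>) (P \<alpha>) \<subseteq> splits (\<alpha> + \<alpha>)" by (auto simp: P_def splits_def)
      show "\<forall>x\<in>splits (\<alpha> + \<alpha>) - insert (\<alpha>, \<alpha>) (P \<alpha>). (case x of (\<beta>, \<gamma>) \<Rightarrow> Q \<beta> \<gamma>) = 0"
      proof
        fix x assume "x \<in> splits (\<alpha> + \<alpha>) - insert (\<alpha>, \<alpha>) (P \<alpha>)"
        moreover obtain \<beta> \<gamma> where x_eq: "x = (\<beta>, \<gamma>)" by (cases x)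
        ultimately have x: "(\<beta>, \<gamma>) \<in> splits (\<alpha> + \<alpha>)" "(\<beta>, \<gamma>) \<notin> insert (\<alpha>, \<alpha>) (P \<alpha>)" by auto
        then have "(\<beta>, \<gamma>) \<notin> M \<times> M"
          by (auto simp: P_def splits_def double_mono_eq_iff)
        then show "(case x of (\<beta>, \<gamma>) \<Rightarrow> Q \<beta> \<gamma>) = 0" using zero[OF that] x by (auto simp: x_eq Q_def splits_def)
      qed
    qed simp
    also have "\<dots> = Q \<alpha> \<alpha> + (\<Sum>x\<in>P \<alpha>. Q (fst x) (snd x))"
      using finP by (subst sum.insert) (auto simp: P_def case_prod_beta)
    finally show ?thesis .
  qed
  \<comment> \<open>The midpoint inequality gains the factor \<open>T\<^sup>2\<close>; the rest is
    the arithmetic-geometric mean inequality for each \<open>x\<close>.\<close>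
  have off: "T ^ (2 * nsq \<alpha>) * \<bar>Q \<beta> \<gamma>\<bar> \<le> (w \<beta> + w \<gamma>) / 2 / T\<^sup>2" if "(\<beta>, \<gamma>) \<in> P \<alpha>" for \<alpha> \<beta> \<gamma>
  proof -
    have "T ^ (2 * nsq \<alpha>) * T\<^sup>2 \<le> T ^ nsq \<beta> * T ^ nsq \<gamma>"
      unfolding power_add[symmetric] using that T nsq_midpoint[of \<beta> \<gamma> \<alpha>]
      by (intro power_increasing) (auto simp: P_def)
    then have "T ^ (2 * nsq \<alpha>) * T\<^sup>2 * \<bar>Q \<beta> \<gamma>\<bar> \<le> T ^ nsq \<beta> * T ^ nsq \<gamma> * \<bar>Q \<beta> \<gamma>\<bar>"
      by (intro mult_right_mono) auto
    also have "\<dots> \<le> T ^ nsq \<beta> * T ^ nsq \<gamma> * (\<Sum>x\<in>X. \<bar>v x \<beta> * v x \<gamma>\<bar>)"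
      unfolding Q_def using T by (intro mult_left_mono sum_abs) auto
    also have "\<dots> \<le> (\<Sum>x\<in>X. ((T ^ nsq \<beta> * v x \<beta>)\<^sup>2 + (T ^ nsq \<gamma> * v x \<gamma>)\<^sup>2) / 2)"
      unfolding sum_distrib_left
    proof (rule sum_mono)
      fix x
      have "2 * \<bar>a * b\<bar> \<le> a\<^sup>2 + b\<^sup>2" for a b :: real
        using sum_squares_bound[of "\<bar>a\<bar>" "\<bar>b\<bar>"] by (simp add: abs_mult mult.assoc)
      from this[of "T ^ nsq \<beta> * v x \<beta>" "T ^ nsq \<gamma> * v x \<gamma>"]
      show "T ^ nsq \<beta> * T ^ nsq \<gamma> * \<bar>v x \<beta> * v x \<gamma>\<bar> \<le> ((T ^ nsq \<beta> * v x \<beta>)\<^sup>2 + (T ^ nsq \<gamma> * v x \<gamma>)\<^sup>2) / 2"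
        using T by (simp add: abs_mult mult_ac)
    qed
    also have "\<dots> = (w \<beta> + w \<gamma>) / 2"
      by (simp add: w_def Q_def power_mult_distrib sum.distrib power_mult[symmetric] mult.commute sum_distrib_left
        power2_eq_square[of "v _ _"] flip: sum_divide_distrib)
    finally show ?thesis
      using T by (simp add: field_simps)
  qed
  \<comment> \<open>A pair determines its midpoint, so the sets \<open>P \<alpha>\<close> are
    disjoint subsets of \<open>M \<times> M\<close>, and each weight is used at most
    \<open>2 * card M\<close> times.\<close>
  have "(\<Sum>\<alpha>\<in>M. \<Sum>x\<in>P \<alpha>. w (fst x) + w (snd x)) = (\<Sum>x\<in>(\<Union>\<alpha>\<in>M. P \<alpha>). w (fst x) + w (snd x))"
  proof (rule sum.UNION_disjoint[symmetric])
    show "\<forall>\<alpha>\<in>M. \<forall>\<beta>\<in>M. \<alpha> \<noteq> \<beta> \<longrightarrow> P \<alpha> \<inter> P \<beta> = {}"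
      unfolding P_def using double_mono_eq_iff by fastforce
  qed (use M finP in auto)
  also have "\<dots> \<le> (\<Sum>x\<in>M \<times> M. w (fst x) + w (snd x))"
    by (rule sum_mono2) (use M w0 in \<open>auto simp: P_def\<close>)
  also have "\<dots> = (\<Sum>\<beta>\<in>M. \<Sum>\<gamma>\<in>M. w \<beta> + w \<gamma>)"
    by (simp add: sum.cartesian_product case_prod_beta)
  also have "\<dots> = 2 * real (card M) * (\<Sum>\<beta>\<in>M. w \<beta>)"
    by (simp add: sum.distrib flip: sum_distrib_left)
  finally have pairs: "(\<Sum>\<alpha>\<in>M. \<Sum>x\<in>P \<alpha>. w (fst x) + w (snd x)) \<le> 2 * real (card M) * (\<Sum>\<beta>\<in>M. w \<beta>)" .
  have "(\<Sum>\<alpha>\<in>M. w \<alpha>) - (\<Sum>\<alpha>\<in>M. T ^ (2 * nsq \<alpha>) * h \<alpha>) \<le> (\<Sum>\<alpha>\<in>M. \<Sum>x\<in>P \<alpha>. (w (fst x) + w (snd x)) / 2 / T\<^sup>2)"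
    unfolding sum_subtractf[symmetric]
  proof (rule sum_mono)
    fix \<alpha> assume a: "\<alpha> \<in> M"
    have "Q \<alpha> \<alpha> - h \<alpha> \<le> - (\<Sum>x\<in>P \<alpha>. Q (fst x) (snd x))"
      using h[OF a] diag[OF a] unfolding Q_def by linarith
    also have "\<dots> \<le> (\<Sum>x\<in>P \<alpha>. \<bar>Q (fst x) (snd x)\<bar>)"
      unfolding sum_negf[symmetric] by (intro sum_mono) auto
    finally have "T ^ (2 * nsq \<alpha>) * (Q \<alpha> \<alpha> - h \<alpha>) \<le> T ^ (2 * nsq \<alpha>) * (\<Sum>x\<in>P \<alpha>. \<bar>Q (fst x) (snd x)\<bar>)"
      using T by (intro mult_left_mono) auto
    also have "\<dots> \<le> (\<Sum>x\<in>P \<alpha>. (w (fst x) + w (snd x)) / 2 / T\<^sup>2)"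
      unfolding sum_distrib_left by (intro sum_mono off) auto
    finally show "w \<alpha> - T ^ (2 * nsq \<alpha>) * h \<alpha> \<le> (\<Sum>x\<in>P \<alpha>. (w (fst x) + w (snd x)) / 2 / T\<^sup>2)"
      by (simp add: w_def algebra_simps)
  qed
  also have "\<dots> = (\<Sum>\<alpha>\<in>M. \<Sum>x\<in>P \<alpha>. w (fst x) + w (snd x)) / 2 / T\<^sup>2"
    by (simp add: sum_divide_distrib)
  also have "\<dots> \<le> (2 * real (card M) * (\<Sum>\<beta>\<in>M. w \<beta>)) / 2 / T\<^sup>2"
    using pairs by (intro divide_right_mono) auto
  also have "\<dots> = real (card M) / T\<^sup>2 * (\<Sum>\<beta>\<in>M. w \<beta>)"
    by simp
  also have "\<dots> \<le> 1 / 2 * (\<Sum>\<beta>\<in>M. w \<beta>)"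
  proof (rule mult_right_mono)
    show "real (card M) / T\<^sup>2 \<le> 1 / 2"
      by (simp add: T_def divide_simps power2_eq_square algebra_simps)
  qed (simp add: sum_nonneg w0)
  finally have main: "(\<Sum>\<beta>\<in>M. w \<beta>) \<le> 2 * (\<Sum>\<alpha>\<in>M. T ^ (2 * nsq \<alpha>) * h \<alpha>)"
    by simp
  have "Q \<alpha> \<alpha> \<le> w \<alpha>"
    unfolding w_def using mult_right_mono[OF one_le_power[OF T, of "2 * nsq \<alpha>"] Q0[of \<alpha>]] by simp
  also have "\<dots> \<le> (\<Sum>\<beta>\<in>M. w \<beta>)"
    using M \<alpha> w0 by (intro member_le_sum) auto
  finally show ?thesis using main by (simp add: Q_def T_def power2_eq_square)
qed

subsection \<open>Symmetric Gram matrices\<close>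

lemma sum_fst_ptype: "sum_mset (image_mset fst (ptype \<alpha> \<beta>)) = mdeg \<alpha>"
  by (simp add: ptype_def multiset.map_comp o_def mdeg_altdef[of "keys \<alpha> \<union> keys \<beta>"] sum_unfold_sum_mset)

lemma sum_snd_ptype: "sum_mset (image_mset snd (ptype \<alpha> \<beta>)) = mdeg \<beta>"
  by (simp add: ptype_def multiset.map_comp o_def mdeg_altdef[of "keys \<alpha> \<union> keys \<beta>"] sum_unfold_sum_mset)

text \<open>The functions \<open>v x\<close> play the role of the coefficient vectors of the
  squares. The vanishing clause ranges over every multiset \<open>P\<close>, also those not realized
  in \<open>n\<close> variables, because cumulants evaluate \<open>q\<close> at arbitrary
  multisets.\<close>

definition symmetric_gram ::
    "nat \<Rightarrow> nat \<Rightarrow> nat \<Rightarrow> (nat multiset \<Rightarrow> real) \<Rightarrow> 'x set \<Rightarrow> ('x \<Rightarrow> mono \<Rightarrow> real) \<Rightarrow> ((nat \<times> nat) multiset \<Rightarrow> real) \<Rightarrow> bool" where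
  "symmetric_gram n m d c X v q \<longleftrightarrow> finite X \<and>
     (\<forall>\<alpha> \<beta>. keys \<alpha> \<subseteq> {1..n} \<longrightarrow> keys \<beta> \<subseteq> {1..n} \<longrightarrow> (\<Sum>x\<in>X. v x \<alpha> * v x \<beta>) = q (ptype \<alpha> \<beta>)) \<and>
     (\<forall>P. q P \<noteq> 0 \<longrightarrow> sum_mset (image_mset fst P) = d \<and> sum_mset (image_mset snd P) = d \<and>
        (\<forall>z\<in>#P. fst z mod m = snd z mod m)) \<and>
     (\<forall>\<gamma>. keys \<gamma> \<subseteq> {1..n} \<longrightarrow> mtype \<gamma> \<in> parts m d \<longrightarrow>
        (\<Sum>(\<alpha>, \<beta>)\<in>splits \<gamma>. q (ptype \<alpha> \<beta>)) = (\<Sum>\<mu>\<in>parts m d. c \<mu> * transition \<mu> (mtype \<gamma>)))"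

lemma lookup_sum_squares:
  fixes qs :: "real_mpoly list"
  shows
  "lookup (\<Sum>q\<leftarrow>qs. q ^ 2) \<gamma> =
     (\<Sum>(\<alpha>, \<beta>)\<in>splits \<gamma>. \<Sum>i<length qs. lookup (qs ! i) \<alpha> * lookup (qs ! i) \<beta>)"
proof -
  have "(\<Sum>q\<leftarrow>qs. q ^ 2) = (\<Sum>i<length qs. (qs ! i) ^ 2)"
    by (simp add: sum_list_sum_nth atLeast0LessThan)
  then show ?thesis
    by (simp add: lookup_sum power2_eq_square lookup_mult_splits case_prod_beta sum.swap[of _ "{..<length qs}"])
qed

text \<open>If the largest degree \<open>D\<close> of a monomial in the squares exceeded
  \<open>d\<close>, the monomials of degree \<open>D\<close> would satisfy \<open>gram_bound\<close>
  with \<open>h = 0\<close>, since no coefficient of degree \<open>2 * D\<close> survives. Their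
  coefficients would all vanish.\<close>

lemma sum_of_squares_degree_le:
  fixes qs :: "real_mpoly list"
  assumes f: "\<And>\<gamma>. lookup (\<Sum>q\<leftarrow>qs. q ^ 2) \<gamma> \<noteq> 0 \<Longrightarrow> mdeg \<gamma> = 2 * d"
    and q: "i < length qs" "lookup (qs ! i) \<alpha> \<noteq> 0"
  shows "mdeg \<alpha> \<le> d"
proof (rule ccontr)
  assume "\<not> mdeg \<alpha> \<le> d"
  define S where "S = (\<Union>i<length qs. keys (qs ! i))"
  have finS: "finite S" by (simp add: S_def)
  have \<alpha>: "\<alpha> \<in> S" using q by (auto simp: S_def in_keys_iff)
  define D where "D = Max (mdeg ` S)"
  have le: "mdeg \<beta> \<le> D" if "\<beta> \<in> S" for \<beta>
    using that finS by (simp add: D_def)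
  have "D > d" using le[OF \<alpha>] \<open>\<not> mdeg \<alpha> \<le> d\<close> by simp
  define M where "M = {\<beta> \<in> S. mdeg \<beta> = D}"
  obtain \<beta> where "\<beta> \<in> M" using Max_in[of "mdeg ` S"] finS \<alpha> unfolding M_def D_def by fastforce
  then obtain k where k: "k < length qs" "lookup (qs ! k) \<beta> \<noteq> 0"
    by (auto simp: M_def S_def in_keys_iff)
  have "(\<Sum>i<length qs. (lookup (qs ! i) \<beta>)\<^sup>2) \<le> 2 * (\<Sum>\<beta>\<in>M. real (card M + 1) ^ (2 * nsq \<beta>) * 0)"
  proof (rule gram_bound[OF _ _ _ \<open>\<beta> \<in> M\<close>])
    show "finite M" using finS by (simp add: M_def)
    fix \<gamma> assume g: "\<gamma> \<in> M"
    then have "mdeg (\<gamma> + \<gamma>) \<noteq> 2 * d" using \<open>D > d\<close> by (simp add: M_def mdeg_plus)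
    then show "(\<Sum>(\<alpha>, \<beta>)\<in>splits (\<gamma> + \<gamma>). \<Sum>i<length qs. lookup (qs ! i) \<alpha> * lookup (qs ! i) \<beta>) \<le> 0"
      using f[of "\<gamma> + \<gamma>"] unfolding lookup_sum_squares[symmetric] by (metis order_refl)
    fix \<alpha> \<beta> assume eq: "\<alpha> + \<beta> = \<gamma> + \<gamma>" and notin: "(\<alpha>, \<beta>) \<notin> M \<times> M"
    have "lookup (qs ! i) \<alpha> * lookup (qs ! i) \<beta> = 0" if "i < length qs" for i
    proof (rule ccontr)
      assume "lookup (qs ! i) \<alpha> * lookup (qs ! i) \<beta> \<noteq> 0"
      then have S: "\<alpha> \<in> S" "\<beta> \<in> S" using that by (auto simp: S_def in_keys_iff)
      have "mdeg \<alpha> + mdeg \<beta> = D + D" using arg_cong[OF eq, of mdeg] g by (simp add: mdeg_plus M_def)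
      then show False using le[OF S(1)] le[OF S(2)] S notin by (auto simp: M_def)
    qed
    then show "(\<Sum>i<length qs. lookup (qs ! i) \<alpha> * lookup (qs ! i) \<beta>) = 0" by (intro sum.neutral) auto
  qed
  then have "(\<Sum>i<length qs. (lookup (qs ! i) \<beta>)\<^sup>2) \<le> 0" by simp
  moreover have "(\<Sum>i<length qs. (lookup (qs ! i) \<beta>)\<^sup>2) > 0"
    by (rule sum_pos2[of _ k]) (use k in auto)
  ultimately show False by simp
qed

text \<open>The given squares are averaged over all permutations, restricted to degree
  \<open>d\<close> and split by residues modulo \<open>m\<close>; an index in \<open>X\<close>
  records permutation, square and residue pattern. For monomials with type in
  \<open>parts m d\<close> none of this changes the coefficient.\<close>

lemma exists_symmetric_gram:
  assumes m: "m = 1 \<or> m = 2"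
    and sos: "sum_of_squares_in n (\<Sum>\<mu>\<in>parts m d. Const (c \<mu>) * power_sum_partition n \<mu>)"
  shows "\<exists>(X :: ((nat \<Rightarrow> nat) \<times> nat \<times> (nat \<Rightarrow> nat)) set) v q. symmetric_gram n m d c X v q"
proof -
  define f where "f = (\<Sum>\<mu>\<in>parts m d. Const (c \<mu>) * power_sum_partition n \<mu>)"
  obtain qs where f_qs: "f = (\<Sum>q\<leftarrow>qs. q ^ 2)"
    using sos by (auto simp: sum_of_squares_in_def f_def)
  define r where "r = (\<lambda>i. lookup (qs ! i))"
  define I where "I = {..<length qs}"
  have lookup_f: "lookup f \<gamma> = (\<Sum>(\<alpha>, \<beta>)\<in>splits \<gamma>. \<Sum>i\<in>I. r i \<alpha> * r i \<beta>)" for \<gamma>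
    unfolding f_qs r_def I_def by (rule lookup_sum_squares)
  have "mdeg \<gamma> = 2 * d" if "lookup f \<gamma> \<noteq> 0" for \<gamma>
    using lookup_power_sum_combination_nonzeroD[of c n m d \<gamma>] that by (auto simp: f_def mtype_in_parts_iff)
  then have deg: "mdeg \<alpha> \<le> d" if "i \<in> I" "r i \<alpha> \<noteq> 0" for i \<alpha>
    using sum_of_squares_degree_le[of qs d i \<alpha>] that by (simp add: f_qs I_def r_def)
  define res where "res = (\<lambda>(\<alpha> :: mono) k. lookup \<alpha> k mod m)"
  define perms where "perms = {\<pi>. \<pi> permutes {1..n}}"
  define mons where "mons = {\<alpha>. keys \<alpha> \<subseteq> {1..n} \<and> mdeg \<alpha> = d}"
  define X where "X = perms \<times> I \<times> res ` mons"
  \<comment> \<open>The square root enters twice in each product, which turns the sum over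
    permutations into the mean.\<close>
  define v where "v = (\<lambda>(\<pi>, i, \<rho>) \<alpha>. (if res \<alpha> = \<rho> \<and> mdeg \<alpha> = d then r i (rename \<pi> \<alpha>) else 0) / sqrt (fact n))"
  define Q where "Q = (\<lambda>\<alpha> \<beta>. if res \<alpha> = res \<beta> \<and> mdeg \<alpha> = d \<and> mdeg \<beta> = d
      then (\<Sum>\<pi>\<in>perms. \<Sum>i\<in>I. r i (rename \<pi> \<alpha>) * r i (rename \<pi> \<beta>)) / fact n else 0)"
  have fin: "finite perms" "finite I" "finite mons"
    by (simp_all add: perms_def I_def mons_def finite_permutations finite_monos_mdeg)
  then have finX: "finite X" by (simp add: X_def)
  have gram: "(\<Sum>x\<in>X. v x \<alpha> * v x \<beta>) = Q \<alpha> \<beta>" if k: "keys \<alpha> \<subseteq> {1..n}" for \<alpha> \<beta> :: mono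
  proof (cases "mdeg \<alpha> = d \<and> mdeg \<beta> = d")
    case True
    then have R: "res \<alpha> \<in> res ` mons" using k by (auto simp: mons_def)
    have "(\<Sum>x\<in>X. v x \<alpha> * v x \<beta>) = (\<Sum>\<pi>\<in>perms. \<Sum>i\<in>I. \<Sum>\<rho>\<in>res ` mons. v (\<pi>, i, \<rho>) \<alpha> * v (\<pi>, i, \<rho>) \<beta>)"
      by (simp add: X_def sum.cartesian_product case_prod_beta)
    also have "\<dots> = (\<Sum>\<pi>\<in>perms. \<Sum>i\<in>I. \<Sum>\<rho>\<in>res ` mons. if \<rho> = res \<alpha> then
        (if res \<alpha> = res \<beta> then r i (rename \<pi> \<alpha>) * r i (rename \<pi> \<beta>) / fact n else 0) else 0)"
      by (intro sum.cong refl) (use True in \<open>auto simp: v_def\<close>)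
    also have "\<dots> = Q \<alpha> \<beta>"
      using R fin True by (simp add: Q_def sum_divide_distrib)
    finally show ?thesis .
  qed (auto simp: Q_def v_def intro!: sum.neutral)
  have Q_rename: "Q (rename \<sigma> \<alpha>) (rename \<sigma> \<beta>) = Q \<alpha> \<beta>" if \<sigma>: "\<sigma> permutes {1..n}" for \<sigma> \<alpha> \<beta>
  proof -
    have b: "bij \<sigma>" using \<sigma> by (rule permutes_bij)
    have "res (rename \<sigma> \<alpha>) = res \<alpha> \<circ> \<sigma>" for \<alpha> using b by (auto simp: res_def lookup_rename)
    then have res: "res (rename \<sigma> \<alpha>) = res (rename \<sigma> \<beta>) \<longleftrightarrow> res \<alpha> = res \<beta>"
      using b by (metis bij_is_surj surj_fun_eq comp_apply UNIV_I ext)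
    have "(\<Sum>\<pi>\<in>perms. \<Sum>i\<in>I. r i (rename \<pi> (rename \<sigma> \<alpha>)) * r i (rename \<pi> (rename \<sigma> \<beta>))) =
        (\<Sum>\<pi>\<in>perms. \<Sum>i\<in>I. r i (rename (\<sigma> \<circ> \<pi>) \<alpha>) * r i (rename (\<sigma> \<circ> \<pi>) \<beta>))"
      by (intro sum.cong refl) (simp add: perms_def rename_rename[OF b] permutes_bij)
    also have "\<dots> = (\<Sum>\<pi>\<in>perms. \<Sum>i\<in>I. r i (rename \<pi> \<alpha>) * r i (rename \<pi> \<beta>))"
      unfolding perms_def by (rule setum_permutations_compose_left[OF \<sigma>, symmetric])
    finally show ?thesis by (simp add: Q_def res mdeg_rename[OF b])
  qed
  \<comment> \<open>The first conjunct says that \<open>Q\<close> factors through pair types. The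
    second also constrains the values at pair types that do not occur in \<open>n\<close>
    variables.\<close>
  have "\<forall>P. \<exists>y. (\<forall>\<alpha> \<beta>. keys \<alpha> \<subseteq> {1..n} \<longrightarrow> keys \<beta> \<subseteq> {1..n} \<longrightarrow> ptype \<alpha> \<beta> = P \<longrightarrow> Q \<alpha> \<beta> = y) \<and>
      (y \<noteq> 0 \<longrightarrow> (\<exists>\<alpha> \<beta>. ptype \<alpha> \<beta> = P \<and> Q \<alpha> \<beta> \<noteq> 0))"
  proof
    fix P
    show "\<exists>y. (\<forall>\<alpha> \<beta>. keys \<alpha> \<subseteq> {1..n} \<longrightarrow> keys \<beta> \<subseteq> {1..n} \<longrightarrow> ptype \<alpha> \<beta> = P \<longrightarrow> Q \<alpha> \<beta> = y) \<and>
      (y \<noteq> 0 \<longrightarrow> (\<exists>\<alpha> \<beta>. ptype \<alpha> \<beta> = P \<and> Q \<alpha> \<beta> \<noteq> 0))"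
    proof (cases "\<exists>\<alpha> \<beta>. keys \<alpha> \<subseteq> {1..n} \<and> keys \<beta> \<subseteq> {1..n} \<and> ptype \<alpha> \<beta> = P")
      case True
      then obtain \<alpha>0 \<beta>0 where 0: "keys \<alpha>0 \<subseteq> {1..n}" "keys \<beta>0 \<subseteq> {1..n}" "ptype \<alpha>0 \<beta>0 = P" by blast
      have "Q \<alpha> \<beta> = Q \<alpha>0 \<beta>0" if k: "keys \<alpha> \<subseteq> {1..n}" "keys \<beta> \<subseteq> {1..n}" "ptype \<alpha> \<beta> = P" for \<alpha> \<beta>
      proof -
        obtain \<pi> where "\<pi> permutes {1..n}" "\<alpha> = rename \<pi> \<alpha>0" "\<beta> = rename \<pi> \<beta>0"
          by (rule ptype_eq_imp_rename[of \<alpha> \<beta> \<alpha>0 \<beta>0 "{1..n}"]) (use k 0 in auto)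
        then show ?thesis by (simp add: Q_rename)
      qed
      then show ?thesis using 0 by (intro exI[of _ "Q \<alpha>0 \<beta>0"]) blast
    next
      case False
      then show ?thesis by (intro exI[of _ 0]) blast
    qed
  qed
  from choice[OF this] obtain q where
    q: "\<And>\<alpha> \<beta>. keys \<alpha> \<subseteq> {1..n} \<Longrightarrow> keys \<beta> \<subseteq> {1..n} \<Longrightarrow> Q \<alpha> \<beta> = q (ptype \<alpha> \<beta>)"
    and q_nz: "\<And>P. q P \<noteq> 0 \<Longrightarrow> \<exists>\<alpha> \<beta>. ptype \<alpha> \<beta> = P \<and> Q \<alpha> \<beta> \<noteq> 0"
    by blast
  have "symmetric_gram n m d c X v q"
    unfolding symmetric_gram_def
  proof (intro conjI allI impI finX)
    fix \<alpha> \<beta> :: mono assume "keys \<alpha> \<subseteq> {1..n}" "keys \<beta> \<subseteq> {1..n}"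
    then show "(\<Sum>x\<in>X. v x \<alpha> * v x \<beta>) = q (ptype \<alpha> \<beta>)" by (simp add: gram q)
  next
    fix P assume "q P \<noteq> 0"
    then obtain \<alpha> \<beta> where P: "P = ptype \<alpha> \<beta>" "Q \<alpha> \<beta> \<noteq> 0" using q_nz by blast
    then have *: "res \<alpha> = res \<beta>" "mdeg \<alpha> = d" "mdeg \<beta> = d" by (auto simp: Q_def split: if_splits)
    show "sum_mset (image_mset fst P) = d" "sum_mset (image_mset snd P) = d"
      using * by (simp_all add: P sum_fst_ptype sum_snd_ptype)
    have "lookup \<alpha> k mod m = lookup \<beta> k mod m" for k
      using fun_cong[OF *(1), of k] by (simp add: res_def)
    then show "\<forall>z\<in>#P. fst z mod m = snd z mod m"
      by (auto simp: P ptype_def)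
  next
    fix \<gamma> assume g: "keys \<gamma> \<subseteq> {1..n}" "mtype \<gamma> \<in> parts m d"
    have "(\<Sum>(\<alpha>, \<beta>)\<in>splits \<gamma>. q (ptype \<alpha> \<beta>)) =
        (\<Sum>(\<alpha>, \<beta>)\<in>splits \<gamma>. \<Sum>\<pi>\<in>perms. (\<Sum>i\<in>I. r i (rename \<pi> \<alpha>) * r i (rename \<pi> \<beta>)) / fact n)"
    proof (intro sum.cong refl, clarify)
      fix \<alpha> \<beta> assume s: "(\<alpha>, \<beta>) \<in> splits \<gamma>"
      then have k: "keys \<alpha> \<subseteq> {1..n}" "keys \<beta> \<subseteq> {1..n}" using g by (auto simp: splits_def keys_plus_nat)
      have sum: "mdeg \<alpha> + mdeg \<beta> = 2 * d" "\<And>k. m dvd lookup \<alpha> k + lookup \<beta> k"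
        using s g(2) by (auto simp: splits_def mtype_in_parts_iff mdeg_plus lookup_add)
      have res: "res \<alpha> = res \<beta>" using sum(2) by (auto simp: res_def dvd_add_iff_mod_eq[OF m])
      \<comment> \<open>The residues agree automatically, and the degrees add up to
        \<open>2 * d\<close>. If they are not both \<open>d\<close>, one exceeds \<open>d\<close>
        and the unrestricted average vanishes as well.\<close>
      have "Q \<alpha> \<beta> = (\<Sum>\<pi>\<in>perms. \<Sum>i\<in>I. r i (rename \<pi> \<alpha>) * r i (rename \<pi> \<beta>)) / fact n"
      proof (cases "mdeg \<alpha> = d \<and> mdeg \<beta> = d")
        case False
        have "r i (rename \<pi> \<alpha>) * r i (rename \<pi> \<beta>) = 0" if "\<pi> \<in> perms" "i \<in> I" for \<pi> i
        proof (rule ccontr)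
          assume "r i (rename \<pi> \<alpha>) * r i (rename \<pi> \<beta>) \<noteq> 0"
          then have "mdeg (rename \<pi> \<alpha>) \<le> d" "mdeg (rename \<pi> \<beta>) \<le> d" using deg that(2) by auto
          then show False using False sum(1) that(1) by (auto simp: perms_def mdeg_rename permutes_bij)
        qed
        then show ?thesis using False by (auto simp: Q_def intro!: sum.neutral)
      qed (simp add: Q_def res)
      then show "q (ptype \<alpha> \<beta>) = (\<Sum>\<pi>\<in>perms. (\<Sum>i\<in>I. r i (rename \<pi> \<alpha>) * r i (rename \<pi> \<beta>)) / fact n)"
        using q[OF k] by (simp add: sum_divide_distrib)
    qed
    also have "\<dots> = (\<Sum>\<pi>\<in>perms. (\<Sum>(\<alpha>, \<beta>)\<in>splits \<gamma>. \<Sum>i\<in>I. r i (rename \<pi> \<alpha>) * r i (rename \<pi> \<beta>)) / fact n)"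
      by (simp add: case_prod_beta sum.swap[of _ perms] sum_divide_distrib)
    also have "\<dots> = (\<Sum>\<pi>\<in>perms. lookup f \<gamma> / fact n)"
    proof (rule sum.cong[OF refl])
      fix \<pi> assume "\<pi> \<in> perms"
      then have p: "\<pi> permutes {1..n}" by (simp add: perms_def)
      have "(\<Sum>(\<alpha>, \<beta>)\<in>splits \<gamma>. \<Sum>i\<in>I. r i (rename \<pi> \<alpha>) * r i (rename \<pi> \<beta>)) = lookup f (rename \<pi> \<gamma>)"
        unfolding lookup_f
        by (subst sum.reindex_bij_betw[OF splits_rename[OF permutes_bij[OF p]], symmetric]) (simp add: case_prod_beta)
      also have "\<dots> = lookup f \<gamma>"
        unfolding f_def lookup_power_sum_combination by (simp add: lookup_power_sum_partition_rename[OF p])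
      finally show "(\<Sum>(\<alpha>, \<beta>)\<in>splits \<gamma>. \<Sum>i\<in>I. r i (rename \<pi> \<alpha>) * r i (rename \<pi> \<beta>)) / fact n = lookup f \<gamma> / fact n"
        by simp
    qed
    also have "\<dots> = lookup f \<gamma>"
      using card_permutations[of "{1..n}" n] by (simp add: perms_def)
    also have "\<dots> = (\<Sum>\<mu>\<in>parts m d. c \<mu> * transition \<mu> (mtype \<gamma>))"
      unfolding f_def by (rule lookup_power_sum_combination_eq[OF g(1)])
    finally show "(\<Sum>(\<alpha>, \<beta>)\<in>splits \<gamma>. q (ptype \<alpha> \<beta>)) = (\<Sum>\<mu>\<in>parts m d. c \<mu> * transition \<mu> (mtype \<gamma>))" .
  qed
  then show ?thesis by blast
qed

lemma card_keys_le_mdeg: "card (keys \<alpha>) \<le> mdeg \<alpha>"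
proof -
  have "card (keys \<alpha>) = (\<Sum>i\<in>keys \<alpha>. 1)" by simp
  also have "\<dots> \<le> mdeg \<alpha>" unfolding mdeg_def by (intro sum_mono) (auto simp: in_keys_iff)
  finally show ?thesis .
qed

text \<open>A monomial of degree \<open>d\<close> has at most \<open>d\<close> variables, so by
  symmetry it can be moved into \<open>{1..d}\<close> without changing its diagonal entry. There
  \<open>gram_bound\<close> applies with a set \<open>M\<close> and coefficients \<open>h\<close>
  that do not involve \<open>n\<close>.\<close>

lemma symmetric_gram_bounded:
  assumes m: "m = 1 \<or> m = 2"
  shows "\<exists>B\<ge>0. \<forall>n (X :: 'x set) v q. d \<le> n \<longrightarrow> symmetric_gram n m d c X v q \<longrightarrow>
    (\<forall>\<alpha>. keys \<alpha> \<subseteq> {1..n} \<longrightarrow> (\<Sum>x\<in>X. (v x \<alpha>)\<^sup>2) \<le> B)"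
proof -
  define M where "M = {\<alpha>. keys \<alpha> \<subseteq> {1..d} \<and> mdeg \<alpha> = d}"
  define h where "h = (\<lambda>\<alpha>. \<Sum>\<mu>\<in>parts m d. c \<mu> * transition \<mu> (mtype (\<alpha> + \<alpha>)))"
  \<comment> \<open>The maximum with 0 covers monomials of degree other than \<open>d\<close>, whose
    diagonal entry is 0.\<close>
  define B where "B = max 0 (2 * (\<Sum>\<beta>\<in>M. real (card M + 1) ^ (2 * nsq \<beta>) * h \<beta>))"
  have finM: "finite M" unfolding M_def by (rule finite_monos_mdeg) simp
  have "(\<Sum>x\<in>X. (v x \<alpha>)\<^sup>2) \<le> B"
    if n: "d \<le> n" and sg: "symmetric_gram n m d c X v q" and k: "keys \<alpha> \<subseteq> {1..n}"
    for n X q \<alpha> and v :: "'x \<Rightarrow> mono \<Rightarrow> real"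
  proof -
    have gram: "(\<Sum>x\<in>X. v x \<alpha> * v x \<beta>) = q (ptype \<alpha> \<beta>)" if "keys \<alpha> \<subseteq> {1..n}" "keys \<beta> \<subseteq> {1..n}" for \<alpha> \<beta>
      using sg that by (simp add: symmetric_gram_def)
    have qdeg: "mdeg \<alpha> = d \<and> mdeg \<beta> = d" if "q (ptype \<alpha> \<beta>) \<noteq> 0" for \<alpha> \<beta>
      using sg that unfolding symmetric_gram_def by (metis sum_fst_ptype sum_snd_ptype)
    show ?thesis
    proof (cases "mdeg \<alpha> = d")
      case False
      then have "q (ptype \<alpha> \<alpha>) = 0" using qdeg by blast
      then show ?thesis using gram[OF k k] by (simp add: power2_eq_square B_def)
    next
      case True
      define \<beta> where "\<beta> = mono_at 0 (mtype \<alpha>)"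
      have \<beta>: "mtype \<beta> = mtype \<alpha>" "keys \<beta> \<subseteq> {1..d}"
        using card_keys_le_mdeg[of \<alpha>] True by (auto simp: \<beta>_def mtype_mono_at keys_mono_at)
      have "mdeg \<beta> = d" using \<beta>(1) True by (metis sum_mtype)
      then have "\<beta> \<in> M" using \<beta> by (simp add: M_def)
      have kn: "keys \<gamma> \<subseteq> {1..n}" if "keys \<gamma> \<subseteq> {1..d}" for \<gamma> :: mono
        using that n by (meson atLeastatMost_subset_iff order_refl order_trans)
      have "(\<Sum>x\<in>X. (v x \<beta>)\<^sup>2) \<le> 2 * (\<Sum>\<beta>\<in>M. real (card M + 1) ^ (2 * nsq \<beta>) * h \<beta>)"
      proof (rule gram_bound[OF finM _ _ \<open>\<beta> \<in> M\<close>])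
        fix \<gamma> assume g: "\<gamma> \<in> M"
        have keys: "keys \<alpha> \<subseteq> {1..d}" "keys \<beta> \<subseteq> {1..d}" if "\<alpha> + \<beta> = \<gamma> + \<gamma>" for \<alpha> \<beta>
          using arg_cong[OF that, of keys] g by (auto simp: M_def keys_plus_nat)
        have "mtype (\<gamma> + \<gamma>) \<in> parts m d"
          using g m by (auto simp: mtype_in_parts_iff M_def mdeg_plus lookup_add)
        then have "(\<Sum>(\<alpha>, \<beta>)\<in>splits (\<gamma> + \<gamma>). q (ptype \<alpha> \<beta>)) = h \<gamma>"
          using sg g kn[of "\<gamma> + \<gamma>"] by (simp add: symmetric_gram_def h_def M_def keys_plus_nat)
        moreover have "(\<Sum>(\<alpha>, \<beta>)\<in>splits (\<gamma> + \<gamma>). \<Sum>x\<in>X. v x \<alpha> * v x \<beta>) = (\<Sum>(\<alpha>, \<beta>)\<in>splits (\<gamma> + \<gamma>). q (ptype \<alpha> \<beta>))"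
        proof (intro sum.cong refl, clarify)
          fix \<alpha> \<beta> assume "(\<alpha>, \<beta>) \<in> splits (\<gamma> + \<gamma>)"
          then have "\<alpha> + \<beta> = \<gamma> + \<gamma>" by (simp add: splits_def)
          from keys[OF this] show "(\<Sum>x\<in>X. v x \<alpha> * v x \<beta>) = q (ptype \<alpha> \<beta>)" by (intro gram kn)
        qed
        ultimately show "(\<Sum>(\<alpha>, \<beta>)\<in>splits (\<gamma> + \<gamma>). \<Sum>x\<in>X. v x \<alpha> * v x \<beta>) \<le> h \<gamma>" by simp
        fix \<alpha> \<beta> assume eq: "\<alpha> + \<beta> = \<gamma> + \<gamma>" and "(\<alpha>, \<beta>) \<notin> M \<times> M"
        then have "q (ptype \<alpha> \<beta>) = 0" using qdeg keys[OF eq] by (auto simp: M_def)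
        then show "(\<Sum>x\<in>X. v x \<alpha> * v x \<beta>) = 0" using gram kn keys[OF eq] by simp
      qed
      moreover have "(\<Sum>x\<in>X. (v x \<alpha>)\<^sup>2) = (\<Sum>x\<in>X. (v x \<beta>)\<^sup>2)"
        using gram[OF k k] gram[OF kn kn, OF \<beta>(2) \<beta>(2)] \<beta>(1) by (simp add: power2_eq_square ptype_same)
      ultimately show ?thesis by (simp add: B_def)
    qed
  qed
  moreover have "B \<ge> 0" by (simp add: B_def)
  ultimately show ?thesis by blast
qed

subsection \<open>Realizing cumulants as Gram matrices\<close>

text \<open>Signed sum over all ways to put each exponent of the list either on its common position
  \<open>p\<close>, with sign plus, or on its fresh position \<open>f\<close>, with sign
  minus.\<close>

fun spread :: "nat list \<Rightarrow> nat list \<Rightarrow> nat list \<Rightarrow> mono \<Rightarrow> (mono \<Rightarrow> real) \<Rightarrow> real" where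
  "spread (x # l) (p # ps) (f # fs) \<alpha> V =
     spread l ps fs (\<alpha> + single p x) V - spread l ps fs (\<alpha> + single f x) V"
| "spread _ _ _ \<alpha> V = V \<alpha>"

text \<open>For one list entry, four products arise: both exponents on \<open>p\<close> are joined,
  the other three choices keep them apart. With their signs this is joined minus apart, exactly one
  \<open>diff_op\<close>. The fresh positions of the two vectors must differ, as otherwise the
  fourth product would be joined too.\<close>

lemma spread_gram:
  assumes gram: "\<And>\<alpha> \<beta>. keys \<alpha> \<subseteq> {1..n} \<Longrightarrow> keys \<beta> \<subseteq> {1..n} \<Longrightarrow> (\<Sum>x\<in>X. v x \<alpha> * v x \<beta>) = q (ptype \<alpha> \<beta>)"
    and "length l' = length l" "length ps = length l" "length fs = length l" "length fs' = length l"
    and "0 \<notin> set l" "0 \<notin> set l'" "distinct (ps @ fs @ fs')"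
    and "set (ps @ fs @ fs') \<union> keys \<alpha> \<union> keys \<beta> \<subseteq> {1..n}"
    and "set (ps @ fs @ fs') \<inter> (keys \<alpha> \<union> keys \<beta>) = {}"
  shows "(\<Sum>x\<in>X. spread l ps fs \<alpha> (v x) * spread l' ps fs' \<beta> (v x)) =
    cumulant q (mset (zip l l')) (ptype \<alpha> \<beta>)"
  using assms(2-)
proof (induction l arbitrary: l' ps fs fs' \<alpha> \<beta>)
  case Nil
  then show ?case by (simp add: gram)
next
  case (Cons x l)
  obtain y k where l': "l' = y # k" using Cons.prems by (cases l') auto
  obtain p ps' where ps: "ps = p # ps'" using Cons.prems by (cases ps) auto
  obtain f fs1 where fs: "fs = f # fs1" using Cons.prems by (cases fs) auto
  obtain g fs2 where fs': "fs' = g # fs2" using Cons.prems by (cases fs') auto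
  define S where "S = (\<lambda>a b. \<Sum>x\<in>X. spread l ps' fs1 a (v x) * spread k ps' fs2 b (v x))"
  have IH: "S a b = cumulant q (mset (zip l k)) (ptype a b)"
    if ab: "keys a \<union> keys b \<subseteq> insert p (insert f (insert g (keys \<alpha> \<union> keys \<beta>)))" for a b
  proof -
    have dist: "distinct (ps' @ fs1 @ fs2)" "{p, f, g} \<inter> set (ps' @ fs1 @ fs2) = {}"
      "{p, f, g} \<subseteq> {1..n}" "set (ps' @ fs1 @ fs2) \<subseteq> {1..n}" "keys \<alpha> \<union> keys \<beta> \<subseteq> {1..n}"
      "set (ps' @ fs1 @ fs2) \<inter> (keys \<alpha> \<union> keys \<beta>) = {}"
      using Cons.prems(7-9) unfolding ps fs fs' by auto
    show ?thesis
      unfolding S_def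
    proof (rule Cons.IH)
      show "set (ps' @ fs1 @ fs2) \<union> keys a \<union> keys b \<subseteq> {1..n}"
        using dist(3-5) ab by blast
      show "set (ps' @ fs1 @ fs2) \<inter> (keys a \<union> keys b) = {}"
        using dist(2,6) ab by blast
    qed (use Cons.prems dist(1) in \<open>auto simp: l' ps fs fs'\<close>)
  qed
  have pos: "x > 0" "y > 0" using Cons.prems by (auto simp: l')
  have new: "p \<notin> keys \<alpha> \<union> keys \<beta>" "f \<notin> keys \<alpha> \<union> keys \<beta>" "g \<notin> keys \<alpha> \<union> keys \<beta>" "p \<noteq> f" "p \<noteq> g" "f \<noteq> g"
    using Cons.prems(7,9) by (auto simp: ps fs fs')
  have same: "ptype (\<alpha> + single p x) (\<beta> + single p y) = add_mset (x, y) (ptype \<alpha> \<beta>)"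
    using new pos by (intro ptype_add_single) auto
  have apart: "ptype (\<alpha> + single i x) (\<beta> + single j y) = add_mset (x, 0) (add_mset (0, y) (ptype \<alpha> \<beta>))"
    if "i \<notin> keys \<alpha> \<union> keys \<beta>" "j \<notin> keys \<alpha> \<union> keys \<beta>" "i \<noteq> j" for i j
  proof -
    have "ptype (\<alpha> + single i x) (\<beta> + single j y) = add_mset (x, 0) (ptype \<alpha> (\<beta> + single j y))"
      using that pos by (intro ptype_add_single_left) (auto simp: keys_plus_nat)
    also have "ptype \<alpha> (\<beta> + single j y) = add_mset (0, y) (ptype \<alpha> \<beta>)"
      using that pos by (intro ptype_add_single_right) auto
    finally show ?thesis .
  qed
  have "(\<Sum>z\<in>X. spread (x # l) ps fs \<alpha> (v z) * spread l' ps fs' \<beta> (v z)) =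
      S (\<alpha> + single p x) (\<beta> + single p y) - S (\<alpha> + single p x) (\<beta> + single g y) -
      (S (\<alpha> + single f x) (\<beta> + single p y) - S (\<alpha> + single f x) (\<beta> + single g y))"
    unfolding S_def sum_subtractf[symmetric]
    by (intro sum.cong refl) (simp add: l' ps fs fs' left_diff_distrib right_diff_distrib)
  also have "S (\<alpha> + single p x) (\<beta> + single p y) = cumulant q (mset (zip l k)) (add_mset (x, y) (ptype \<alpha> \<beta>))"
    by (subst IH) (auto simp: keys_plus_nat same)
  also have "S (\<alpha> + single p x) (\<beta> + single g y) =
      cumulant q (mset (zip l k)) (add_mset (x, 0) (add_mset (0, y) (ptype \<alpha> \<beta>)))"
    using new by (subst IH) (auto simp: keys_plus_nat apart)
  also have "S (\<alpha> + single f x) (\<beta> + single p y) =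
      cumulant q (mset (zip l k)) (add_mset (x, 0) (add_mset (0, y) (ptype \<alpha> \<beta>)))"
    using new by (subst IH) (auto simp: keys_plus_nat apart)
  also have "S (\<alpha> + single f x) (\<beta> + single g y) =
      cumulant q (mset (zip l k)) (add_mset (x, 0) (add_mset (0, y) (ptype \<alpha> \<beta>)))"
    using new by (subst IH) (auto simp: keys_plus_nat apart)
  finally show ?case
    by (simp add: l' cumulant_add_mset)
qed

text \<open>Every list entry replaces a vector by a difference of two vectors under the same bound,
  which costs at most a factor 4 in the squared norm.\<close>

lemma spread_bound:
  assumes B: "\<And>\<alpha>. keys \<alpha> \<subseteq> {1..n} \<Longrightarrow> (\<Sum>x\<in>X. (v x \<alpha>)\<^sup>2) \<le> B"
    and "length ps = length l" "length fs = length l" "set (ps @ fs) \<union> keys \<alpha> \<subseteq> {1..n}"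
  shows "(\<Sum>x\<in>X. (spread l ps fs \<alpha> (v x))\<^sup>2) \<le> 4 ^ length l * B"
  using assms(2-)
proof (induction l arbitrary: ps fs \<alpha>)
  case Nil
  then show ?case by (simp add: B)
next
  case (Cons x l)
  obtain p ps' where ps: "ps = p # ps'" using Cons.prems by (cases ps) auto
  obtain f fs' where fs: "fs = f # fs'" using Cons.prems by (cases fs) auto
  have IH: "(\<Sum>z\<in>X. (spread l ps' fs' (\<alpha> + single i x) (v z))\<^sup>2) \<le> 4 ^ length l * B" if "i \<in> {p, f}" for i
  proof (rule Cons.IH)
    show "set (ps' @ fs') \<union> keys (\<alpha> + single i x) \<subseteq> {1..n}"
      using Cons.prems(3) that by (auto simp: ps fs keys_plus_nat split: if_splits)
  qed (use Cons.prems in \<open>auto simp: ps fs\<close>)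
  have "(a - b)\<^sup>2 \<le> 2 * a\<^sup>2 + 2 * b\<^sup>2" for a b :: real
    using zero_le_power2[of "a + b"] by (simp add: power2_eq_square algebra_simps)
  then have "(\<Sum>z\<in>X. (spread (x # l) ps fs \<alpha> (v z))\<^sup>2) \<le>
      (\<Sum>z\<in>X. 2 * (spread l ps' fs' (\<alpha> + single p x) (v z))\<^sup>2 + 2 * (spread l ps' fs' (\<alpha> + single f x) (v z))\<^sup>2)"
    unfolding ps fs spread.simps by (intro sum_mono)
  also have "\<dots> \<le> 4 ^ length (x # l) * B"
    using IH[of p] IH[of f] by (simp add: sum.distrib flip: sum_distrib_left)
  finally show ?case .
qed

text \<open>Vectors for distinct copies \<open>t \<noteq> t'\<close> of the same label have inner product exactly
  \<open>kern q j j\<close>, but a copy has a different inner product with itself; averaging over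
  \<open>N\<close> copies reduces this defect to order \<open>1 / N\<close>.\<close>

lemma kern_nearly_positive:
  fixes A :: "nat list \<times> nat multiset \<Rightarrow> nat list \<times> nat multiset \<Rightarrow> real"
  assumes sg: "symmetric_gram n m d c X v q"
    and n: "d + 2 * d * (card (labels d m) * N) \<le> n" and N: "N \<ge> 2"
    and B0: "B \<ge> 0" and B: "\<And>\<alpha>. keys \<alpha> \<subseteq> {1..n} \<Longrightarrow> (\<Sum>x\<in>X. (v x \<alpha>)\<^sup>2) \<le> B"
    and psd: "\<And>g. (\<Sum>j\<in>labels d m. \<Sum>j'\<in>labels d m. g j * g j' * A j j') \<ge> 0"
    and A0: "\<And>j j'. length (fst j) \<noteq> length (fst j') \<Longrightarrow> A j j' = 0"
  shows "(\<Sum>j\<in>labels d m. \<Sum>j'\<in>labels d m. kern q j j' * A j j') \<ge>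
    - (2 * 4 ^ d * B * (\<Sum>j\<in>labels d m. A j j)) / N"
proof -
  let ?J = "labels d m"
  have gram: "(\<Sum>x\<in>X. v x \<alpha> * v x \<beta>) = q (ptype \<alpha> \<beta>)" if "keys \<alpha> \<subseteq> {1..n}" "keys \<beta> \<subseteq> {1..n}" for \<alpha> \<beta>
    using sg that by (simp add: symmetric_gram_def)
  obtain e where e: "bij_betw e (?J \<times> {..<N}) {0..<card ?J * N}"
    using ex_bij_betw_finite_nat[of "?J \<times> {..<N}"] by (auto simp: card_cartesian_product)
  \<comment> \<open>Variables \<open>1..d\<close> are the common positions. Copy \<open>t\<close> of
    label \<open>j\<close> owns the next free block of \<open>2 * d\<close> variables: its first
    half holds the fresh positions, its second half the remaining exponents.\<close>
  define off where "off = (\<lambda>j t. d + 2 * d * e (j, t))"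
  \<comment> \<open>The positions depend only on the length of the list, so labels of equal length
    share them.\<close>
  define ps where "ps = (\<lambda>j :: nat list \<times> nat multiset. [1..<length (fst j) + 1])"
  define fs where "fs = (\<lambda>j t. [off j t + 1..<off j t + 1 + length (fst j)])"
  define base where "base = (\<lambda>j t. mono_at (off j t + d) (snd j))"
  \<comment> \<open>For lists of equal length the two square roots multiply to the factorial in
    \<open>kern\<close>.\<close>
  define u where "u = (\<lambda>j t x. spread (fst j) (ps j) (fs j t) (base j t) (v x) / sqrt (fact (length (fst j))))"
  have J: "length (fst j) \<le> d" "size (snd j) \<le> d" "0 \<notin> set (fst j)" "0 \<notin># snd j" if "j \<in> ?J" for j
  proof -
    have *: "0 \<notin> set (fst j)" "0 \<notin># snd j" "sum_list (fst j) + sum_mset (snd j) = d"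
      using that by (auto simp: labels_def)
    have "length l \<le> sum_list l" if "0 \<notin> set l" for l :: "nat list"
      using that by (induction l) auto
    moreover have "size M \<le> sum_mset M" if "0 \<notin># M" for M :: "nat multiset"
      using that by (induction M) auto
    ultimately show "length (fst j) \<le> d" "size (snd j) \<le> d" "0 \<notin> set (fst j)" "0 \<notin># snd j"
      using * by fastforce+
  qed
  have blk: "set (ps j) \<subseteq> {1..d}" "set (fs j t) \<subseteq> {off j t + 1..off j t + d}"
    "keys (base j t) \<subseteq> {off j t + d + 1..off j t + 2 * d}" "mtype (base j t) = snd j" if "j \<in> ?J" for j t
    using J[OF that] by (auto simp: ps_def fs_def base_def keys_mono_at mtype_mono_at)
  have off: "d \<le> off j t" "off j t + 2 * d \<le> n" if "j \<in> ?J" "t < N" for j t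
  proof -
    have "e (j, t) < card ?J * N" using e that by (auto simp: bij_betw_def)
    then have "2 * d * (e (j, t) + 1) \<le> 2 * d * (card ?J * N)" by (intro mult_left_mono) auto
    then show "off j t + 2 * d \<le> n" using n by (simp add: off_def)
  qed (simp add: off_def)
  have sep: "{off j t + 1..off j t + 2 * d} \<inter> {off j' t' + 1..off j' t' + 2 * d} = {}"
    if "j \<in> ?J" "j' \<in> ?J" "t < N" "t' < N" "(j, t) \<noteq> (j', t')" for j j' t t'
  proof -
    have "e (j, t) \<noteq> e (j', t')" using e that by (auto simp: bij_betw_def inj_on_def)
    then have "e (j, t) + 1 \<le> e (j', t') \<or> e (j', t') + 1 \<le> e (j, t)" by linarith
    then have "2 * d * (e (j, t) + 1) \<le> 2 * d * e (j', t') \<or> 2 * d * (e (j', t') + 1) \<le> 2 * d * e (j, t)"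
      by (meson mult_le_mono2)
    then show ?thesis by (auto simp: off_def)
  qed
  have uu: "(\<Sum>x\<in>X. u j t x * u j' t' x) = kern q j j'"
    if j: "j \<in> ?J" "j' \<in> ?J" "t < N" "t' < N" "(j, t) \<noteq> (j', t')" and len: "length (fst j) = length (fst j')"
    for j j' t t'
  proof -
    note b = blk(1)[OF j(1)] blk(2-4)[OF j(1), of t] blk(1)[OF j(2)] blk(2-4)[OF j(2), of t']
    have ps': "ps j' = ps j" by (simp add: ps_def len)
    have fsd: "set (fs j t) \<inter> set (fs j' t') = {}" using b(2,6) sep[OF j] by fastforce
    have base_disj: "keys (base j t) \<inter> keys (base j' t') = {}" using b(3,7) sep[OF j] by fastforce
    have cross: "set (fs j t) \<inter> keys (base j' t') = {}" "set (fs j' t') \<inter> keys (base j t) = {}"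
      using b(2,3,6,7) sep[OF j] by fastforce+
    have own: "set (fs j t) \<inter> keys (base j t) = {}" "set (fs j' t') \<inter> keys (base j' t') = {}"
      using b(2,3,6,7) by fastforce+
    have "(\<Sum>x\<in>X. spread (fst j) (ps j) (fs j t) (base j t) (v x) * spread (fst j') (ps j) (fs j' t') (base j' t') (v x)) =
        cumulant q (mset (zip (fst j) (fst j'))) (ptype (base j t) (base j' t'))"
    proof (rule spread_gram[where n = n])
      show "(\<Sum>x\<in>X. v x \<alpha> * v x \<beta>) = q (ptype \<alpha> \<beta>)"
        if "keys \<alpha> \<subseteq> {1..n}" "keys \<beta> \<subseteq> {1..n}" for \<alpha> \<beta>
        using that by (rule gram)
      have low: "set (ps j) \<inter> (set (fs j t) \<union> set (fs j' t') \<union> keys (base j t) \<union> keys (base j' t')) = {}"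
        using b(1-3,6,7) off(1)[OF j(1,3)] off(1)[OF j(2,4)] by fastforce
      have "distinct (ps j)" "distinct (fs j t)" "distinct (fs j' t')" by (simp_all add: ps_def fs_def)
      then show "distinct (ps j @ fs j t @ fs j' t')" using fsd low by auto
      show "set (ps j @ fs j t @ fs j' t') \<inter> (keys (base j t) \<union> keys (base j' t')) = {}"
        unfolding set_append using low cross own by blast
      have "{1..d} \<subseteq> {1..n}" "{off j t + 1..off j t + d} \<subseteq> {1..n}" "{off j' t' + 1..off j' t' + d} \<subseteq> {1..n}"
        "{off j t + d + 1..off j t + 2 * d} \<subseteq> {1..n}" "{off j' t' + d + 1..off j' t' + 2 * d} \<subseteq> {1..n}"
        using off[OF j(1,3)] off[OF j(2,4)] by auto
      then show "set (ps j @ fs j t @ fs j' t') \<union> keys (base j t) \<union> keys (base j' t') \<subseteq> {1..n}"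
        unfolding set_append using b(1-3,6,7) by blast
    qed (use len J[OF j(1)] J[OF j(2)] in \<open>auto simp: ps_def fs_def simp del: upt_Suc\<close>)
    also have "ptype (base j t) (base j' t') = apart (snd j) (snd j')"
      using ptype_disjoint[OF base_disj] b(4,8) by (simp add: apart_def)
    finally show ?thesis
      by (simp add: u_def kern_def ps' len flip: sum_divide_distrib)
  qed
  have u2: "(\<Sum>x\<in>X. (u j t x)\<^sup>2) \<le> 4 ^ d * B" if j: "j \<in> ?J" "t < N" for j t
  proof -
    have "{1..d} \<subseteq> {1..n}" "{off j t + 1..off j t + d} \<subseteq> {1..n}" "{off j t + d + 1..off j t + 2 * d} \<subseteq> {1..n}"
      using off[OF j] by auto
    then have "set (ps j @ fs j t) \<union> keys (base j t) \<subseteq> {1..n}"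
      unfolding set_append using blk(1)[OF j(1)] blk(2,3)[OF j(1), of t] by blast
    then have "(\<Sum>x\<in>X. (spread (fst j) (ps j) (fs j t) (base j t) (v x))\<^sup>2) \<le> 4 ^ length (fst j) * B"
      by (intro spread_bound[where n = n] B) (auto simp: ps_def fs_def simp del: upt_Suc)
    also have "\<dots> \<le> 4 ^ d * B" using J(1)[OF j(1)] B0 by (intro mult_right_mono power_increasing) auto
    finally have le: "(\<Sum>x\<in>X. (spread (fst j) (ps j) (fs j t) (base j t) (v x))\<^sup>2) \<le> 4 ^ d * B" .
    have "(\<Sum>x\<in>X. (u j t x)\<^sup>2) = (\<Sum>x\<in>X. (spread (fst j) (ps j) (fs j t) (base j t) (v x))\<^sup>2) / fact (length (fst j))"
      by (simp add: u_def power_divide sum_divide_distrib)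
    also have "\<dots> \<le> (\<Sum>x\<in>X. (spread (fst j) (ps j) (fs j t) (base j t) (v x))\<^sup>2) / 1"
      by (intro divide_left_mono) (auto simp: sum_nonneg fact_ge_1)
    finally show ?thesis using le by simp
  qed
  \<comment> \<open>The diagonal entry is an inner product of two different copies;
    \<open>N \<ge> 2\<close> supplies copies 0 and 1.\<close>
  have kern_ge: "- kern q j j \<le> 4 ^ d * B" if j: "j \<in> ?J" for j
  proof -
    have "- kern q j j = (\<Sum>x\<in>X. - (u j 0 x * u j 1 x))"
      using uu[OF j j, of 0 1] N by (simp add: sum_negf)
    also have "\<dots> \<le> (\<Sum>x\<in>X. ((u j 0 x)\<^sup>2 + (u j 1 x)\<^sup>2) / 2)"
    proof (rule sum_mono)
      fix x show "- (u j 0 x * u j 1 x) \<le> ((u j 0 x)\<^sup>2 + (u j 1 x)\<^sup>2) / 2"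
        using zero_le_power2[of "u j 0 x + u j 1 x"] by (simp add: power2_eq_square algebra_simps)
    qed
    also have "\<dots> = ((\<Sum>x\<in>X. (u j 0 x)\<^sup>2) + (\<Sum>x\<in>X. (u j 1 x)\<^sup>2)) / 2"
      by (simp add: sum.distrib flip: sum_divide_distrib)
    also have "\<dots> \<le> 4 ^ d * B" using u2[OF j, of 0] u2[OF j, of 1] N by simp
    finally show ?thesis .
  qed
  define U where "U = (\<lambda>j x. \<Sum>t<N. u j t x)"
  define defect where "defect = (\<lambda>j. \<Sum>t<N. (\<Sum>x\<in>X. (u j t x)\<^sup>2) - kern q j j)"
  \<comment> \<open>Of the \<open>N\<^sup>2\<close> pairs of copies only the \<open>N\<close> pairs
    with \<open>j = j'\<close> and \<open>t = t'\<close> deviate from \<open>kern q j j'\<close>;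
    they make up \<open>defect\<close>.\<close>
  have UU: "(\<Sum>x\<in>X. U j x * U j' x) = (real N)\<^sup>2 * kern q j j' + (if j = j' then defect j else 0)"
    if j: "j \<in> ?J" "j' \<in> ?J" and len: "length (fst j) = length (fst j')" for j j'
  proof -
    have "(\<Sum>x\<in>X. U j x * U j' x) = (\<Sum>x\<in>X. \<Sum>t<N. \<Sum>t'<N. u j t x * u j' t' x)"
      by (simp add: U_def sum_product)
    also have "\<dots> = (\<Sum>t<N. \<Sum>x\<in>X. \<Sum>t'<N. u j t x * u j' t' x)"
      by (rule sum.swap)
    also have "\<dots> = (\<Sum>t<N. \<Sum>t'<N. \<Sum>x\<in>X. u j t x * u j' t' x)"
      by (intro sum.cong refl, rule sum.swap)
    also have "\<dots> = (\<Sum>t<N. \<Sum>t'<N. kern q j j' +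
        (if t' = t then (if j = j' then (\<Sum>x\<in>X. (u j t x)\<^sup>2) - kern q j j else 0) else 0))"
    proof (intro sum.cong refl)
      fix t t' assume "t \<in> {..<N}" "t' \<in> {..<N}"
      then show "(\<Sum>x\<in>X. u j t x * u j' t' x) = kern q j j' +
        (if t' = t then (if j = j' then (\<Sum>x\<in>X. (u j t x)\<^sup>2) - kern q j j else 0) else 0)"
        using uu[OF j, of t t'] len by (cases "(j, t) = (j', t')") (auto simp: power2_eq_square)
    qed
    also have "\<dots> = (real N)\<^sup>2 * kern q j j' + (if j = j' then defect j else 0)"
      by (simp add: sum.distrib defect_def power2_eq_square mult.assoc)
    finally show ?thesis .
  qed
  have A_diag: "A j j \<ge> 0" if j: "j \<in> ?J" for j
  proof -
    have "(\<Sum>i\<in>?J. \<Sum>i'\<in>?J. (if i = j then 1 else 0) * (if i' = j then 1 else 0) * A i i') =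
        (\<Sum>i\<in>?J. \<Sum>i'\<in>?J. if i' = j then (if i = j then A j j else 0) else 0)"
      by (intro sum.cong refl) auto
    also have "\<dots> = A j j" using j by simp
    finally show ?thesis using psd[of "\<lambda>i. if i = j then 1 else 0"] by simp
  qed
  \<comment> \<open>Positivity of \<open>A\<close> is used at the vector
    \<open>\<lambda>j. U j x\<close> for each \<open>x\<close>; summing over \<open>x\<close> gives
    the trace of the Gram matrix of the \<open>U j\<close> against \<open>A\<close>.\<close>
  have "0 \<le> (\<Sum>x\<in>X. \<Sum>j\<in>?J. \<Sum>j'\<in>?J. U j x * U j' x * A j j')"
    by (intro sum_nonneg psd)
  also have "\<dots> = (\<Sum>j\<in>?J. \<Sum>x\<in>X. \<Sum>j'\<in>?J. U j x * U j' x * A j j')"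
    by (rule sum.swap)
  also have "\<dots> = (\<Sum>j\<in>?J. \<Sum>j'\<in>?J. \<Sum>x\<in>X. U j x * U j' x * A j j')"
    by (intro sum.cong refl, rule sum.swap)
  also have "\<dots> = (\<Sum>j\<in>?J. \<Sum>j'\<in>?J. (real N)\<^sup>2 * (kern q j j' * A j j') + (if j' = j then defect j * A j j else 0))"
  proof (intro sum.cong refl)
    fix j j' assume j: "j \<in> ?J" "j' \<in> ?J"
    show "(\<Sum>x\<in>X. U j x * U j' x * A j j') =
        (real N)\<^sup>2 * (kern q j j' * A j j') + (if j' = j then defect j * A j j else 0)"
    proof (cases "length (fst j) = length (fst j')")
      case True
      have "(\<Sum>x\<in>X. U j x * U j' x * A j j') = (\<Sum>x\<in>X. U j x * U j' x) * A j j'"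
        by (simp add: sum_distrib_right)
      then show ?thesis unfolding UU[OF j True] by (auto simp: algebra_simps)
    next
      case False
      then show ?thesis using A0[OF False] by auto
    qed
  qed
  also have "\<dots> = (real N)\<^sup>2 * (\<Sum>j\<in>?J. \<Sum>j'\<in>?J. kern q j j' * A j j') + (\<Sum>j\<in>?J. defect j * A j j)"
    by (simp add: sum.distrib sum_distrib_left)
  \<comment> \<open>The defect grows linearly in \<open>N\<close> while the main term carries
    \<open>N\<^sup>2\<close>; dividing leaves the error of order \<open>1 / N\<close>.\<close>
  also have "(\<Sum>j\<in>?J. defect j * A j j) \<le> (\<Sum>j\<in>?J. real N * (2 * 4 ^ d * B) * A j j)"
  proof (intro sum_mono mult_right_mono A_diag)
    fix j assume j: "j \<in> ?J"
    have "defect j \<le> (\<Sum>t<N. 2 * 4 ^ d * B)"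
      unfolding defect_def
    proof (rule sum_mono)
      fix t assume "t \<in> {..<N}"
      then show "(\<Sum>x\<in>X. (u j t x)\<^sup>2) - kern q j j \<le> 2 * 4 ^ d * B"
        using u2[OF j, of t] kern_ge[OF j] by simp
    qed
    then show "defect j \<le> real N * (2 * 4 ^ d * B)" by simp
  qed
  also have "\<dots> = real N * (2 * 4 ^ d * B * (\<Sum>j\<in>?J. A j j))"
    by (simp add: sum_distrib_left mult.assoc)
  finally have "0 \<le> real N * (real N * (\<Sum>j\<in>?J. \<Sum>j'\<in>?J. kern q j j' * A j j') + 2 * 4 ^ d * B * (\<Sum>j\<in>?J. A j j))"
    by (simp add: power2_eq_square algebra_simps)
  then have "0 \<le> real N * (\<Sum>j\<in>?J. \<Sum>j'\<in>?J. kern q j j' * A j j') + 2 * 4 ^ d * B * (\<Sum>j\<in>?J. A j j)"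
    using N by (simp add: zero_le_mult_iff)
  then have "- (2 * 4 ^ d * B * (\<Sum>j\<in>?J. A j j)) \<le> (\<Sum>j\<in>?J. \<Sum>j'\<in>?J. kern q j j' * A j j') * real N"
    unfolding mult.commute[of _ "real N"] by linarith
  moreover have "0 < real N" using N by simp
  ultimately show ?thesis
    by (simp only: pos_divide_le_eq)
qed

text \<open>Restricting the expansion to \<open>labels d m\<close> loses nothing. A remaining
  exponent not divisible by \<open>m\<close> would be paired with 0 in every multiset entering the
  cumulant, where \<open>q\<close> vanishes; other degrees contribute 0 on both sides.\<close>

lemma pair_sum_kern:
  assumes sg: "symmetric_gram n m d c X v q"
  defines "G \<equiv> \<lambda>j j'. if j \<in> labels d m \<and> j' \<in> labels d m then kern q j j' else 0"
  shows "pair_sum G \<gamma> = (\<Sum>(\<alpha>, \<beta>)\<in>splits \<gamma>. q (ptype \<alpha> \<beta>))"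
  unfolding pair_sum_def
proof (intro sum.cong refl, clarify)
  fix \<alpha> \<beta>
  have q: "sum_mset (image_mset fst P) = d" "sum_mset (image_mset snd P) = d"
    "\<And>z. z \<in># P \<Longrightarrow> fst z mod m = snd z mod m" if "q P \<noteq> 0" for P
    using sg that by (auto simp: symmetric_gram_def)
  show "(\<Sum>ps\<in>arrangements (keys \<alpha> \<inter> keys \<beta>). G (label \<alpha> ps) (label \<beta> ps)) = q (ptype \<alpha> \<beta>)"
  proof (cases "mdeg \<alpha> = d \<and> mdeg \<beta> = d")
    case True
    have "G (label \<alpha> ps) (label \<beta> ps) = kern q (label \<alpha> ps) (label \<beta> ps)"
      if "ps \<in> arrangements (keys \<alpha> \<inter> keys \<beta>)" for ps
    proof (cases "label \<alpha> ps \<in> labels d m \<and> label \<beta> ps \<in> labels d m")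
      case False
      have "ps \<in> arrangements (keys \<alpha>)" "ps \<in> arrangements (keys \<beta>)"
        using that by (auto simp: arrangements_def)
      then consider i where "i \<in> keys \<alpha> - set ps" "\<not> m dvd lookup \<alpha> i"
        | i where "i \<in> keys \<beta> - set ps" "\<not> m dvd lookup \<beta> i"
        using False True label_in_labels_iff by blast
      then obtain z where z: "z \<in># apart (snd (label \<alpha> ps)) (snd (label \<beta> ps))" "fst z mod m \<noteq> snd z mod m"
      proof cases
        case (1 i)
        show thesis
          by (rule that[of "(lookup \<alpha> i, 0)"]) (use 1 in \<open>auto simp: apart_def label_def mod_eq_0_iff_dvd\<close>)
      next
        case (2 i)
        show thesis
          by (rule that[of "(0, lookup \<beta> i)"]) (use 2 in \<open>auto simp: apart_def label_def dvd_eq_mod_eq_0\<close>)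
      qed
      have "q P' = 0" if "apart (snd (label \<alpha> ps)) (snd (label \<beta> ps)) \<subseteq># P'" for P'
        using q(3)[of P' z] z mset_subset_eqD[OF that z(1)] by blast
      then have "kern q (label \<alpha> ps) (label \<beta> ps) = 0"
        by (simp add: kern_def cumulant_eq_0)
      then show ?thesis by (simp add: G_def)
    qed (simp add: G_def)
    then show ?thesis unfolding kern_expansion by (intro sum.cong refl)
  next
    case False
    have "G (label \<alpha> ps) (label \<beta> ps) = 0" if "ps \<in> arrangements (keys \<alpha> \<inter> keys \<beta>)" for ps
    proof -
      have "ps \<in> arrangements (keys \<alpha>)" "ps \<in> arrangements (keys \<beta>)"
        using that by (auto simp: arrangements_def)
      from this[THEN label_in_labels_iff[of _ _ d m]] show ?thesis using False by (auto simp: G_def)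
    qed
    moreover have "q (ptype \<alpha> \<beta>) = 0"
      using q(1,2)[of "ptype \<alpha> \<beta>"] False by (auto simp: sum_fst_ptype sum_snd_ptype)
    ultimately show ?thesis by simp
  qed
qed

subsection \<open>The dual cones\<close>

text \<open>The constant \<open>K\<close> depends on \<open>c\<close> and \<open>\<psi>\<close> but
  not on \<open>N\<close>. Since \<open>c\<close> gives sums of squares for all large
  \<open>n\<close>, the estimate \<open>S \<ge> - K / N\<close> holds for every
  \<open>N \<ge> 2\<close>, and the Archimedean property concludes.\<close>

lemma pairing_nonneg:
  assumes m: "m = 1 \<or> m = 2"
    and dual: "\<And>\<mu>. \<mu> \<in> parts m d \<Longrightarrow> (\<Sum>\<nu>\<in>parts m d. transition \<mu> \<nu> * \<psi> \<nu>) = \<phi> \<mu>"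
    and psd: "\<And>g. (\<Sum>j\<in>labels d m. \<Sum>j'\<in>labels d m. g j * g j' * moment_form m d \<psi> j j') \<ge> 0"
    and c: "c \<in> stable_sos (parts m d) (2 * d)"
  shows "(\<Sum>\<mu>\<in>parts m d. c \<mu> * \<phi> \<mu>) \<ge> 0"
proof -
  let ?J = "labels d m" and ?A = "moment_form m d \<psi>"
  define S where "S = (\<Sum>\<mu>\<in>parts m d. c \<mu> * \<phi> \<mu>)"
  obtain B where B0: "B \<ge> 0" and B: "\<And>n (X :: ((nat \<Rightarrow> nat) \<times> nat \<times> (nat \<Rightarrow> nat)) set) v q \<alpha>. d \<le> n \<Longrightarrow>
      symmetric_gram n m d c X v q \<Longrightarrow> keys \<alpha> \<subseteq> {1..n} \<Longrightarrow> (\<Sum>x\<in>X. (v x \<alpha>)\<^sup>2) \<le> B"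
    using symmetric_gram_bounded[OF m, of d c] by blast
  define K where "K = 2 * 4 ^ d * B * (\<Sum>j\<in>?J. ?A j j)"
  have main: "S \<ge> - K / N" if N: "N \<ge> 2" for N :: nat
  proof -
    \<comment> \<open>The first two summands provide the common positions and the blocks for all
      copies. The last one ensures \<open>n \<ge> 2 * d\<close>, so that every type in
      \<open>parts m d\<close> fits into \<open>n\<close> variables and the stability of
      \<open>c\<close> applies.\<close>
    define n where "n = d + 2 * d * (card ?J * N) + 2 * d"
    have "sum_of_squares_in n (\<Sum>\<mu>\<in>parts m d. Const (c \<mu>) * power_sum_partition n \<mu>)"
      using c by (simp add: stable_sos_def n_def)
    then obtain X :: "((nat \<Rightarrow> nat) \<times> nat \<times> (nat \<Rightarrow> nat)) set" and v q where sg: "symmetric_gram n m d c X v q"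
      using exists_symmetric_gram[OF m] by blast
    define G where "G = (\<lambda>j j'. if j \<in> ?J \<and> j' \<in> ?J then kern q j j' else 0)"
    have "pair_sum G (mono_at 0 \<nu>) = (\<Sum>\<mu>\<in>parts m d. c \<mu> * transition \<mu> \<nu>)" if \<nu>: "\<nu> \<in> parts m d" for \<nu>
    proof -
      have mt: "mtype (mono_at 0 \<nu>) = \<nu>" using \<nu> by (simp add: mtype_mono_at zero_notin_parts)
      then have "mdeg (mono_at 0 \<nu>) = 2 * d" using \<nu> mtype_in_parts_iff by metis
      then have "size \<nu> \<le> 2 * d" using card_keys_le_mdeg[of "mono_at 0 \<nu>"] size_mtype[of "mono_at 0 \<nu>"] mt by simp
      then have "keys (mono_at 0 \<nu>) \<subseteq> {1..n}" using \<nu> by (simp add: keys_mono_at zero_notin_parts n_def)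
      moreover have "(\<Sum>(\<alpha>, \<beta>)\<in>splits \<gamma>. q (ptype \<alpha> \<beta>)) = (\<Sum>\<mu>\<in>parts m d. c \<mu> * transition \<mu> (mtype \<gamma>))"
        if "keys \<gamma> \<subseteq> {1..n}" "mtype \<gamma> \<in> parts m d" for \<gamma>
        using sg that by (simp add: symmetric_gram_def)
      ultimately show ?thesis
        using \<nu> unfolding G_def pair_sum_kern[OF sg] by (simp only: mt)
    qed
    then have "S = (\<Sum>\<nu>\<in>parts m d. pair_sum G (mono_at 0 \<nu>) * \<psi> \<nu>)"
      unfolding S_def by (intro pairing_change_coordinates[OF dual]) auto
    also have "\<dots> = (\<Sum>j\<in>?J. \<Sum>j'\<in>?J. G j j' * ?A j j')"
      by (rule moment_form_sum[symmetric]) (auto simp: G_def split: if_splits)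
    also have "\<dots> = (\<Sum>j\<in>?J. \<Sum>j'\<in>?J. kern q j j' * ?A j j')"
      by (intro sum.cong refl) (simp add: G_def)
    also have "\<dots> \<ge> - K / N"
      unfolding K_def
      by (rule kern_nearly_positive[OF sg _ N B0 B[OF _ sg] psd moment_form_eq_0]) (auto simp: n_def)
    finally show ?thesis .
  qed
  show ?thesis
  proof (rule ccontr)
    assume "\<not> ?thesis"
    then have S: "S < 0" by (simp add: S_def)
    obtain N :: nat where N: "K / (- S) < N" using reals_Archimedean2 by blast
    define N' where "N' = max N 2"
    have "K / (- S) < N'" using N by (simp add: N'_def)
    then have "K < N' * (- S)" using S pos_divide_less_eq[of "- S" K N'] by simp
    moreover have "0 < real N'" by (simp add: N'_def)
    then have "- K \<le> S * N'"
      using main[of N'] pos_divide_le_eq[of "real N'" "- K" S] by (simp add: N'_def)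
    ultimately show False by (simp add: mult.commute)
  qed
qed

lemma spectrahedral_dual_stable_sos:
  assumes m: "m = 1 \<or> m = 2"
  shows "spectrahedral_cone (parts m d) (dual_cone (parts m d) (stable_sos (parts m d) (2 * d)))"
proof -
  let ?J = "labels d m" and ?\<Lambda> = "parts m d"
  obtain D where D: "\<And>(\<phi> :: nat multiset \<Rightarrow> real) \<mu>. \<mu> \<in> ?\<Lambda> \<Longrightarrow>
      (\<Sum>\<nu>\<in>?\<Lambda>. transition \<mu> \<nu> * (\<Sum>\<mu>'\<in>?\<Lambda>. D \<nu> \<mu>' * \<phi> \<mu>')) = \<phi> \<mu>"
    using exists_dual_coordinates[of m d] by blast
  define \<psi> where "\<psi> = (\<lambda>\<phi> \<nu>. \<Sum>\<mu>'\<in>?\<Lambda>. D \<nu> \<mu>' * \<phi> \<mu>')"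
  have D': "(\<Sum>\<nu>\<in>?\<Lambda>. transition \<mu> \<nu> * \<psi> \<phi> \<nu>) = \<phi> \<mu>" if "\<mu> \<in> ?\<Lambda>" for \<mu> \<phi>
    unfolding \<psi>_def by (rule D[OF that])
  show ?thesis
  proof (rule spectrahedral_coneI[where A = "\<lambda>\<phi>. moment_form m d (\<psi> \<phi>)" and J = ?J])
    have coord: "linear_form_on ?\<Lambda> (\<lambda>\<phi>. \<phi> \<mu>)" if "\<mu> \<in> ?\<Lambda>" for \<mu>
      unfolding linear_form_on_def
      by (rule exI[of _ "\<lambda>i. if i = \<mu> then 1 else 0"]) (use that in \<open>simp add: if_distrib[of "\<lambda>x. x * _"] cong: if_cong\<close>)
    show "linear_form_on ?\<Lambda> (\<lambda>\<phi>. moment_form m d (\<psi> \<phi>) j j')" for j j'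
      unfolding moment_form_def \<psi>_def by (intro linear_form_on_lincomb coord)
    show "dual_cone ?\<Lambda> (stable_sos ?\<Lambda> (2 * d)) =
        {\<phi> \<in> coord_space ?\<Lambda>. \<forall>g. 0 \<le> (\<Sum>j\<in>?J. \<Sum>j'\<in>?J. g j * g j' * moment_form m d (\<psi> \<phi>) j j')}"
    proof (intro subset_antisym subsetI CollectI conjI allI)
      fix \<phi> assume \<phi>: "\<phi> \<in> dual_cone ?\<Lambda> (stable_sos ?\<Lambda> (2 * d))"
      then show "\<phi> \<in> coord_space ?\<Lambda>" by (simp add: dual_cone_def)
      fix g :: "nat list \<times> nat multiset \<Rightarrow> real"
      define G where "G = (\<lambda>j j'. if j \<in> ?J \<and> j' \<in> ?J then g j * g j' else 0)"
      obtain c where c: "c \<in> stable_sos ?\<Lambda> (2 * d)"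
        "\<And>\<nu>. \<nu> \<in> ?\<Lambda> \<Longrightarrow> (\<Sum>\<mu>\<in>?\<Lambda>. c \<mu> * transition \<mu> \<nu>) = pair_sum G (mono_at 0 \<nu>)"
        using exists_stable_sos_with_pair_sum[OF m, of d g] unfolding G_def by blast
      have "0 \<le> (\<Sum>\<mu>\<in>?\<Lambda>. c \<mu> * \<phi> \<mu>)" using \<phi> c(1) by (simp add: dual_cone_def)
      also have "\<dots> = (\<Sum>\<nu>\<in>?\<Lambda>. pair_sum G (mono_at 0 \<nu>) * \<psi> \<phi> \<nu>)"
        by (rule pairing_change_coordinates[OF D' c(2)])
      also have "\<dots> = (\<Sum>j\<in>?J. \<Sum>j'\<in>?J. G j j' * moment_form m d (\<psi> \<phi>) j j')"
        by (rule moment_form_sum[symmetric]) (auto simp: G_def split: if_splits)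
      also have "\<dots> = (\<Sum>j\<in>?J. \<Sum>j'\<in>?J. g j * g j' * moment_form m d (\<psi> \<phi>) j j')"
        by (intro sum.cong refl) (simp add: G_def)
      finally show "0 \<le> (\<Sum>j\<in>?J. \<Sum>j'\<in>?J. g j * g j' * moment_form m d (\<psi> \<phi>) j j')" .
    next
      fix \<phi> assume \<phi>: "\<phi> \<in> {\<phi> \<in> coord_space ?\<Lambda>. \<forall>g. 0 \<le> (\<Sum>j\<in>?J. \<Sum>j'\<in>?J. g j * g j' * moment_form m d (\<psi> \<phi>) j j')}"
      then have "0 \<le> (\<Sum>\<mu>\<in>?\<Lambda>. c \<mu> * \<phi> \<mu>)" if "c \<in> stable_sos ?\<Lambda> (2 * d)" for c
        by (intro pairing_nonneg[OF m D' _ that]) auto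
      then show "\<phi> \<in> dual_cone ?\<Lambda> (stable_sos ?\<Lambda> (2 * d))" using \<phi> by (simp add: dual_cone_def)
    qed
  qed simp
qed

theorem propositionA6:
  fixes d :: nat
  shows "spectrahedral_cone (partitions_of (2 * d))
           (dual_cone (partitions_of (2 * d)) (S_Sigma (2 * d)))
       \<and> spectrahedral_cone (even_partitions_of (2 * d))
           (dual_cone (even_partitions_of (2 * d)) (B_Sigma (2 * d)))"
proof -
  have "partitions_of (2 * d) = parts 1 d" "even_partitions_of (2 * d) = parts 2 d"
    by (auto simp: parts_def even_partitions_of_def)
  then show ?thesis
    using spectrahedral_dual_stable_sos[of 1 d] spectrahedral_dual_stable_sos[of 2 d]
    by (simp add: S_Sigma_def B_Sigma_def)
qed

end
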